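(* Consider the multi-armed bandit model described in the context, with discount rate $q>0$, and assume the integrability condition $\mathbb{E}\big[\sum_{s=0}^\infty |X^j_s|\int_{T^j_s}^{T^j_{s+1}} e^{-qr}\,{\rm d}r\big]<\infty$ for every $j\in\mathcal{J}$. Then the Gittins index strategy, which at the onset of each period $t\in\mathbb{N}_0$ operates an arm in $\arg\max_{j\in\mathcal{J}}\Gamma^j_{\pi^j(t)}$, is optimal, i.e. it attains $\sup_{\pi\in\Pi}V(\pi)$.
   Context: There are $J\in\mathbb{N}$ arms, $\mathcal{J}=\{1,\dots,J\}$, on a complete probability space $(\Omega,\mathcal{F},\mathbb{P})$. Arm $j$ is associated with a sequence $\{X^j_s,W^j_s,\mathcal{F}^j_s; s\in\mathbb{N}_0\}$, where $\mathbb{F}^j=(\mathcal{F}^j_s)_{s\ge0}$ is a $\mathbb{P}$-completed filtration, $X^j_s$ is real-valued and $\mathcal{F}^j_s$-measurable (the reward when arm $j$ is selected after $s$ previous operations), and $(W^j_s)_{s\in\mathbb{N}_0}$ is an i.i.d. sequence of strictly positive random variables with common law $G^j$, with $W^j_s$ independent of $\mathcal{F}^j_s$ but $\mathcal{F}^j_{s+1}$-measurable. The $\sigma$-algebras $\mathcal{F}^j:=\bigvee_{s}\mathcal{F}^j_s$, $j\in\mathcal{J}$, are independent. Let $T^j_0=0$ and $T^j_s=W^j_0+\dots+W^j_{s-1}$ for $s\ge1$. A strategy is an $\mathbb{N}_0^J$-valued process $\pi(t)=(\pi^1(t),\dots,\pi^J(t))$, $t\in\mathbb{N}_0$ ($\pi^j(t)$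 = number of times arm $j$ was selected in periods $0,\dots,t-1$), with $\pi(0)=0$, $\pi^1(t)+\dots+\pi^J(t)=t$, $\pi(t+1)=\pi(t)+\mathbf{e}_j$ for some $j$ (with $\mathbf{e}_j$ the $j$-th unit vector), and $\{\pi(t)=\mathbf{s}\}\in\mathcal{F}_{\mathbf{s}}:=\mathcal{F}^1_{s^1}\vee\dots\vee\mathcal{F}^J_{s^J}$ for all $\mathbf{s}=(s^1,\dots,s^J)\in\mathbb{N}_0^J$; $\Pi$ is the set of such strategies. Let $\mathrm{j}_t$ be the arm selected in period $t$ (so $\pi(t+1)=\pi(t)+\mathbf{e}_{\mathrm{j}_t}$), $\mathcal{W}_t:=W^{\mathrm{j}_t}_{\pi^{\mathrm{j}_t}(t)}$, $\mathcal{T}_0=0$, $\mathcal{T}_t=\mathcal{W}_0+\dots+\mathcal{W}_{t-1}$, $\mathcal{X}_t:=X^{\mathrm{j}_t}_{\pi^{\mathrm{j}_t}(t)}$, and $V(\pi)=\mathbb{E}^\pi\big[\sum_{t=0}^\infty \mathcal{X}_t\int_{\mathcal{T}_t}^{\mathcal{T}_{t+1}}e^{-qr}{\rm d}r\,\big|\,\mathcal{F}_{\pi(0)}\big]$. The Gittins index process of arm $j$ is $\Gamma^j_s:=\operatorname{ess\,sup}_{\tau>s}\dfrac{\mathbb{E}\big[\sum_{u=s}^{\tau-1}e^{-qT^j_u}X^j_u\,|\,\mathcal{F}^j_s\big]}{\mathbb{E}\big[\sum_{u=s}^{\tau-1}e^{-qT^j_u}\,|\,\mathcal{F}^j_s\big]}$,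 $s\in\mathbb{N}_0$, the supremum over $\mathbb{F}^j$-stopping times $\tau>s$. *)

theory Defs
  imports "HOL-Probability.Probability"
begin

text \<open>Arms are indexed by {..<J} (i.e. 0,...,J-1 instead of 1,...,J).
  F j s is the sigma-algebra F^j_s (a sub-measure of M), X j s, W j s the
  reward and duration variables of arm j at its s-th operation.\<close>

definition arm_time :: "(nat \<Rightarrow> nat \<Rightarrow> 'a \<Rightarrow> real) \<Rightarrow> nat \<Rightarrow> nat \<Rightarrow> 'a \<Rightarrow> real" where
  "arm_time W j s \<omega> = (\<Sum>u<s. W j u \<omega>)"

definition disc_int :: "real \<Rightarrow> real \<Rightarrow> real \<Rightarrow> real" where
  "disc_int q a b = integral {a..b} (\<lambda>r. exp (- q * r))"

definition joint_sigma :: "'a measure \<Rightarrow> (nat \<Rightarrow> nat \<Rightarrow> 'a measure) \<Rightarrow> nat \<Rightarrow> (nat \<Rightarrow> nat) \<Rightarrow> 'a measure" where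
  "joint_sigma M F J s = sigma (space M) (\<Union>j<J. sets (F j (s j)))"

definition is_stopping_time :: "'a measure \<Rightarrow> (nat \<Rightarrow> 'a measure) \<Rightarrow> ('a \<Rightarrow> enat) \<Rightarrow> bool" where
  "is_stopping_time M Fj \<tau> \<longleftrightarrow> (\<forall>n::nat. {\<omega> \<in> space M. \<tau> \<omega> = enat n} \<in> sets (Fj n))"

definition gittins_ratio ::
  "'a measure \<Rightarrow> real \<Rightarrow> (nat \<Rightarrow> nat \<Rightarrow> 'a measure) \<Rightarrow> (nat \<Rightarrow> nat \<Rightarrow> 'a \<Rightarrow> real)
    \<Rightarrow> (nat \<Rightarrow> nat \<Rightarrow> 'a \<Rightarrow> real) \<Rightarrow> nat \<Rightarrow> nat \<Rightarrow> ('a \<Rightarrow> enat) \<Rightarrow> 'a \<Rightarrow> real" where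
  "gittins_ratio M q F X W j s \<tau> \<omega> =
     real_cond_exp M (F j s)
       (\<lambda>\<omega>'. \<Sum>u. (if s \<le> u \<and> enat u < \<tau> \<omega>' then exp (- q * arm_time W j u \<omega>') * X j u \<omega>' else 0)) \<omega>
   / real_cond_exp M (F j s)
       (\<lambda>\<omega>'. \<Sum>u. (if s \<le> u \<and> enat u < \<tau> \<omega>' then exp (- q * arm_time W j u \<omega>') else 0)) \<omega>"

definition is_ess_sup :: "'a measure \<Rightarrow> 'i set \<Rightarrow> ('i \<Rightarrow> 'a \<Rightarrow> ereal) \<Rightarrow> ('a \<Rightarrow> ereal) \<Rightarrow> bool" where
  "is_ess_sup M I Y Z \<longleftrightarrow>
     Z \<in> borel_measurable M \<and>
     (\<forall>i\<in>I. AE \<omega> in M. Y i \<omega> \<le> Z \<omega>) \<and>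
     (\<forall>Z'. Z' \<in> borel_measurable M \<longrightarrow> (\<forall>i\<in>I. AE \<omega> in M. Y i \<omega> \<le> Z' \<omega>)
            \<longrightarrow> (AE \<omega> in M. Z \<omega> \<le> Z' \<omega>))"

definition is_gittins_index ::
  "'a measure \<Rightarrow> real \<Rightarrow> (nat \<Rightarrow> nat \<Rightarrow> 'a measure) \<Rightarrow> (nat \<Rightarrow> nat \<Rightarrow> 'a \<Rightarrow> real)
    \<Rightarrow> (nat \<Rightarrow> nat \<Rightarrow> 'a \<Rightarrow> real) \<Rightarrow> nat \<Rightarrow> (nat \<Rightarrow> 'a \<Rightarrow> ereal) \<Rightarrow> bool" where
  "is_gittins_index M q F X W j \<Gamma> \<longleftrightarrow>
     (\<forall>s. \<Gamma> s \<in> borel_measurable (F j s) \<and>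
          is_ess_sup M {\<tau>. is_stopping_time M (F j) \<tau> \<and> (\<forall>\<omega>\<in>space M. enat s < \<tau> \<omega>)}
            (\<lambda>\<tau> \<omega>. ereal (gittins_ratio M q F X W j s \<tau> \<omega>)) (\<Gamma> s))"

definition is_strategy :: "'a measure \<Rightarrow> (nat \<Rightarrow> nat \<Rightarrow> 'a measure) \<Rightarrow> nat
    \<Rightarrow> (nat \<Rightarrow> 'a \<Rightarrow> (nat \<Rightarrow> nat)) \<Rightarrow> bool" where
  "is_strategy M F J \<pi> \<longleftrightarrow>
     (\<forall>\<omega>\<in>space M. \<pi> 0 \<omega> = (\<lambda>_. 0)) \<and>
     (\<forall>t. \<forall>\<omega>\<in>space M. (\<Sum>j<J. \<pi> t \<omega> j) = t) \<and>
     (\<forall>t. \<forall>\<omega>\<in>space M. \<exists>j<J. \<pi> (Suc t) \<omega> = (\<pi> t \<omega>)(j := Suc (\<pi> t \<omega> j))) \<and>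
     (\<forall>t. \<forall>s::nat \<Rightarrow> nat. (\<forall>j\<ge>J. s j = 0) \<longrightarrow>
          {\<omega> \<in> space M. \<pi> t \<omega> = s} \<in> sets (joint_sigma M F J s))"

definition sel_arm :: "(nat \<Rightarrow> 'a \<Rightarrow> (nat \<Rightarrow> nat)) \<Rightarrow> nat \<Rightarrow> 'a \<Rightarrow> nat" where
  "sel_arm \<pi> t \<omega> = (LEAST j. \<pi> (Suc t) \<omega> j \<noteq> \<pi> t \<omega> j)"

definition cW :: "(nat \<Rightarrow> nat \<Rightarrow> 'a \<Rightarrow> real) \<Rightarrow> (nat \<Rightarrow> 'a \<Rightarrow> (nat \<Rightarrow> nat)) \<Rightarrow> nat \<Rightarrow> 'a \<Rightarrow> real" where
  "cW W \<pi> t \<omega> = W (sel_arm \<pi> t \<omega>) (\<pi> t \<omega> (sel_arm \<pi> t \<omega>)) \<omega>"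

definition cT :: "(nat \<Rightarrow> nat \<Rightarrow> 'a \<Rightarrow> real) \<Rightarrow> (nat \<Rightarrow> 'a \<Rightarrow> (nat \<Rightarrow> nat)) \<Rightarrow> nat \<Rightarrow> 'a \<Rightarrow> real" where
  "cT W \<pi> t \<omega> = (\<Sum>u<t. cW W \<pi> u \<omega>)"

definition cX :: "(nat \<Rightarrow> nat \<Rightarrow> 'a \<Rightarrow> real) \<Rightarrow> (nat \<Rightarrow> 'a \<Rightarrow> (nat \<Rightarrow> nat)) \<Rightarrow> nat \<Rightarrow> 'a \<Rightarrow> real" where
  "cX X \<pi> t \<omega> = X (sel_arm \<pi> t \<omega>) (\<pi> t \<omega> (sel_arm \<pi> t \<omega>)) \<omega>"

definition value_fun :: "'a measure \<Rightarrow> real \<Rightarrow> (nat \<Rightarrow> nat \<Rightarrow> 'a measure) \<Rightarrow> nat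
    \<Rightarrow> (nat \<Rightarrow> nat \<Rightarrow> 'a \<Rightarrow> real) \<Rightarrow> (nat \<Rightarrow> nat \<Rightarrow> 'a \<Rightarrow> real)
    \<Rightarrow> (nat \<Rightarrow> 'a \<Rightarrow> (nat \<Rightarrow> nat)) \<Rightarrow> 'a \<Rightarrow> real" where
  "value_fun M q F J X W \<pi> =
     real_cond_exp M (joint_sigma M F J (\<lambda>_. 0))
       (\<lambda>\<omega>. \<Sum>t. cX X \<pi> t \<omega> * disc_int q (cT W \<pi> t \<omega>) (cT W \<pi> (Suc t) \<omega>))"

end

theory Submission
  imports Defs
begin

text \<open>
  The proof follows Weber's prevailing charge argument. Let the charge of an arm be the running minimum
  of its Gittins index. If the arm must pay its current charge per unit of discounted time, then, given the
  past, its future net profit is nonnegative, and it is zero whenever the index is at a new minimum. Under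
  any strategy the discount factor that the other arms impose on an arm is nonincreasing and depends only
  on the past of the arm and on the independent other arms; by summation by parts the expected reward is
  therefore at most the expected total charge. A Gittins strategy leaves an arm only at a new minimum, which
  gives equality. Finally, since the charges of every arm decrease, the Gittins strategy collects the charges
  in decreasing order, which maximises their discounted total pathwise.
\<close>

text \<open>The index weighs a reward with the discount at the start of its operation, the value
  with the discount integral over its duration. Since a duration is independent of the past, the two
  weights differ on average by the factor \<open>(1 - \<rho>) / q\<close>, so a charge read off the
  index also fits the value. The index is an essential supremum of ratios; multiplying by the
  positive denominator turns "index at most l" into "no rule gains against the rental l", which is
  linear and behaves well under unions of rules. With the exact charge, a maximising rule could stop
  where index and charge agree without any contradiction; hence the charge is first lowered by a
  small amount. A strategy may select an arm on an event that is revealed only by operating this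
  arm, so it is not obvious that the discount imposed by the other arms ignores the future;
  conditioning on everything about the other arms settles this. Finally, the value is conditional on
  an initial sigma-algebra that may be nontrivial; it is reached from plain expectations by
  switching between two strategies on an initial event.\<close>

lemma AE_summable_norm:
  fixes f :: "nat \<Rightarrow> 'a \<Rightarrow> real"
  assumes int: "\<And>i. integrable M (f i)" and sum: "summable (\<lambda>i. \<integral>x. \<bar>f i x\<bar> \<partial>M)"
  shows "AE x in M. summable (\<lambda>i. \<bar>f i x\<bar>)"
proof -
  have "(\<integral>\<^sup>+x. (\<Sum>i. ennreal \<bar>f i x\<bar>) \<partial>M) = (\<Sum>i. \<integral>\<^sup>+x. ennreal \<bar>f i x\<bar> \<partial>M)"
    using int by (intro nn_integral_suminf) auto
  also have "\<dots> = (\<Sum>i. ennreal (\<integral>x. \<bar>f i x\<bar> \<partial>M))"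
    using int by (intro suminf_cong nn_integral_eq_integral) auto
  also have "\<dots> \<noteq> \<infinity>"
    using sum by (simp add: ennreal_suminf_neq_top)
  finally have "AE x in M. (\<Sum>i. ennreal \<bar>f i x\<bar>) \<noteq> \<infinity>"
    using int by (intro nn_integral_PInf_AE) auto
  then show ?thesis
    by eventually_elim (auto intro: summable_suminf_not_top)
qed

lemma tendsto_suminf_dominated:
  fixes f :: "nat \<Rightarrow> nat \<Rightarrow> real"
  assumes lim: "\<And>s. (\<lambda>n. f n s) \<longlonglongrightarrow> g s"
    and bound: "\<And>n s. \<bar>f n s\<bar> \<le> b s" and b: "summable b"
  shows "(\<lambda>n. \<Sum>s. f n s) \<longlonglongrightarrow> (\<Sum>s. g s)"
  using tannerys_theorem[where a = "\<lambda>k n. f n k" and F = sequentially and M = b and b = g] lim bound b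
  by (simp add: case_prod_unfold)

lemma integrable_indicator_mult:
  fixes f :: "'a \<Rightarrow> real"
  assumes "integrable M f" "A \<in> sets M"
  shows "integrable M (\<lambda>x. indicator A x * f x)"
  using integrable_mult_indicator[OF assms(2,1)] by simp

section \<open>Existence of optimal stopping rules\<close>

text \<open>A stopping time \<open>\<tau>\<close> is represented by the decreasing adapted sets \<open>E s = {\<tau> > s}\<close>.\<close>

definition adapted_down :: "'a measure \<Rightarrow> (nat \<Rightarrow> 'a measure) \<Rightarrow> (nat \<Rightarrow> 'a set) \<Rightarrow> bool" where
  "adapted_down M F E \<longleftrightarrow> (\<forall>s. E s \<in> sets (F s) \<and> E (Suc s) \<subseteq> E s)"

definition stop_gain :: "'a measure \<Rightarrow> (nat \<Rightarrow> 'a \<Rightarrow> real) \<Rightarrow> (nat \<Rightarrow> 'a set) \<Rightarrow> real" where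
  "stop_gain M Y E = (\<Sum>s. \<integral>x. indicator (E s) x * Y s x \<partial>M)"

locale stop_problem =
  fixes M :: "'a measure" and F :: "nat \<Rightarrow> 'a measure" and Y :: "nat \<Rightarrow> 'a \<Rightarrow> real"
  assumes sub: "\<And>s. sets (F s) \<subseteq> sets M"
    and int_Y: "\<And>s. integrable M (Y s)"
    and sum_Y: "summable (\<lambda>s. \<integral>x. \<bar>Y s x\<bar> \<partial>M)"
begin

lemma int_indicator: "E \<in> sets M \<Longrightarrow> integrable M (\<lambda>x. indicator E x * Y s x)"
  by (rule integrable_indicator_mult[OF int_Y])

lemma bound_indicator: "E \<in> sets M \<Longrightarrow> \<bar>\<integral>x. indicator E x * Y s x \<partial>M\<bar> \<le> (\<integral>x. \<bar>Y s x\<bar> \<partial>M)"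
proof -
  assume E: "E \<in> sets M"
  have "\<bar>\<integral>x. indicator E x * Y s x \<partial>M\<bar> \<le> (\<integral>x. \<bar>indicator E x * Y s x\<bar> \<partial>M)"
    by (rule integral_abs_bound)
  also have "\<dots> \<le> (\<integral>x. \<bar>Y s x\<bar> \<partial>M)"
    using int_indicator[OF E] int_Y by (intro integral_mono) (auto simp: indicator_def)
  finally show ?thesis .
qed

lemma summable_gain:
  assumes "\<And>s. E s \<in> sets M"
  shows "summable (\<lambda>s. \<integral>x. indicator (E s) x * Y s x \<partial>M)"
  using bound_indicator assms by (intro summable_comparison_test'[OF sum_Y, of 0]) auto

lemma stop_gain_le: "(\<And>s. E s \<in> sets M) \<Longrightarrow> stop_gain M Y E \<le> (\<Sum>s. \<integral>x. \<bar>Y s x\<bar> \<partial>M)"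
  unfolding stop_gain_def
  by (intro suminf_le summable_gain sum_Y) (use bound_indicator in \<open>force simp: abs_le_iff\<close>)+

text \<open>Pointwise, the indicators of union and intersection have the same sum as those of the
  two sets. For the stopping times behind the sets these are maximum and minimum, so two nearly
  optimal rules can be merged.\<close>

lemma stop_gain_modular:
  assumes "\<And>s. E s \<in> sets M" "\<And>s. E' s \<in> sets M"
  shows "stop_gain M Y (\<lambda>s. E s \<union> E' s) + stop_gain M Y (\<lambda>s. E s \<inter> E' s)
    = stop_gain M Y E + stop_gain M Y E'"
proof -
  have "(\<integral>x. indicator (E s \<union> E' s) x * Y s x \<partial>M) + (\<integral>x. indicator (E s \<inter> E' s) x * Y s x \<partial>M)
    = (\<integral>x. indicator (E s) x * Y s x \<partial>M) + (\<integral>x. indicator (E' s) x * Y s x \<partial>M)" for s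
  proof -
    have "(\<integral>x. indicator (E s \<union> E' s) x * Y s x \<partial>M) + (\<integral>x. indicator (E s \<inter> E' s) x * Y s x \<partial>M)
      = (\<integral>x. indicator (E s \<union> E' s) x * Y s x + indicator (E s \<inter> E' s) x * Y s x \<partial>M)"
      by (intro Bochner_Integration.integral_add[symmetric] int_indicator sets.Un sets.Int assms)
    also have "\<dots> = (\<integral>x. indicator (E s) x * Y s x + indicator (E' s) x * Y s x \<partial>M)"
      by (intro Bochner_Integration.integral_cong) (auto simp: indicator_def)
    also have "\<dots> = (\<integral>x. indicator (E s) x * Y s x \<partial>M) + (\<integral>x. indicator (E' s) x * Y s x \<partial>M)"
      by (intro Bochner_Integration.integral_add int_indicator assms)
    finally show ?thesis .
  qed
  then show ?thesis
    using assms unfolding stop_gain_def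
    by (subst (1 2) suminf_add) (auto intro!: summable_gain)
qed

text \<open>Only eventual agreement at each point is required, which covers increasing unions and
  decreasing intersections alike. The series \<open>sum_Y\<close> dominates.\<close>

lemma stop_gain_tendsto:
  assumes E: "\<And>n s. E n s \<in> sets M" and E': "\<And>s. E' s \<in> sets M"
    and lim: "\<And>s x. x \<in> space M \<Longrightarrow> eventually (\<lambda>n. x \<in> E n s \<longleftrightarrow> x \<in> E' s) sequentially"
  shows "(\<lambda>n. stop_gain M Y (E n)) \<longlonglongrightarrow> stop_gain M Y E'"
  unfolding stop_gain_def
proof (rule tendsto_suminf_dominated[OF _ _ sum_Y])
  fix s
  show "(\<lambda>n. \<integral>x. indicator (E n s) x * Y s x \<partial>M) \<longlonglongrightarrow> (\<integral>x. indicator (E' s) x * Y s x \<partial>M)"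
  proof (rule integral_dominated_convergence[where w = "\<lambda>x. \<bar>Y s x\<bar>"])
    show "AE x in M. (\<lambda>n. indicator (E n s) x * Y s x) \<longlonglongrightarrow> indicator (E' s) x * Y s x"
    proof (rule AE_I2)
      fix x assume "x \<in> space M"
      have "eventually (\<lambda>n. indicator (E n s) x * Y s x = indicator (E' s) x * Y s x) sequentially"
        using lim[OF \<open>x \<in> space M\<close>, of s] by eventually_elim (auto simp: indicator_def)
      then show "(\<lambda>n. indicator (E n s) x * Y s x) \<longlonglongrightarrow> indicator (E' s) x * Y s x"
        by (rule tendsto_eventually)
    qed
  qed (use int_indicator E E' int_Y in \<open>auto simp: indicator_def dest!: borel_measurable_integrable\<close>)
qed (use bound_indicator E in auto)

lemma adapted_down_Int: "adapted_down M F E \<Longrightarrow> adapted_down M F E' \<Longrightarrow> adapted_down M F (\<lambda>s. E s \<inter> E' s)"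
  unfolding adapted_down_def by blast

text \<open>By modularity, if \<open>E\<close> and \<open>E'\<close> are within \<open>d\<close> and \<open>d'\<close> of the supremum, then their union is within
  \<open>d + d'\<close>. Hence the upper limit of a maximising sequence with summable defects is a maximiser.\<close>

lemma stop_gain_maximizer:
  obtains E where "adapted_down M F E" "\<And>E'. adapted_down M F E' \<Longrightarrow> stop_gain M Y E' \<le> stop_gain M Y E"
proof -
  let ?C = "{E. adapted_down M F E}" and ?J = "stop_gain M Y"
  define m where "m = (SUP E\<in>?C. ?J E)"
  have meas: "E s \<in> sets M" if "adapted_down M F E" for E s
    using that sub unfolding adapted_down_def by blast
  have bdd: "bdd_above (?J ` ?C)"
    using stop_gain_le meas by (intro bdd_aboveI2[where M = "\<Sum>s. \<integral>x. \<bar>Y s x\<bar> \<partial>M"]) auto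
  have le_m: "?J E \<le> m" if "adapted_down M F E" for E
    unfolding m_def using that bdd by (intro cSUP_upper) auto
  have "(\<lambda>s. {}) \<in> ?C" by (auto simp: adapted_down_def)
  then have ne: "?C \<noteq> {}" by blast
  have "\<exists>E. adapted_down M F E \<and> m - (1/2)^n < ?J E" for n
  proof -
    have "m - (1/2)^n < m" by simp
    then obtain y where "y \<in> ?J ` ?C" "m - (1/2)^n < y"
      unfolding m_def using less_cSupD[of "?J ` ?C"] ne by blast
    then show ?thesis by auto
  qed
  then obtain E where E: "\<And>n. adapted_down M F (E n)" and E_close: "\<And>n. m - (1/2)^n < ?J (E n)"
    by metis
  define U where "U n k = (\<lambda>s. \<Union>i\<in>{n..n+k}. E n s \<union> E i s)" for n k :: nat
  have U_ad: "adapted_down M F (U n k)" for n k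
    using E unfolding U_def adapted_down_def by (auto; blast)
  have U_Suc: "U n (Suc k) = (\<lambda>s. U n k s \<union> E (n + Suc k) s)" for n k
    unfolding U_def by (auto simp: le_Suc_eq atLeastAtMostSuc_conv)
  \<comment> \<open>The subtracted defect is the geometric sum of \<open>(1/2)^i\<close> for
    \<open>i\<close> from \<open>n\<close> to \<open>n+k\<close>: each further union adds only its
    own defect, because the intersection earns at most \<open>m\<close>.\<close>
  have U_close: "m - (2 * (1/2)^n - (1/2)^(n+k)) \<le> ?J (U n k)" for n k
  proof (induction k)
    case 0
    then show ?case using E_close[of n] by (simp add: U_def)
  next
    case (Suc k)
    have "?J (U n (Suc k)) + ?J (\<lambda>s. U n k s \<inter> E (n + Suc k) s) = ?J (U n k) + ?J (E (n + Suc k))"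
      unfolding U_Suc by (intro stop_gain_modular meas U_ad E)
    moreover have "?J (\<lambda>s. U n k s \<inter> E (n + Suc k) s) \<le> m"
      by (intro le_m adapted_down_Int U_ad E)
    ultimately show ?case using Suc E_close[of "n + Suc k"] by simp
  qed
  define V where "V n = (\<lambda>s. \<Union>i\<in>{n..}. E i s)" for n
  have V_ad: "adapted_down M F (V n)" for n
    using E unfolding V_def adapted_down_def by (auto; blast)
  have V_close: "m - 2 * (1/2)^n \<le> ?J (V n)" for n
  proof (rule LIMSEQ_le_const)
    show "(\<lambda>k. ?J (U n k)) \<longlonglongrightarrow> ?J (V n)"
    proof (rule stop_gain_tendsto)
      fix s x
      show "eventually (\<lambda>k. x \<in> U n k s \<longleftrightarrow> x \<in> V n s) sequentially"
      proof (cases "x \<in> V n s")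
        case True
        then obtain i where "i \<ge> n" "x \<in> E i s" by (auto simp: V_def)
        then have "x \<in> U n k s" if "k \<ge> i" for k
          using that by (auto simp: U_def intro!: bexI[of _ i])
        with True show ?thesis by (auto simp: eventually_sequentially)
      next
        case False
        then show ?thesis by (auto simp: V_def U_def)
      qed
    qed (intro meas U_ad V_ad)+
    have "m - 2 * (1/2)^n \<le> ?J (U n k)" for k
      by (rule order_trans[OF _ U_close]) simp
    then show "\<exists>N. \<forall>k\<ge>N. m - 2 * (1/2)^n \<le> ?J (U n k)" by blast
  qed
  define L where "L = (\<lambda>s. \<Inter>n. V n s)"
  have L_ad: "adapted_down M F L"
    using V_ad unfolding L_def adapted_down_def by (auto; blast)
  have "m \<le> ?J L"
  proof (rule LIMSEQ_le)
    show "(\<lambda>n. m - 2 * (1/2)^n :: real) \<longlonglongrightarrow> m"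
      by (auto intro!: tendsto_eq_intros LIMSEQ_realpow_zero)
    show "(\<lambda>n. ?J (V n)) \<longlonglongrightarrow> ?J L"
    proof (rule stop_gain_tendsto)
      fix s x
      show "eventually (\<lambda>n. x \<in> V n s \<longleftrightarrow> x \<in> L s) sequentially"
      proof (cases "x \<in> L s")
        case True
        then show ?thesis by (auto simp: L_def)
      next
        case False
        then obtain N where "x \<notin> V N s" by (auto simp: L_def)
        then have "x \<notin> V n s" if "n \<ge> N" for n using that by (auto simp: V_def)
        with False show ?thesis by (auto simp: eventually_sequentially)
      qed
    qed (intro meas V_ad L_ad)+
    show "\<exists>N. \<forall>n\<ge>N. m - 2 * (1/2)^n \<le> ?J (V n)" using V_close by blast
  qed
  then show ?thesis
    using L_ad le_m by (intro that[of L]) (auto intro: order_trans)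
qed

end

text \<open>Multiplying the stopped sum by \<open>indicator B\<close> intersects every
  \<open>E s\<close> with \<open>B\<close>, so its integral over an event is again a gain. The sets
  need not be adapted here.\<close>

lemma (in stop_problem)
  assumes E: "\<And>s. E s \<in> sets M"
  shows int_total: "integrable M (\<lambda>x. \<Sum>s. indicator (E s) x * Y s x)"
    and integral_total: "B \<in> sets M \<Longrightarrow>
      (\<integral>x. indicator B x * (\<Sum>s. indicator (E s) x * Y s x) \<partial>M) = stop_gain M Y (\<lambda>s. E s \<inter> B)"
    and AE_summable_Y: "AE x in M. summable (\<lambda>s. \<bar>Y s x\<bar>)"
proof -
  show ae: "AE x in M. summable (\<lambda>s. \<bar>Y s x\<bar>)"
    using int_Y sum_Y by (rule AE_summable_norm)
  have ae': "AE x in M. summable (\<lambda>s. norm (indicator (E' s) x * Y s x))" for E'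
    using ae by eventually_elim (erule summable_comparison_test', auto simp: indicator_def)
  have sum': "summable (\<lambda>s. \<integral>x. norm (indicator (E' s) x * Y s x) \<partial>M)" if "\<And>s. E' s \<in> sets M" for E'
  proof (rule summable_comparison_test'[OF sum_Y, of 0])
    fix s
    have "(\<integral>x. norm (indicator (E' s) x * Y s x) \<partial>M) \<le> (\<integral>x. \<bar>Y s x\<bar> \<partial>M)"
      using that by (intro integral_mono integrable_norm int_indicator integrable_abs int_Y)
        (auto simp: indicator_def)
    then show "norm (\<integral>x. norm (indicator (E' s) x * Y s x) \<partial>M) \<le> (\<integral>x. \<bar>Y s x\<bar> \<partial>M)"
      by simp
  qed
  show "integrable M (\<lambda>x. \<Sum>s. indicator (E s) x * Y s x)"
    by (intro integrable_suminf ae' sum' int_indicator E)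
  assume B: "B \<in> sets M"
  then have EB: "E s \<inter> B \<in> sets M" for s using E by auto
  have "(\<integral>x. indicator B x * (\<Sum>s. indicator (E s) x * Y s x) \<partial>M)
      = (\<integral>x. (\<Sum>s. indicator (E s \<inter> B) x * Y s x) \<partial>M)"
    by (intro Bochner_Integration.integral_cong) (auto simp: indicator_def)
  also have "\<dots> = stop_gain M Y (\<lambda>s. E s \<inter> B)"
    unfolding stop_gain_def by (intro integral_suminf ae' sum' int_indicator EB)
  finally show "(\<integral>x. indicator B x * (\<Sum>s. indicator (E s) x * Y s x) \<partial>M) = stop_gain M Y (\<lambda>s. E s \<inter> B)" .
qed

text \<open>The part of \<open>B\<close> where the conditional expectation is positive is itself an
  event of \<open>F\<close>; testing \<open>le\<close> on it forces it to be null.\<close>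

lemma (in sigma_finite_subalgebra) real_cond_exp_nonpos_on:
  assumes k: "integrable M k" and B: "B \<in> sets F"
    and le: "\<And>B'. B' \<in> sets F \<Longrightarrow> B' \<subseteq> B \<Longrightarrow> (\<integral>x. indicator B' x * k x \<partial>M) \<le> 0"
  shows "AE x in M. x \<in> B \<longrightarrow> real_cond_exp M F k x \<le> 0"
proof -
  have spF: "space F = space M" using subalg by (simp add: subalgebra_def)
  define B' where "B' = B \<inter> {x \<in> space M. 0 < real_cond_exp M F k x}"
  have B'F: "B' \<in> sets F"
  proof -
    have "{x \<in> space F. 0 < real_cond_exp M F k x} \<in> sets F" by measurable
    then show ?thesis using B by (simp add: B'_def spF)
  qed
  then have B'M: "B' \<in> sets M" using subalg by (auto simp: subalgebra_def)
  have int: "integrable M (\<lambda>x. indicator B' x * real_cond_exp M F k x)"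
    by (intro integrable_indicator_mult real_cond_exp_int k B'M)
  have "(\<integral>x. indicator B' x * real_cond_exp M F k x \<partial>M) = (\<integral>x. indicator B' x * k x \<partial>M)"
    using B'F k by (intro real_cond_exp_intg integrable_indicator_mult B'M) auto
  also have "\<dots> \<le> 0" by (rule le) (use B'F in \<open>auto simp: B'_def\<close>)
  finally have "(\<integral>x. indicator B' x * real_cond_exp M F k x \<partial>M) \<le> 0" .
  moreover have nn: "0 \<le> indicator B' x * real_cond_exp M F k x" for x
    by (auto simp: indicator_def B'_def)
  ultimately have "(\<integral>x. indicator B' x * real_cond_exp M F k x \<partial>M) = 0"
    by (intro antisym) auto
  then have "AE x in M. indicator B' x * real_cond_exp M F k x = 0"
    using integral_nonneg_eq_0_iff_AE[OF int] nn by auto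
  then show ?thesis
    by (rule AE_mp) (auto intro!: AE_I2 simp: B'_def indicator_def not_less)
qed

section \<open>Independence tools and the discount integral\<close>

lemma (in prob_space) indep_var_of_indep_set:
  assumes ind: "indep_set A {Y -` S \<inter> space M |S. S \<in> sets borel}"
    and X: "\<And>S. S \<in> sets borel \<Longrightarrow> X -` S \<inter> space M \<in> A" "sigma_algebra (space M) A"
    and m: "X \<in> borel_measurable M" "Y \<in> borel_measurable M"
  shows "indep_var borel X borel Y"
proof -
  let ?SX = "sigma_sets (space M) {X -` S \<inter> space M |S. S \<in> sets borel}"
    and ?SY = "sigma_sets (space M) {Y -` S \<inter> space M |S. S \<in> sets borel}"
  have 1: "?SX \<subseteq> A"
    using X(1) by (intro sigma_algebra.sigma_sets_subset[OF X(2)]) blast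
  have 2: "?SY = {Y -` S \<inter> space M |S. S \<in> sets borel}"
  proof -
    have "sigma_algebra (space M) {Y -` S \<inter> space M |S. S \<in> sets borel}"
      using sets.sigma_algebra_axioms[of "vimage_algebra (space M) Y borel"] sets_vimage_algebra2[of Y "space M" borel]
      by simp
    then show ?thesis by (rule sigma_algebra.sigma_sets_eq)
  qed
  have "indep_set ?SX ?SY"
    unfolding indep_set_def 2
  proof (rule indep_sets_mono_sets[OF ind[unfolded indep_set_def]])
    show "case_bool ?SX V i \<subseteq> case_bool A V i" for i V
      using 1 by (cases i) simp_all
  qed
  then show ?thesis
    unfolding indep_var_eq using m by simp
qed

lemma (in prob_space) indep_var_nn_integral:
  fixes X Y :: "'a \<Rightarrow> ennreal"
  assumes "indep_var borel X borel Y"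
  shows "(\<integral>\<^sup>+x. X x * Y x \<partial>M) = (\<integral>\<^sup>+x. X x \<partial>M) * (\<integral>\<^sup>+x. Y x \<partial>M)"
proof -
  have b: "case_bool borel borel = (\<lambda>_. borel)" by (auto split: bool.split)
  have "(\<integral>\<^sup>+z. (\<Prod>i\<in>UNIV. case_bool X Y i z) \<partial>M) = (\<Prod>i\<in>UNIV. \<integral>\<^sup>+z. case_bool X Y i z \<partial>M)"
    using assms unfolding indep_var_def b by (intro indep_vars_nn_integral) auto
  then show ?thesis by (simp add: UNIV_bool mult.commute)
qed

lemma disc_int_eq:
  assumes "a \<le> b" "q > 0"
  shows "disc_int q a b = (exp (- q * a) - exp (- q * b)) / q"
proof -
  have "((\<lambda>r. exp (- q * r)) has_integral (- exp (- q * b) / q - - exp (- q * a) / q)) {a..b}"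
    using assms
    by (intro fundamental_theorem_of_calculus)
       (auto simp flip: has_real_derivative_iff_has_vector_derivative intro!: derivative_eq_intros)
  then have "disc_int q a b = - exp (- q * b) / q - - exp (- q * a) / q"
    unfolding disc_int_def by (rule integral_unique)
  then show ?thesis by (simp add: diff_divide_distrib)
qed

section \<open>A single arm and its prevailing charge\<close>

locale arm = prob_space M for M :: "'a measure" +
  fixes q :: real and F :: "nat \<Rightarrow> nat \<Rightarrow> 'a measure" and X W :: "nat \<Rightarrow> nat \<Rightarrow> 'a \<Rightarrow> real"
    and j :: nat and \<Gamma> :: "nat \<Rightarrow> 'a \<Rightarrow> ereal" and G :: "real measure"
  assumes q: "q > 0"
    and F_sub: "\<And>s. subalgebra M (F j s)"
    and F_Suc: "\<And>s. sets (F j s) \<subseteq> sets (F j (Suc s))"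
    and X_meas: "\<And>s. X j s \<in> borel_measurable (F j s)"
    and W_meas: "\<And>s. W j s \<in> borel_measurable (F j (Suc s))"
    and W_pos: "\<And>s z. z \<in> space M \<Longrightarrow> W j s z > 0"
    and W_law: "\<And>s. distr M borel (W j s) = G"
    and W_indep: "\<And>s. indep_set (sets (F j s)) {W j s -` A \<inter> space M | A. A \<in> sets borel}"
    and integr: "(\<integral>\<^sup>+ z. (\<Sum>s. ennreal (\<bar>X j s z\<bar> *
            disc_int q (arm_time W j s z) (arm_time W j (Suc s) z))) \<partial>M) < \<infinity>"
    and Gittins: "is_gittins_index M q F X W j \<Gamma>"
begin

abbreviation cexp :: "nat \<Rightarrow> ('a \<Rightarrow> real) \<Rightarrow> 'a \<Rightarrow> real" where
  "cexp n \<equiv> real_cond_exp M (F j n)"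

definition beta :: "nat \<Rightarrow> 'a \<Rightarrow> real" where
  "beta s z = exp (- q * arm_time W j s z)"

text \<open>By the common law of the durations, this is the expected discount factor of every single
  operation, not only of operation 0.\<close>

definition \<rho> :: real where "\<rho> = expectation (\<lambda>z. exp (- q * W j 0 z))"

lemma space_F [simp]: "space (F j s) = space M"
  using F_sub by (auto simp: subalgebra_def)

lemma space_in_F [simp]: "space M \<in> sets (F j s)"
  using sets.top[of "F j s"] by simp

lemma F_mono: "s \<le> t \<Longrightarrow> sets (F j s) \<subseteq> sets (F j t)"
  by (rule lift_Suc_mono_le[of "\<lambda>s. sets (F j s)"]) (use F_Suc in auto)

lemma F_le_M: "sets (F j s) \<subseteq> sets M"
  using F_sub by (auto simp: subalgebra_def)

lemma F_subD: "A \<in> sets (F j s) \<Longrightarrow> A \<in> sets M"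
  using F_le_M by auto

lemma meas_mono: "f \<in> measurable (F j s) N \<Longrightarrow> s \<le> t \<Longrightarrow> f \<in> measurable (F j t) N"
  by (rule measurable_from_subalg[of "F j t" "F j s"]) (auto simp: subalgebra_def F_mono)

lemma meas_M: "f \<in> measurable (F j s) N \<Longrightarrow> f \<in> measurable M N"
  by (rule measurable_from_subalg[OF F_sub])

lemma sfs: "sigma_finite_subalgebra M (F j s)"
  by (rule finite_measure_subalgebra_is_sigma_finite)
     (simp add: finite_measure_subalgebra_def finite_measure_subalgebra_axioms_def F_sub finite_measure_axioms)

lemma beta_0 [simp]: "beta 0 z = 1"
  by (simp add: beta_def arm_time_def)

lemma beta_pos: "beta s z > 0"
  by (simp add: beta_def)

lemma beta_Suc: "beta (Suc s) z = beta s z * exp (- q * W j s z)"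
  by (simp add: beta_def arm_time_def algebra_simps flip: exp_add)

lemma beta_antimono: "z \<in> space M \<Longrightarrow> s \<le> t \<Longrightarrow> beta t z \<le> beta s z"
  by (rule lift_Suc_antimono_le[of "\<lambda>s. beta s z"])
     (use W_pos q in \<open>auto simp: beta_Suc beta_pos less_imp_le intro!: mult_left_le\<close>)

lemma beta_meas: "beta s \<in> borel_measurable (F j s)"
proof -
  have "W j u \<in> borel_measurable (F j s)" if "u < s" for u
    by (rule meas_mono[OF W_meas]) (use that in auto)
  then show ?thesis
    unfolding beta_def arm_time_def by measurable
qed

lemma W_meas_M: "W j s \<in> borel_measurable M"
  by (rule meas_M[OF W_meas])

lemma disc_int_arm:
  "z \<in> space M \<Longrightarrow> disc_int q (arm_time W j s z) (arm_time W j (Suc s) z) = (beta s z - beta (Suc s) z) / q"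
  using W_pos[of z s] q by (subst disc_int_eq) (auto simp: beta_def arm_time_def)

lemma indep_past_W:
  assumes Y: "Y \<in> borel_measurable (F j s)" and f: "f \<in> borel_measurable borel"
  shows "indep_var borel Y borel (\<lambda>z. f (W j s z))"
proof (rule indep_var_of_indep_set)
  show "indep_set (sets (F j s)) {(\<lambda>z. f (W j s z)) -` S \<inter> space M |S. S \<in> sets borel}"
    unfolding indep_set_def
  proof (rule indep_sets_mono_sets[OF W_indep[unfolded indep_set_def]])
    have "f -` S \<in> sets borel" if "S \<in> sets borel" for S
      using measurable_sets[OF f that] by simp
    then have "{(\<lambda>z. f (W j s z)) -` S \<inter> space M |S. S \<in> sets borel}
        \<subseteq> {W j s -` A \<inter> space M |A. A \<in> sets borel}"
      by (auto simp: vimage_def)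
    then show "case_bool (sets (F j s)) {(\<lambda>z. f (W j s z)) -` S \<inter> space M |S. S \<in> sets borel} i
        \<subseteq> case_bool (sets (F j s)) {W j s -` A \<inter> space M |A. A \<in> sets borel} i" for i
      by (cases i) simp_all
  qed
  show "Y -` S \<inter> space M \<in> sets (F j s)" if "S \<in> sets borel" for S
    using measurable_sets[OF Y that] by simp
  show "sigma_algebra (space M) (sets (F j s))"
    using sets.sigma_algebra_axioms[of "F j s"] by simp
  show "Y \<in> borel_measurable M" by (rule meas_M[OF Y])
  show "(\<lambda>z. f (W j s z)) \<in> borel_measurable M"
    using f W_meas_M by measurable
qed

lemma exp_W_integrable: "integrable M (\<lambda>z. exp (- q * W j s z))"
  using W_pos q W_meas_M[of s]
  by (intro integrable_const_bound[where B = 1]) (auto intro!: AE_I2 mult_nonneg_nonneg less_imp_le)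

lemma expectation_exp_W: "expectation (\<lambda>z. exp (- q * W j s z)) = \<rho>"
proof -
  have "expectation (\<lambda>z. exp (- q * W j u z)) = integral\<^sup>L G (\<lambda>x. exp (- q * x))" for u
    using W_meas_M[of u] by (subst W_law[of u, symmetric]) (simp add: integral_distr)
  then show ?thesis by (simp add: \<rho>_def)
qed

lemma \<rho>_nonneg: "0 \<le> \<rho>"
  unfolding \<rho>_def by (intro Bochner_Integration.integral_nonneg) auto

text \<open>Durations are strictly positive, so the discount factor is below 1 everywhere. The
  resulting geometric decay drives the summability arguments.\<close>

lemma \<rho>_less_1: "\<rho> < 1"
proof -
  have "\<rho> < expectation (\<lambda>z. 1)"
    unfolding \<rho>_def using W_pos q
    by (intro integral_less_AE_space exp_W_integrable) (auto intro!: AE_I2 simp: emeasure_space_1)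
  then show ?thesis by (simp add: prob_space)
qed

lemma
  assumes "Y \<in> borel_measurable (F j s)" "integrable M Y"
  shows integrable_exp_W: "integrable M (\<lambda>z. Y z * exp (- q * W j s z))"
    and integral_exp_W: "expectation (\<lambda>z. Y z * exp (- q * W j s z)) = expectation Y * \<rho>"
proof -
  have "indep_var borel Y borel (\<lambda>z. exp (- q * W j s z))"
    by (rule indep_past_W[OF assms(1)]) measurable
  from indep_var_integrable[OF this assms(2) exp_W_integrable]
       indep_var_lebesgue_integral[OF this assms(2) exp_W_integrable]
  show "integrable M (\<lambda>z. Y z * exp (- q * W j s z))"
    "expectation (\<lambda>z. Y z * exp (- q * W j s z)) = expectation Y * \<rho>"
    by (simp_all only: expectation_exp_W)
qed

text \<open>The durations are peeled off one at a time: \<open>W j (s + k)\<close> is independent of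
  \<open>F j (s + k)\<close>, hence contributes one factor \<open>\<rho>\<close>.\<close>

lemma beta_shift:
  assumes "Y \<in> borel_measurable (F j s)" "integrable M (\<lambda>z. Y z * beta s z)"
  shows "integrable M (\<lambda>z. Y z * beta (s + k) z) \<and>
    expectation (\<lambda>z. Y z * beta (s + k) z) = expectation (\<lambda>z. Y z * beta s z) * \<rho> ^ k"
proof (induction k)
  case 0
  then show ?case using assms by simp
next
  case (Suc k)
  have m: "(\<lambda>z. Y z * beta (s + k) z) \<in> borel_measurable (F j (s + k))"
    using meas_mono[OF assms(1), of "s + k"] beta_meas[of "s + k"] by measurable
  have "(\<lambda>z. Y z * beta (s + Suc k) z) = (\<lambda>z. (Y z * beta (s + k) z) * exp (- q * W j (s + k) z))"
    by (simp add: beta_Suc mult_ac)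
  then show ?case
    using integrable_exp_W[OF m] integral_exp_W[OF m] Suc.IH by simp
qed

lemma integral_beta: "integrable M (beta s)" "expectation (beta s) = \<rho> ^ s"
  using beta_shift[of "\<lambda>_. 1" 0 s] by (auto simp: prob_space)

lemma summable_rho: "summable (\<lambda>s. \<rho> ^ s)"
  using \<rho>_nonneg \<rho>_less_1 by (intro summable_geometric) auto

text \<open>The expectations form a geometric series. Besides convergence, this later forces the
  operation times of the arm to diverge.\<close>

lemma AE_summable_beta: "AE z in M. summable (\<lambda>s. beta s z)"
proof -
  have "AE z in M. summable (\<lambda>s. \<bar>beta s z\<bar>)"
    using integral_beta summable_rho beta_pos by (intro AE_summable_norm) (auto simp: abs_of_pos)
  then show ?thesis using beta_pos by (simp add: abs_of_pos)
qed

text \<open>The hypothesis \<open>integr\<close> uses discount integrals as weights, the index uses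
  \<open>beta\<close>. The normalised duration is independent of the past and has mean
  \<open>(1 - \<rho>) / q\<close>, a positive finite constant that can be cancelled. The computation
  stays with nonnegative integrals until finiteness is known.\<close>

lemma
  shows integrable_beta_X: "integrable M (\<lambda>z. beta s z * X j s z)"
    and summable_beta_X: "summable (\<lambda>s. \<integral>z. \<bar>beta s z * X j s z\<bar> \<partial>M)"
proof -
  have Xm: "X j s \<in> borel_measurable M" for s by (rule meas_M[OF X_meas])
  have bm: "beta s \<in> borel_measurable M" for s by (rule meas_M[OF beta_meas])
  have dm: "(\<lambda>z. disc_int q (arm_time W j s z) (arm_time W j (Suc s) z)) \<in> borel_measurable M" for s
  proof -
    have "(\<lambda>z. (beta s z - beta (Suc s) z) / q) \<in> borel_measurable M"
      using bm by measurable
    then show ?thesis by (subst measurable_cong[OF disc_int_arm])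
  qed
  have c_eq: "(\<integral>\<^sup>+z. ennreal ((1 - exp (- q * W j s z)) / q) \<partial>M) = ennreal ((1 - \<rho>) / q)" for s
  proof -
    have i: "integrable M (\<lambda>z. (1 - exp (- q * W j s z)) / q)"
      using exp_W_integrable[of s] by auto
    have "(\<integral>z. (1 - exp (- q * W j s z)) / q \<partial>M) = (1 - \<rho>) / q"
      using exp_W_integrable[of s] expectation_exp_W[of s] by (simp add: prob_space)
    then show ?thesis
      using W_pos q by (subst nn_integral_eq_integral[OF i]) (auto intro!: AE_I2 divide_nonneg_pos less_imp_le)
  qed
  have factor: "(\<integral>\<^sup>+z. ennreal (\<bar>X j s z\<bar> * disc_int q (arm_time W j s z) (arm_time W j (Suc s) z)) \<partial>M)
    = (\<integral>\<^sup>+z. ennreal \<bar>beta s z * X j s z\<bar> \<partial>M) * ennreal ((1 - \<rho>) / q)" for s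
  proof -
    have "(\<integral>\<^sup>+z. ennreal (\<bar>X j s z\<bar> * disc_int q (arm_time W j s z) (arm_time W j (Suc s) z)) \<partial>M)
      = (\<integral>\<^sup>+z. ennreal \<bar>beta s z * X j s z\<bar> * ennreal ((1 - exp (- q * W j s z)) / q) \<partial>M)"
    proof (rule nn_integral_cong)
      fix z assume z: "z \<in> space M"
      have "0 \<le> (1 - exp (- q * W j s z)) / q" using W_pos[OF z, of s] q by simp
      moreover have "\<bar>X j s z\<bar> * disc_int q (arm_time W j s z) (arm_time W j (Suc s) z)
        = \<bar>beta s z * X j s z\<bar> * ((1 - exp (- q * W j s z)) / q)"
        using beta_pos[of s z] by (simp add: disc_int_arm[OF z] beta_Suc abs_mult algebra_simps)
      ultimately show "ennreal (\<bar>X j s z\<bar> * disc_int q (arm_time W j s z) (arm_time W j (Suc s) z))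
        = ennreal \<bar>beta s z * X j s z\<bar> * ennreal ((1 - exp (- q * W j s z)) / q)"
        by (simp only: ennreal_mult''[symmetric])
    qed
    also have "\<dots> = (\<integral>\<^sup>+z. ennreal \<bar>beta s z * X j s z\<bar> \<partial>M) * (\<integral>\<^sup>+z. ennreal ((1 - exp (- q * W j s z)) / q) \<partial>M)"
    proof (rule indep_var_nn_integral)
      have "indep_var borel (ennreal \<circ> (\<lambda>z. \<bar>beta s z * X j s z\<bar>)) borel (ennreal \<circ> (\<lambda>z. (1 - exp (- q * W j s z)) / q))"
      proof (rule indep_var_compose)
        show "indep_var borel (\<lambda>z. \<bar>beta s z * X j s z\<bar>) borel (\<lambda>z. (1 - exp (- q * W j s z)) / q)"
        proof (rule indep_past_W[where f = "\<lambda>w. (1 - exp (- q * w)) / q"])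
          show "(\<lambda>z. \<bar>beta s z * X j s z\<bar>) \<in> borel_measurable (F j s)"
            using beta_meas[of s] X_meas[of s] by measurable
        qed (intro borel_measurable_continuous_onI continuous_intros, use q in auto)
      qed auto
      then show "indep_var borel (\<lambda>z. ennreal \<bar>beta s z * X j s z\<bar>) borel (\<lambda>z. ennreal ((1 - exp (- q * W j s z)) / q))"
        by (simp add: comp_def)
    qed
    finally show ?thesis by (simp only: c_eq)
  qed
  have "(\<Sum>s. (\<integral>\<^sup>+z. ennreal \<bar>beta s z * X j s z\<bar> \<partial>M)) * ennreal ((1 - \<rho>) / q)
    = (\<Sum>s. (\<integral>\<^sup>+z. ennreal \<bar>beta s z * X j s z\<bar> \<partial>M) * ennreal ((1 - \<rho>) / q))"
    by simp
  also have "\<dots> = (\<integral>\<^sup>+z. (\<Sum>s. ennreal (\<bar>X j s z\<bar> * disc_int q (arm_time W j s z) (arm_time W j (Suc s) z))) \<partial>M)"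
    using Xm dm by (subst nn_integral_suminf) (auto simp: factor)
  finally have "(\<Sum>s. (\<integral>\<^sup>+z. ennreal \<bar>beta s z * X j s z\<bar> \<partial>M)) * ennreal ((1 - \<rho>) / q) \<noteq> \<infinity>"
    using integr by simp
  moreover have "ennreal ((1 - \<rho>) / q) \<noteq> 0"
    using \<rho>_less_1 q by (simp add: ennreal_eq_0_iff divide_le_0_iff)
  ultimately have fin: "(\<Sum>s. (\<integral>\<^sup>+z. ennreal \<bar>beta s z * X j s z\<bar> \<partial>M)) \<noteq> \<infinity>"
    by (auto simp: ennreal_mult_eq_top_iff)
  have fin1: "(\<integral>\<^sup>+z. ennreal \<bar>beta s z * X j s z\<bar> \<partial>M) \<noteq> \<infinity>" for s
  proof
    assume "(\<integral>\<^sup>+z. ennreal \<bar>beta s z * X j s z\<bar> \<partial>M) = \<infinity>"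
    then have "(\<Sum>s. (\<integral>\<^sup>+z. ennreal \<bar>beta s z * X j s z\<bar> \<partial>M)) = \<infinity>"
      using sum_le_suminf[of "\<lambda>s. \<integral>\<^sup>+z. ennreal \<bar>beta s z * X j s z\<bar> \<partial>M" "{s}"] by (simp add: top_unique)
    with fin show False by simp
  qed
  show int: "integrable M (\<lambda>z. beta s z * X j s z)" for s
    using fin1[of s] Xm[of s] bm[of s] by (auto simp: integrable_iff_bounded less_top)
  have "(\<integral>\<^sup>+z. ennreal \<bar>beta s z * X j s z\<bar> \<partial>M) = ennreal (\<integral>z. \<bar>beta s z * X j s z\<bar> \<partial>M)" for s
    by (intro nn_integral_eq_integral integrable_abs int) auto
  with fin show "summable (\<lambda>s. \<integral>z. \<bar>beta s z * X j s z\<bar> \<partial>M)"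
    by (intro summable_suminf_not_top) auto
qed

end

lemma adapted_downD: "adapted_down M F E \<Longrightarrow> s \<le> t \<Longrightarrow> E t \<subseteq> E s"
  by (rule lift_Suc_antimono_le[of E]) (auto simp: adapted_down_def)

section \<open>The Gittins index through linear stopping problems\<close>

context arm
begin

definition weight_from :: "nat \<Rightarrow> nat \<Rightarrow> 'a \<Rightarrow> real" where
  "weight_from n u z = (if n \<le> u then beta u z else 0)"

text \<open>The discounted reward net of a rental rate \<open>l\<close>. It is the linear substitute
  for the index ratio: a rule earns a nonnegative total exactly when its ratio is at least the
  rental.\<close>

definition excess :: "nat \<Rightarrow> ('a \<Rightarrow> real) \<Rightarrow> nat \<Rightarrow> 'a \<Rightarrow> real" where
  "excess n l u z = weight_from n u z * (X j u z - l z)"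

definition stopped :: "(nat \<Rightarrow> 'a \<Rightarrow> real) \<Rightarrow> (nat \<Rightarrow> 'a set) \<Rightarrow> 'a \<Rightarrow> real" where
  "stopped Y E z = (\<Sum>u. indicator (E u) z * Y u z)"

text \<open>With \<open>E s\<close> read as the event that the stopping time exceeds
  \<open>s\<close>, the second condition says that it exceeds \<open>n\<close>, as the index
  demands.\<close>

definition stops_after :: "nat \<Rightarrow> (nat \<Rightarrow> 'a set) \<Rightarrow> bool" where
  "stops_after n E \<longleftrightarrow> adapted_down M (F j) E \<and> (\<forall>s\<le>n. E s = space M)"

lemma stops_afterD:
  "stops_after n E \<Longrightarrow> E s \<in> sets (F j s)" "stops_after n E \<Longrightarrow> E s \<in> sets M"
  "stops_after n E \<Longrightarrow> s \<le> t \<Longrightarrow> E t \<subseteq> E s" "stops_after n E \<Longrightarrow> s \<le> n \<Longrightarrow> E s = space M"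
  using F_subD adapted_downD[of M "F j" E] by (auto simp: stops_after_def adapted_down_def)

lemma beta_meas_M: "beta s \<in> borel_measurable M"
  by (rule meas_M[OF beta_meas])

lemma stop_problem_weight: "stop_problem M (F j) (weight_from n)"
proof
  show "summable (\<lambda>s. \<integral>x. \<bar>weight_from n s x\<bar> \<partial>M)"
  proof (rule summable_comparison_test'[OF summable_rho, of 0])
    fix s show "norm (\<integral>x. \<bar>weight_from n s x\<bar> \<partial>M) \<le> \<rho> ^ s"
      using integral_beta(2)[of s] beta_pos[of s] \<rho>_nonneg
      by (cases "n \<le> s") (auto simp: weight_from_def abs_of_pos)
  qed
  show "integrable M (weight_from n s)" for s
    using integral_beta(1)[of s] by (cases "n \<le> s") (auto simp: weight_from_def[abs_def])
qed (rule F_le_M)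

text \<open>A rental known at operation \<open>n\<close> loses a factor \<open>\<rho>\<close> in
  expectation with every further operation, so it adds a geometric series to that of the
  rewards.\<close>

lemma stop_problem_excess:
  assumes l: "l \<in> borel_measurable (F j n)" and int: "integrable M (\<lambda>z. l z * beta n z)"
  shows "stop_problem M (F j) (excess n l)"
proof
  have shift: "integrable M (\<lambda>z. l z * beta (n + k) z)" for k
    using beta_shift[OF l int] by blast
  have shift_abs: "(\<integral>z. \<bar>l z * beta (n + k) z\<bar> \<partial>M) = (\<integral>z. \<bar>l z * beta n z\<bar> \<partial>M) * \<rho> ^ k" for k
  proof -
    have "(\<lambda>z. \<bar>l z\<bar>) \<in> borel_measurable (F j n)" using l by measurable
    moreover have eq: "\<bar>l z\<bar> * beta s z = \<bar>l z * beta s z\<bar>" for s z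
      using beta_pos[of s z] by (simp add: abs_mult)
    ultimately show ?thesis
      using beta_shift[of "\<lambda>z. \<bar>l z\<bar>" n k] int by (simp add: eq)
  qed
  have int_l: "integrable M (\<lambda>z. weight_from n u z * l z)" for u
    using shift[of "u - n"] by (cases "n \<le> u") (auto simp: weight_from_def mult.commute)
  have int_X: "integrable M (\<lambda>z. weight_from n u z * X j u z)" for u
    using integrable_beta_X[of u] by (cases "n \<le> u") (auto simp: weight_from_def)
  show int_e: "integrable M (excess n l u)" for u
    unfolding excess_def right_diff_distrib using int_l int_X by auto
  have l_eq: "(\<integral>z. \<bar>weight_from n u z * l z\<bar> \<partial>M) = (if n \<le> u then (\<integral>z. \<bar>l z * beta n z\<bar> \<partial>M) * \<rho> ^ (u - n) else 0)" for u
    using shift_abs[of "u - n"] by (cases "n \<le> u") (auto simp: weight_from_def mult.commute)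
  have sum_l: "summable (\<lambda>u. \<integral>z. \<bar>weight_from n u z * l z\<bar> \<partial>M)"
    unfolding l_eq by (subst summable_iff_shift[of _ n, symmetric]) 
      (simp only: le_add2 if_True add_diff_cancel_right', rule summable_mult[OF summable_rho])
  show "summable (\<lambda>u. \<integral>z. \<bar>excess n l u z\<bar> \<partial>M)"
  proof (rule summable_comparison_test'[OF summable_add[OF summable_beta_X sum_l], of 0])
    fix u
    have "(\<integral>z. \<bar>excess n l u z\<bar> \<partial>M) \<le> (\<integral>z. \<bar>beta u z * X j u z\<bar> + \<bar>weight_from n u z * l z\<bar> \<partial>M)"
    proof (intro integral_mono integrable_abs Bochner_Integration.integrable_add integrable_beta_X int_l int_e)
      fix z
      show "\<bar>excess n l u z\<bar> \<le> \<bar>beta u z * X j u z\<bar> + \<bar>weight_from n u z * l z\<bar>"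
        unfolding excess_def right_diff_distrib
        by (rule order_trans[OF abs_triangle_ineq4]) (auto simp: weight_from_def)
    qed
    also have "\<dots> = (\<integral>z. \<bar>beta u z * X j u z\<bar> \<partial>M) + (\<integral>z. \<bar>weight_from n u z * l z\<bar> \<partial>M)"
      by (intro Bochner_Integration.integral_add integrable_abs integrable_beta_X int_l)
    finally show "norm (\<integral>z. \<bar>excess n l u z\<bar> \<partial>M)
      \<le> (\<integral>z. \<bar>beta u z * X j u z\<bar> \<partial>M) + (\<integral>z. \<bar>weight_from n u z * l z\<bar> \<partial>M)" by simp
  qed
qed (rule F_le_M)

definition gain_from :: "nat \<Rightarrow> nat \<Rightarrow> 'a \<Rightarrow> real" where
  "gain_from n u z = weight_from n u z * X j u z"

lemma stop_problem_gain: "stop_problem M (F j) (gain_from n)"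
  using stop_problem_excess[of "\<lambda>_. 0" n] by (simp add: excess_def[abs_def] gain_from_def[abs_def])

definition ratio :: "nat \<Rightarrow> (nat \<Rightarrow> 'a set) \<Rightarrow> 'a \<Rightarrow> real" where
  "ratio n E z = cexp n (stopped (gain_from n) E) z
     / cexp n (stopped (weight_from n) E) z"

lemma gittins_ratio_eq:
  assumes E: "stops_after n E" and \<tau>: "\<And>z u. z \<in> space M \<Longrightarrow> enat u < \<tau> z \<longleftrightarrow> z \<in> E u"
  shows "AE z in M. gittins_ratio M q F X W j n \<tau> z = ratio n E z"
proof -
  interpret S: sigma_finite_subalgebra M "F j n" by (rule sfs)
  interpret w: stop_problem M "F j" "weight_from n" by (rule stop_problem_weight)
  interpret g: stop_problem M "F j" "gain_from n" by (rule stop_problem_gain)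
  let ?f = "\<lambda>z. \<Sum>u. (if n \<le> u \<and> enat u < \<tau> z then exp (- q * arm_time W j u z) * X j u z else 0)"
    and ?h = "\<lambda>z. \<Sum>u. (if n \<le> u \<and> enat u < \<tau> z then exp (- q * arm_time W j u z) else 0)"
  have f: "?f z = stopped (gain_from n) E z" and h: "?h z = stopped (weight_from n) E z" if "z \<in> space M" for z
    unfolding stopped_def gain_from_def weight_from_def beta_def
    by (intro suminf_cong; simp add: \<tau>[OF that] indicator_def)+
  have "stopped (gain_from n) E \<in> borel_measurable M" "stopped (weight_from n) E \<in> borel_measurable M"
    unfolding stopped_def using g.int_total w.int_total stops_afterD(2)[OF E]
    by (auto dest!: borel_measurable_integrable)
  moreover from this have "?f \<in> borel_measurable M" "?h \<in> borel_measurable M"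
    by (simp_all only: measurable_cong[OF f] measurable_cong[OF h])
  ultimately have "AE z in M. cexp n ?f z = cexp n (stopped (gain_from n) E) z"
    "AE z in M. cexp n ?h z = cexp n (stopped (weight_from n) E) z"
    using f h by (auto intro!: S.real_cond_exp_cong)
  then show ?thesis
    by eventually_elim (simp add: gittins_ratio_def ratio_def)
qed

lemma ratio_le_index:
  assumes E: "stops_after n E"
  shows "AE z in M. ereal (ratio n E z) \<le> \<Gamma> n z"
proof -
  \<comment> \<open>The first position at which the point has left the sets, infinite if it never
    does. As the sets decrease, being before this position is the same as membership.\<close>
  define \<tau> where "\<tau> z = (if \<exists>s. z \<notin> E s then enat (LEAST s. z \<notin> E s) else \<infinity>)" for z
  have less: "enat u < \<tau> z \<longleftrightarrow> z \<in> E u" for u z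
  proof (cases "\<exists>s. z \<notin> E s")
    case True
    define m where "m = (LEAST s. z \<notin> E s)"
    have "z \<notin> E m" unfolding m_def using True by (rule LeastI_ex)
    moreover have "z \<in> E s" if "s < m" for s using not_less_Least that unfolding m_def by blast
    ultimately have "u < m \<longleftrightarrow> z \<in> E u"
      using stops_afterD(3)[OF E, of m u] by (metis not_less subsetD)
    with True show ?thesis by (simp add: \<tau>_def m_def)
  qed (auto simp: \<tau>_def)
  have "is_stopping_time M (F j) \<tau>"
    unfolding is_stopping_time_def
  proof
    fix m
    have "{z \<in> space M. \<tau> z = enat m} = (space M \<inter> (\<Inter>s\<in>{..<m}. E s)) - E m"
    proof -
      have "\<tau> z = enat m \<longleftrightarrow> (\<forall>s<m. z \<in> E s) \<and> z \<notin> E m" for z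
        unfolding less[symmetric] by (cases "\<tau> z") (auto simp: not_less, metis less_le_not_le linorder_neqE_nat order_refl)
      then show ?thesis by auto
    qed
    moreover have "E s \<in> sets (F j m)" if "s \<le> m" for s
      using stops_afterD(1)[OF E] F_mono[OF that] by blast
    then have "(space M \<inter> (\<Inter>s\<in>{..<m}. E s)) - E m \<in> sets (F j m)"
      by (cases "m = 0") (auto intro!: sets.Diff sets.Int sets.finite_INT space_in_F)
    ultimately show "{z \<in> space M. \<tau> z = enat m} \<in> sets (F j m)" by simp
  qed
  moreover have "\<forall>z\<in>space M. enat n < \<tau> z"
    using less stops_afterD(4)[OF E] by auto
  ultimately have "AE z in M. ereal (gittins_ratio M q F X W j n \<tau> z) \<le> \<Gamma> n z"
    using Gittins unfolding is_gittins_index_def is_ess_sup_def by blast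
  moreover have "AE z in M. gittins_ratio M q F X W j n \<tau> z = ratio n E z"
    by (rule gittins_ratio_eq[OF E less])
  ultimately show ?thesis by eventually_elim simp
qed

text \<open>The minimality half of the essential supremum, carried over from stopping times to
  decreasing adapted sets; \<open>ratio_le_index\<close> is the other half.\<close>

lemma index_le:
  assumes Z: "Z \<in> borel_measurable M" and ub: "\<And>E. stops_after n E \<Longrightarrow> AE z in M. ereal (ratio n E z) \<le> Z z"
  shows "AE z in M. \<Gamma> n z \<le> Z z"
proof -
  have "AE z in M. ereal (gittins_ratio M q F X W j n \<tau> z) \<le> Z z"
    if \<tau>: "is_stopping_time M (F j) \<tau>" "\<forall>z\<in>space M. enat n < \<tau> z" for \<tau>
  proof -
    define E where "E s = {z \<in> space M. enat s < \<tau> z}" for s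
    have "E s = space M - (\<Union>m\<in>{..s}. {z \<in> space M. \<tau> z = enat m})" for s
    proof -
      have "enat s < \<tau> z \<longleftrightarrow> (\<forall>m\<le>s. \<tau> z \<noteq> enat m)" for z by (cases "\<tau> z") (auto simp: not_le[symmetric])
      then show ?thesis by (auto simp: E_def)
    qed
    moreover have "{z \<in> space M. \<tau> z = enat m} \<in> sets (F j s)" if "m \<le> s" for m s
      using \<tau>(1) F_mono[OF that] unfolding is_stopping_time_def by blast
    ultimately have "E s \<in> sets (F j s)" for s
      by (auto intro!: sets.Diff sets.finite_UN space_in_F)
    moreover have "E (Suc s) \<subseteq> E s" for s
      unfolding E_def using order.strict_trans[of "enat s" "enat (Suc s)"] by auto
    moreover have "E s = space M" if "s \<le> n" for s
      using \<tau>(2) that unfolding E_def by (auto intro: le_less_trans[of "enat s" "enat n"])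
    ultimately have E: "stops_after n E" by (simp add: stops_after_def adapted_down_def)
    have "AE z in M. gittins_ratio M q F X W j n \<tau> z = ratio n E z"
      by (rule gittins_ratio_eq[OF E]) (simp add: E_def)
    with ub[OF E] show ?thesis by eventually_elim simp
  qed
  then show ?thesis
    using Gittins Z unfolding is_gittins_index_def is_ess_sup_def by blast
qed

text \<open>The term at \<open>n\<close> alone contributes \<open>beta n\<close> and the others are
  nonnegative. This keeps the denominator of the ratio positive, so that ratio inequalities can be
  multiplied out.\<close>

lemma stopped_weight_ge: 
  assumes E: "stops_after n E"
  shows "AE z in M. beta n z \<le> cexp n (stopped (weight_from n) E) z"
proof -
  interpret S: sigma_finite_subalgebra M "F j n" by (rule sfs)
  interpret w: stop_problem M "F j" "weight_from n" by (rule stop_problem_weight)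
  have "AE z in M. beta n z \<le> stopped (weight_from n) E z"
    using AE_summable_beta AE_space
  proof eventually_elim
    case (elim z)
    have "summable (\<lambda>u. indicator (E u) z * weight_from n u z)"
      using elim(1) by (rule summable_comparison_test'[of _ 0]) 
        (use beta_pos in \<open>auto simp: indicator_def weight_from_def abs_of_pos less_imp_le\<close>)
    then have "(\<Sum>u\<in>{n}. indicator (E u) z * weight_from n u z) \<le> stopped (weight_from n) E z"
      unfolding stopped_def using beta_pos by (intro sum_le_suminf) (auto simp: weight_from_def less_imp_le)
    with elim(2) show ?case using stops_afterD(4)[OF E] by (simp add: weight_from_def)
  qed
  then have "AE z in M. cexp n (beta n) z \<le> cexp n (stopped (weight_from n) E) z"
    using integral_beta w.int_total[of E] stops_afterD(2)[OF E]
    by (intro S.real_cond_exp_mono) (auto simp: stopped_def[abs_def])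
  moreover have "AE z in M. cexp n (beta n) z = beta n z"
    by (rule S.real_cond_exp_F_meas[OF integral_beta(1) beta_meas])
  ultimately show ?thesis by eventually_elim simp
qed

text \<open>Since \<open>l\<close> is known at operation \<open>n\<close>, it comes out of the
  conditional expectation. The sign of the conditional excess is therefore the sign of
  \<open>ratio n E z - l z\<close>.\<close>

lemma
  assumes l: "l \<in> borel_measurable (F j n)" and int: "integrable M (\<lambda>z. l z * beta n z)"
    and E: "stops_after n E"
  shows integrable_stopped_excess: "integrable M (stopped (excess n l) E)"
    and integral_stopped_excess: "B \<in> sets (F j n) \<Longrightarrow>
      (\<integral>z. indicator B z * stopped (excess n l) E z \<partial>M) = stop_gain M (excess n l) (\<lambda>s. E s \<inter> B)"
    and cond_exp_stopped_excess: "AE z in M. cexp n (stopped (excess n l) E) z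
      = cexp n (stopped (weight_from n) E) z * (ratio n E z - l z)"
proof -
  interpret S: sigma_finite_subalgebra M "F j n" by (rule sfs)
  interpret w: stop_problem M "F j" "weight_from n" by (rule stop_problem_weight)
  interpret g: stop_problem M "F j" "gain_from n" by (rule stop_problem_gain)
  interpret e: stop_problem M "F j" "excess n l" by (rule stop_problem_excess[OF l int])
  note EM = stops_afterD(2)[OF E]
  show e: "integrable M (stopped (excess n l) E)"
    unfolding stopped_def using EM by (rule e.int_total)
  show "(\<integral>z. indicator B z * stopped (excess n l) E z \<partial>M) = stop_gain M (excess n l) (\<lambda>s. E s \<inter> B)"
    if "B \<in> sets (F j n)"
    unfolding stopped_def using EM F_subD[OF that] by (rule e.integral_total)
  have g: "integrable M (stopped (gain_from n) E)" and w: "integrable M (stopped (weight_from n) E)"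
    unfolding stopped_def using EM by (auto intro: g.int_total w.int_total)
  have eq: "AE z in M. l z * stopped (weight_from n) E z = stopped (gain_from n) E z - stopped (excess n l) E z"
    using g.AE_summable_Y[of E, OF EM] w.AE_summable_Y[of E, OF EM]
  proof eventually_elim
    case (elim z)
    have sg: "summable (\<lambda>u. indicator (E u) z * gain_from n u z)"
      using elim(1) by (rule summable_comparison_test'[of _ 0]) (auto simp: indicator_def)
    have sw: "summable (\<lambda>u. indicator (E u) z * weight_from n u z)"
      using elim(2) by (rule summable_comparison_test'[of _ 0]) (auto simp: indicator_def)
    have "stopped (excess n l) E z
      = (\<Sum>u. indicator (E u) z * gain_from n u z - l z * (indicator (E u) z * weight_from n u z))"
      unfolding stopped_def excess_def gain_from_def by (intro suminf_cong) (simp add: algebra_simps)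
    also have "\<dots> = stopped (gain_from n) E z - l z * stopped (weight_from n) E z"
      unfolding stopped_def using sg sw by (simp add: suminf_diff[symmetric] suminf_mult summable_mult)
    finally show ?case by simp
  qed
  have lw_m: "(\<lambda>z. l z * stopped (weight_from n) E z) \<in> borel_measurable M"
    using meas_M[OF l] w by (auto dest!: borel_measurable_integrable)
  \<comment> \<open>The factor \<open>l\<close> need not be bounded; integrability comes from
    writing the product as a difference of two integrable functions.\<close>
  have lw: "integrable M (\<lambda>z. l z * stopped (weight_from n) E z)"
    using eq Bochner_Integration.integrable_diff[OF g e] lw_m by (subst integrable_cong_AE) auto
  have "AE z in M. cexp n (stopped (excess n l) E) z
    = cexp n (\<lambda>z. stopped (gain_from n) E z - l z * stopped (weight_from n) E z) z"
    using eq e g lw_m by (intro S.real_cond_exp_cong) (auto elim!: eventually_mono)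
  moreover have "AE z in M. cexp n (\<lambda>z. stopped (gain_from n) E z - l z * stopped (weight_from n) E z) z
    = cexp n (stopped (gain_from n) E) z - cexp n (\<lambda>z. l z * stopped (weight_from n) E z) z"
    by (rule S.real_cond_exp_diff[OF g lw])
  moreover have "AE z in M. cexp n (\<lambda>z. l z * stopped (weight_from n) E z) z
    = l z * cexp n (stopped (weight_from n) E) z"
    using w by (intro S.real_cond_exp_mult[OF l _ lw]) auto
  ultimately show "AE z in M. cexp n (stopped (excess n l) E) z
      = cexp n (stopped (weight_from n) E) z * (ratio n E z - l z)"
    using stopped_weight_ge[OF E]
  proof eventually_elim
    case (elim z)
    then have "cexp n (stopped (weight_from n) E) z > 0"
      using beta_pos[of n z] by linarith
    then have "cexp n (stopped (weight_from n) E) z * ratio n E z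
      = cexp n (stopped (gain_from n) E) z" by (simp add: ratio_def)
    with elim show ?case by (simp add: right_diff_distrib mult.commute)
  qed
qed

text \<open>On \<open>B\<close> every ratio is at most the index, hence at most the rental, and the
  factor in front of the difference is positive.\<close>

lemma excess_nonpos:
  assumes l: "l \<in> borel_measurable (F j n)" and int: "integrable M (\<lambda>z. l z * beta n z)"
    and E: "stops_after n E" and B: "B \<in> sets (F j n)"
    and le: "AE z in M. z \<in> B \<longrightarrow> \<Gamma> n z \<le> ereal (l z)"
  shows "stop_gain M (excess n l) (\<lambda>s. E s \<inter> B) \<le> 0"
proof -
  interpret S: sigma_finite_subalgebra M "F j n" by (rule sfs)
  let ?k = "stopped (excess n l) E"
  have k: "integrable M ?k" by (rule integrable_stopped_excess[OF l int E])
  have "stop_gain M (excess n l) (\<lambda>s. E s \<inter> B) = (\<integral>z. indicator B z * ?k z \<partial>M)"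
    by (rule integral_stopped_excess[OF l int E B, symmetric])
  also have "\<dots> = (\<integral>z. indicator B z * cexp n ?k z \<partial>M)"
    using k B F_subD[OF B] by (intro S.real_cond_exp_intg(2)[symmetric] integrable_indicator_mult) auto
  also have "\<dots> \<le> (\<integral>z. 0 \<partial>M)"
  proof (rule integral_mono_AE)
    show "integrable M (\<lambda>z. indicator B z * cexp n ?k z)"
      by (intro integrable_indicator_mult S.real_cond_exp_int k F_subD[OF B])
    show "AE z in M. indicator B z * cexp n ?k z \<le> 0"
      using cond_exp_stopped_excess[OF l int E] stopped_weight_ge[OF E] le ratio_le_index[OF E]
    proof eventually_elim
      case (elim z)
      show ?case
      proof (cases "z \<in> B")
        case True
        then have "ratio n E z - l z \<le> 0"
          using elim(3,4) order_trans[of "ereal (ratio n E z)"] by fastforce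
        moreover have "0 \<le> cexp n (stopped (weight_from n) E) z"
          using elim(2) beta_pos[of n z] by linarith
        ultimately show ?thesis
          using elim(1) by (simp add: True mult_nonneg_nonpos)
      qed simp
    qed
  qed simp
  finally show ?thesis by simp
qed

text \<open>The converse of \<open>excess_nonpos\<close>. Gains over all sub-events of
  \<open>B\<close> are needed, because the sign of a conditional expectation is read off by
  testing.\<close>

lemma index_le_of_excess_nonpos:
  assumes l: "l \<in> borel_measurable (F j n)" and int: "integrable M (\<lambda>z. l z * beta n z)"
    and B: "B \<in> sets (F j n)"
    and le: "\<And>E B'. stops_after n E \<Longrightarrow> B' \<in> sets (F j n) \<Longrightarrow> B' \<subseteq> B \<Longrightarrow> 
      stop_gain M (excess n l) (\<lambda>s. E s \<inter> B') \<le> 0"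
  shows "AE z in M. z \<in> B \<longrightarrow> \<Gamma> n z \<le> ereal (l z)"
proof -
  interpret S: sigma_finite_subalgebra M "F j n" by (rule sfs)
  \<comment> \<open>Replacing the index by \<open>l\<close> on \<open>B\<close> only gives a global
    upper bound of all ratios, to which minimality of the essential supremum applies.\<close>
  define Z where "Z z = (if z \<in> B then ereal (l z) else \<Gamma> n z)" for z
  have "\<Gamma> n \<in> borel_measurable M"
    using Gittins meas_M unfolding is_gittins_index_def by blast
  then have Z: "Z \<in> borel_measurable M"
    unfolding Z_def using meas_M[OF l] F_subD[OF B] by measurable
  have "AE z in M. \<Gamma> n z \<le> Z z"
  proof (rule index_le[OF Z])
    fix E assume E: "stops_after n E"
    have "AE z in M. z \<in> B \<longrightarrow> cexp n (stopped (excess n l) E) z \<le> 0"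
      using le[OF E] integral_stopped_excess[OF l int E]
      by (intro S.real_cond_exp_nonpos_on integrable_stopped_excess[OF l int E] B) auto
    then show "AE z in M. ereal (ratio n E z) \<le> Z z"
      using cond_exp_stopped_excess[OF l int E] stopped_weight_ge[OF E] ratio_le_index[OF E]
    proof eventually_elim
      case (elim z)
      have "0 < cexp n (stopped (weight_from n) E) z"
        using elim(3) beta_pos[of n z] by linarith
      with elim show ?case by (auto simp: Z_def mult_le_0_iff)
    qed
  qed
  then show ?thesis by eventually_elim (auto simp: Z_def)
qed

text \<open>Every numerator is at most the conditional expectation of the total absolute discounted
  reward, and every denominator is at least \<open>beta n\<close>. The bound yields finiteness of
  the index and integrability after discounting.\<close>

lemma index_bound:
  obtains c where "\<And>n. c n \<in> borel_measurable (F j n)" "\<And>n. integrable M (c n)"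
    "\<And>n. AE z in M. \<bar>\<Gamma> n z\<bar> \<le> ereal (c n z / beta n z)"
proof
  define Y where "Y = (\<lambda>z. \<Sum>u. \<bar>beta u z * X j u z\<bar>)"
  define c where "c n = cexp n Y" for n
  have aeY: "AE z in M. summable (\<lambda>u. \<bar>beta u z * X j u z\<bar>)"
    by (rule AE_summable_norm[OF integrable_beta_X summable_beta_X])
  have Y: "integrable M Y"
    unfolding Y_def using summable_beta_X aeY by (intro integrable_suminf integrable_abs integrable_beta_X) auto
  fix n
  interpret S: sigma_finite_subalgebra M "F j n" by (rule sfs)
  interpret g: stop_problem M "F j" "gain_from n" by (rule stop_problem_gain)
  show cm: "c n \<in> borel_measurable (F j n)" unfolding c_def by measurable
  show "integrable M (c n)" unfolding c_def by (rule S.real_cond_exp_int[OF Y])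
  have bound: "AE z in M. \<bar>ratio n E z\<bar> \<le> c n z / beta n z" if E: "stops_after n E" for E
  proof -
    note EM = stops_afterD(2)[OF E]
    have g: "integrable M (stopped (gain_from n) E)"
      unfolding stopped_def using EM by (rule g.int_total)
    have le: "AE z in M. \<bar>stopped (gain_from n) E z\<bar> \<le> Y z"
      using aeY
    proof eventually_elim
      case (elim z)
      have le1: "\<bar>indicator (E u) z * gain_from n u z\<bar> \<le> \<bar>beta u z * X j u z\<bar>" for u
        by (auto simp: indicator_def gain_from_def weight_from_def)
      have s: "summable (\<lambda>u. \<bar>indicator (E u) z * gain_from n u z\<bar>)"
        using elim by (rule summable_comparison_test'[of _ 0]) (use le1 in auto)
      have "\<bar>stopped (gain_from n) E z\<bar> \<le> (\<Sum>u. \<bar>indicator (E u) z * gain_from n u z\<bar>)"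
        unfolding stopped_def by (rule summable_rabs[OF s])
      also have "\<dots> \<le> Y z" unfolding Y_def by (intro suminf_le le1 s elim)
      finally show ?case .
    qed
    have "AE z in M. cexp n (stopped (gain_from n) E) z \<le> c n z"
      unfolding c_def using le by (intro S.real_cond_exp_mono g Y) auto
    moreover have "AE z in M. cexp n (\<lambda>z. (-1) * Y z) z \<le> cexp n (stopped (gain_from n) E) z"
      using le by (intro S.real_cond_exp_mono g integrable_mult_right Y) auto
    moreover have "AE z in M. cexp n (\<lambda>z. (-1) * Y z) z = - c n z"
      using S.real_cond_exp_cmult[OF Y, of "-1"] by (simp add: c_def)
    ultimately show ?thesis
      using stopped_weight_ge[OF E]
    proof eventually_elim
      case (elim z)
      define N D where "N = cexp n (stopped (gain_from n) E) z"
        and "D = cexp n (stopped (weight_from n) E) z"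
      have "\<bar>N\<bar> \<le> c n z" "beta n z \<le> D" using elim by (auto simp: N_def D_def)
      then have "\<bar>N\<bar> / D \<le> c n z / beta n z"
        using beta_pos[of n z] by (intro frac_le) auto
      moreover have "D > 0" using \<open>beta n z \<le> D\<close> beta_pos[of n z] by linarith
      ultimately show ?case by (simp add: ratio_def N_def[symmetric] D_def[symmetric])
    qed
  qed
  \<comment> \<open>One admissible rule suffices for the lower bound; the rule that never stops is
    the simplest.\<close>
  have "stops_after n (\<lambda>_. space M)"
    by (simp add: stops_after_def adapted_down_def)
  from bound[OF this] ratio_le_index[OF this]
  have lower: "AE z in M. ereal (- (c n z / beta n z)) \<le> \<Gamma> n z"
    by eventually_elim (rule order_trans, auto)
  have "(\<lambda>z. ereal (c n z / beta n z)) \<in> borel_measurable M"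
    using meas_M[OF cm] beta_meas_M by measurable
  then have "AE z in M. \<Gamma> n z \<le> ereal (c n z / beta n z)"
    by (rule index_le) (use bound in \<open>fastforce elim!: eventually_mono\<close>)
  with lower show "AE z in M. \<bar>\<Gamma> n z\<bar> \<le> ereal (c n z / beta n z)"
    by eventually_elim (rule ereal_abs_leI, auto simp: ereal_uminus_le_reorder[of "\<Gamma> n _"])
qed

end

section \<open>Integrability of the index and of the prevailing charge\<close>

context arm
begin

text \<open>Infinite values become 0 under \<open>real_of_ereal\<close>; \<open>AE_index_eq\<close>
  shows that this concerns a null set only.\<close>

definition idx :: "nat \<Rightarrow> 'a \<Rightarrow> real" where "idx n z = real_of_ereal (\<Gamma> n z)"

primrec charge :: "nat \<Rightarrow> 'a \<Rightarrow> real" where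
  "charge 0 z = idx 0 z"
| "charge (Suc n) z = min (charge n z) (idx (Suc n) z)"

lemma charge_le_idx: "charge n z \<le> idx n z"
  by (cases n) auto

lemma charge_antimono: "m \<le> n \<Longrightarrow> charge n z \<le> charge m z"
  by (rule lift_Suc_antimono_le[of "\<lambda>n. charge n z"]) auto

lemma idx_meas: "idx n \<in> borel_measurable (F j n)"
proof -
  have "\<Gamma> n \<in> borel_measurable (F j n)" using Gittins unfolding is_gittins_index_def by blast
  then show ?thesis unfolding idx_def[abs_def] by measurable
qed

lemma charge_meas: "charge n \<in> borel_measurable (F j n)"
proof (induction n)
  case 0
  then show ?case using idx_meas[of 0] by (simp cong: measurable_cong)
next
  case (Suc n)
  have "(\<lambda>z. min (charge n z) (idx (Suc n) z)) \<in> borel_measurable (F j (Suc n))"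
    using meas_mono[OF Suc, of "Suc n"] idx_meas[of "Suc n"] by measurable
  then show ?case by (simp cong: measurable_cong)
qed

lemma AE_index_eq: "AE z in M. \<forall>n. \<Gamma> n z = ereal (idx n z)"
  unfolding AE_all_countable
proof
  fix n
  obtain c where "\<And>n. c n \<in> borel_measurable (F j n)" "\<And>n. integrable M (c n)"
    and c: "\<And>n. AE z in M. \<bar>\<Gamma> n z\<bar> \<le> ereal (c n z / beta n z)" by (rule index_bound) (rule that)
  show "AE z in M. \<Gamma> n z = ereal (idx n z)"
    using c[of n]
  proof eventually_elim
    case (elim z)
    then have "\<bar>\<Gamma> n z\<bar> \<noteq> \<infinity>" by auto
    then show ?case by (simp add: idx_def ereal_real')
  qed
qed

lemma integrable_idx: "integrable M (\<lambda>z. idx n z * beta n z)"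
proof -
  obtain c where "\<And>n. c n \<in> borel_measurable (F j n)" and ci: "\<And>n. integrable M (c n)"
    and c: "\<And>n. AE z in M. \<bar>\<Gamma> n z\<bar> \<le> ereal (c n z / beta n z)" by (rule index_bound) (rule that)
  show ?thesis
  proof (rule Bochner_Integration.integrable_bound[OF ci[of n]])
    show "(\<lambda>z. idx n z * beta n z) \<in> borel_measurable M"
      using meas_M[OF idx_meas] beta_meas_M by measurable
    show "AE z in M. norm (idx n z * beta n z) \<le> norm (c n z)"
      using c[of n] AE_index_eq
    proof eventually_elim
      case (elim z)
      then have "\<bar>ereal (idx n z)\<bar> \<le> ereal (c n z / beta n z)" by metis
      then have "\<bar>idx n z\<bar> \<le> c n z / beta n z" by simp
      then show ?case using beta_pos[of n z] by (simp add: abs_mult field_simps)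
    qed
  qed
qed

text \<open>Operating exactly once more is an admissible rule, and its ratio is the immediate
  reward.\<close>

lemma AE_X_le_idx: "AE z in M. X j n z \<le> idx n z"
proof -
  interpret S: sigma_finite_subalgebra M "F j n" by (rule sfs)
  interpret w: stop_problem M "F j" "weight_from n" by (rule stop_problem_weight)
  interpret g: stop_problem M "F j" "gain_from n" by (rule stop_problem_gain)
  define E where "E s = (if s \<le> n then space M else {})" for s
  have E: "stops_after n E" by (auto simp: stops_after_def adapted_down_def E_def)
  have single: "stopped Y E z = Y n z" if "z \<in> space M" "\<And>s. s < n \<Longrightarrow> Y s z = 0" for Y z
  proof -
    have "indicator (E u) z * Y u z = (if u = n then Y n z else 0)" for u
      using that by (auto simp: E_def)
    then show ?thesis unfolding stopped_def by (simp add: suminf_split_initial_segment[OF _, of _ "Suc n"] suminf_finite[of "{n}"])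
  qed
  have g: "integrable M (stopped (gain_from n) E)" and w: "integrable M (stopped (weight_from n) E)"
    unfolding stopped_def using stops_afterD(2)[OF E] by (auto intro: g.int_total w.int_total)
  have "AE z in M. cexp n (stopped (gain_from n) E) z = cexp n (\<lambda>z. beta n z * X j n z) z"
  proof (rule S.real_cond_exp_cong)
    show "AE z in M. stopped (gain_from n) E z = beta n z * X j n z"
      by (rule AE_I2) (simp add: single gain_from_def weight_from_def)
  qed (use g integrable_beta_X in auto)
  moreover have "AE z in M. cexp n (stopped (weight_from n) E) z = cexp n (beta n) z"
  proof (rule S.real_cond_exp_cong)
    show "AE z in M. stopped (weight_from n) E z = beta n z"
      by (rule AE_I2) (simp add: single weight_from_def)
  qed (use w integral_beta in auto)
  moreover have "AE z in M. cexp n (beta n) z = beta n z"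
    by (rule S.real_cond_exp_F_meas[OF integral_beta(1) beta_meas])
  moreover have "AE z in M. cexp n (\<lambda>z. beta n z * X j n z) z = beta n z * X j n z"
    using beta_meas X_meas by (intro S.real_cond_exp_F_meas integrable_beta_X) measurable
  ultimately show ?thesis
    using ratio_le_index[OF E] AE_index_eq
  proof eventually_elim
    case (elim z)
    then have "ratio n E z = X j n z" using beta_pos[of n z] by (simp add: ratio_def)
    with elim(5,6) show ?case by simp
  qed
qed

text \<open>From above the charge is bounded by the first index, from below by the smallest index so
  far, which dominates the reward of the same operation. A sum replaces the smallest reward because
  its discounted expectation can be computed.\<close>

lemma AE_charge_bound: "AE z in M. \<forall>u. \<bar>charge u z\<bar> \<le> \<bar>idx 0 z\<bar> + (\<Sum>v\<le>u. \<bar>X j v z\<bar>)"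
proof -
  have "AE z in M. \<forall>n. X j n z \<le> idx n z" using AE_X_le_idx by (simp add: AE_all_countable)
  then show ?thesis
  proof eventually_elim
    case (elim z)
    show ?case
    proof
      fix u
      have "- (\<Sum>v\<le>u. \<bar>X j v z\<bar>) \<le> charge u z"
      proof (induction u)
        case 0
        then show ?case using elim[rule_format, of 0] by simp
      next
        case (Suc u)
        have "0 \<le> (\<Sum>v\<le>u. \<bar>X j v z\<bar>)" by (rule sum_nonneg) simp
        moreover have "- \<bar>X j (Suc u) z\<bar> \<le> idx (Suc u) z" using elim[rule_format, of "Suc u"] by linarith
        ultimately show ?case using Suc by (simp; linarith)
      qed
      moreover have "0 \<le> (\<Sum>v\<le>u. \<bar>X j v z\<bar>)" by (rule sum_nonneg) simp
      moreover have "charge u z \<le> idx 0 z" using charge_antimono[of 0 u] by simp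
      ultimately show "\<bar>charge u z\<bar> \<le> \<bar>idx 0 z\<bar> + (\<Sum>v\<le>u. \<bar>X j v z\<bar>)" by linarith
    qed
  qed
qed

text \<open>In the bound of \<open>AE_charge_bound\<close>, the reward of operation \<open>v\<close>
  is discounted as of operation \<open>u\<close>, which costs \<open>\<rho> ^ (u - v)\<close> in
  expectation. The resulting double sum is a Cauchy product of two convergent series.\<close>

lemma
  shows integrable_beta_charge: "integrable M (\<lambda>z. beta u z * charge u z)"
    and summable_beta_charge: "summable (\<lambda>u. \<integral>z. \<bar>beta u z * charge u z\<bar> \<partial>M)"
proof -
  define f where "f u z = \<bar>idx 0 z\<bar> * beta u z + (\<Sum>v\<le>u. \<bar>X j v z\<bar> * beta u z)" for u z
  have b: "AE z in M. \<bar>beta u z * charge u z\<bar> \<le> f u z" for u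
    using AE_charge_bound
  proof eventually_elim
    case (elim z)
    then have "beta u z * \<bar>charge u z\<bar> \<le> beta u z * (\<bar>idx 0 z\<bar> + (\<Sum>v\<le>u. \<bar>X j v z\<bar>))"
      using beta_pos[of u z] by (intro mult_left_mono) auto
    then show ?case using beta_pos[of u z]
      by (simp add: f_def abs_mult distrib_left sum_distrib_left sum_distrib_right mult.commute)
  qed
  have i0: "integrable M (\<lambda>z. \<bar>idx 0 z\<bar> * beta u z)"
    "(\<integral>z. \<bar>idx 0 z\<bar> * beta u z \<partial>M) = (\<integral>z. \<bar>idx 0 z\<bar> \<partial>M) * \<rho> ^ u" for u
    using beta_shift[of "\<lambda>z. \<bar>idx 0 z\<bar>" 0 u] idx_meas[of 0] integrable_idx[of 0] by auto
  have bX: "\<bar>X j v z\<bar> * beta v z = \<bar>beta v z * X j v z\<bar>" for v z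
    using beta_pos[of v z] by (simp add: abs_mult)
  have iX: "integrable M (\<lambda>z. \<bar>X j v z\<bar> * beta u z)"
    "(\<integral>z. \<bar>X j v z\<bar> * beta u z \<partial>M) = (\<integral>z. \<bar>beta v z * X j v z\<bar> \<partial>M) * \<rho> ^ (u - v)" if "v \<le> u" for u v
    using beta_shift[of "\<lambda>z. \<bar>X j v z\<bar>" v "u - v"] X_meas[of v] integrable_beta_X[of v] that
    by (auto simp: bX)
  have fi: "integrable M (f u)" for u
    unfolding f_def by (intro Bochner_Integration.integrable_add Bochner_Integration.integrable_sum i0 iX) simp
  show int: "integrable M (\<lambda>z. beta u z * charge u z)" for u
  proof (rule Bochner_Integration.integrable_bound[OF fi[of u]])
    show "(\<lambda>z. beta u z * charge u z) \<in> borel_measurable M"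
      using beta_meas_M meas_M[OF charge_meas] by measurable
    show "AE z in M. norm (beta u z * charge u z) \<le> norm (f u z)"
      using b[of u] by eventually_elim auto
  qed
  have fe: "(\<integral>z. f u z \<partial>M) = (\<integral>z. \<bar>idx 0 z\<bar> \<partial>M) * \<rho> ^ u
      + (\<Sum>v\<le>u. (\<integral>z. \<bar>beta v z * X j v z\<bar> \<partial>M) * \<rho> ^ (u - v))" for u
    unfolding f_def by (subst Bochner_Integration.integral_add)
      (auto simp: Bochner_Integration.integral_sum i0 iX intro!: Bochner_Integration.integrable_sum)
  have "summable (\<lambda>u. \<Sum>v\<le>u. (\<integral>z. \<bar>beta v z * X j v z\<bar> \<partial>M) * \<rho> ^ (u - v))"
    using summable_beta_X summable_rho \<rho>_nonneg by (intro summable_Cauchy_product) auto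
  then have "summable (\<lambda>u. \<integral>z. f u z \<partial>M)"
    unfolding fe by (intro summable_add summable_mult summable_rho)
  then show "summable (\<lambda>u. \<integral>z. \<bar>beta u z * charge u z\<bar> \<partial>M)"
    using b int fi by (rule_tac summable_comparison_test'[of _ 0]) (auto intro!: integral_mono_AE)
qed

lemma integrable_charge_n: "integrable M (\<lambda>z. charge n z * beta n z)"
  using integrable_beta_charge[of n] by (simp add: mult.commute)

text \<open>The slack \<open>e\<close> is positive when the charge is lowered and zero for the
  charge itself.\<close>

lemma stop_problem_charge:
  assumes A: "A \<in> sets M"
  shows "stop_problem M (F j) (\<lambda>s z. indicator A z * (weight_from v s z * (X j s z - charge s z + e)))"
proof
  fix s
  define a where "a s = (\<integral>z. \<bar>beta s z * X j s z\<bar> \<partial>M) + (\<integral>z. \<bar>beta s z * charge s z\<bar> \<partial>M) + \<bar>e\<bar> * \<rho> ^ s" for s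
  have eq: "indicator A z * (weight_from v s z * (X j s z - charge s z + e))
    = indicator (if v \<le> s then A else {}) z * (beta s z * X j s z - beta s z * charge s z + e * beta s z)" for s z
    by (auto simp: weight_from_def indicator_def algebra_simps)
  have i: "integrable M (\<lambda>z. beta s z * X j s z - beta s z * charge s z + e * beta s z)" for s
    using integrable_beta_X integrable_beta_charge integral_beta by auto
  show int: "integrable M (\<lambda>z. indicator A z * (weight_from v s z * (X j s z - charge s z + e)))" for s
    unfolding eq using A by (intro integrable_indicator_mult i) auto
  have sa: "summable a"
    unfolding a_def[abs_def] by (intro summable_add summable_beta_X summable_beta_charge summable_mult summable_rho)
  show "summable (\<lambda>s. \<integral>z. \<bar>indicator A z * (weight_from v s z * (X j s z - charge s z + e))\<bar> \<partial>M)"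
  proof (rule summable_comparison_test'[OF sa, of 0])
    fix s
    have "(\<integral>z. \<bar>indicator A z * (weight_from v s z * (X j s z - charge s z + e))\<bar> \<partial>M)
      \<le> (\<integral>z. \<bar>beta s z * X j s z\<bar> + \<bar>beta s z * charge s z\<bar> + \<bar>e\<bar> * beta s z \<partial>M)"
    proof (rule integral_mono)
      show "\<bar>indicator A z * (weight_from v s z * (X j s z - charge s z + e))\<bar>
        \<le> \<bar>beta s z * X j s z\<bar> + \<bar>beta s z * charge s z\<bar> + \<bar>e\<bar> * beta s z" for z
      proof -
        have "\<bar>e * beta s z\<bar> = \<bar>e\<bar> * beta s z" using beta_pos[of s z] by (simp add: abs_mult)
        then show ?thesis unfolding eq by (auto simp: indicator_def)
      qed
    qed (use int integrable_beta_X integrable_beta_charge integral_beta in auto)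
    also have "\<dots> = a s"
      unfolding a_def using integrable_beta_X[of s] integrable_beta_charge[of s] integral_beta[of s] by simp
    finally show "norm (\<integral>z. \<bar>indicator A z * (weight_from v s z * (X j s z - charge s z + e))\<bar> \<partial>M) \<le> a s"
      by simp
  qed
qed (rule F_le_M)

end

text \<open>Exactly one position is the last one up to \<open>s\<close> at which \<open>R\<close>
  holds, and \<open>R v\<close> makes sure that there is one. This assigns each operation to the
  record that opened its interval.\<close>

lemma sum_last_occurrence:
  fixes v s :: nat
  assumes "R v" "v \<le> s"
  shows "(\<Sum>n=v..s. of_bool (R n \<and> (\<forall>u\<in>{n<..s}. \<not> R u)) :: real) = 1"
  using assms(2)
proof (induction s rule: dec_induct)
  case base
  then show ?case using assms(1) by simp
next
  case (step s)
  have *: "(\<forall>u\<in>{n<..Suc s}. \<not> R u) \<longleftrightarrow> (\<forall>u\<in>{n<..s}. \<not> R u) \<and> \<not> R (Suc s)" if "n \<le> s" for n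
    using that by (auto simp: le_Suc_eq)
  show ?case
  proof (cases "R (Suc s)")
    case True
    then have "(\<Sum>n=v..s. of_bool (R n \<and> (\<forall>u\<in>{n<..Suc s}. \<not> R u)) :: real) = 0"
      by (intro sum.neutral) (auto simp: *)
    with True step show ?thesis by (simp add: sum.nat_ivl_Suc')
  next
    case False
    then have "(\<Sum>n=v..s. of_bool (R n \<and> (\<forall>u\<in>{n<..Suc s}. \<not> R u)) :: real)
      = (\<Sum>n=v..s. of_bool (R n \<and> (\<forall>u\<in>{n<..s}. \<not> R u)))"
      by (intro sum.cong) (auto simp: *)
    with False step show ?thesis by (simp add: sum.nat_ivl_Suc')
  qed
qed

lemma indicator_idem_mult: "indicator A x * (indicator A x * y) = (indicator A x * y :: real)"
  by (simp add: indicator_def)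

section \<open>Sign of the net profit after paying the charge\<close>

context arm
begin

text \<open>A running minimum changes only at a position where the index attains it.\<close>

lemma charge_eq_of_no_record:
  "n \<le> s \<Longrightarrow> (\<And>u. n < u \<Longrightarrow> u \<le> s \<Longrightarrow> idx u z \<noteq> charge u z) \<Longrightarrow> charge s z = charge n z"
proof (induction s rule: dec_induct)
  case (step s)
  have "idx (Suc s) z \<noteq> charge (Suc s) z" by (rule step.prems) (use step.hyps in auto)
  then have "charge (Suc s) z = charge s z" by (auto simp: min_def split: if_splits)
  with step show ?case by auto
qed simp

text \<open>Ties with an earlier minimum count as records, and operation 0 is always one, because
  \<open>charge 0\<close> is \<open>idx 0\<close>.\<close>

definition at_record :: "nat \<Rightarrow> 'a set" where
  "at_record n = {z \<in> space M. idx n z = charge n z}"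

lemma at_record_sets: "at_record n \<in> sets (F j n)"
proof -
  have "{z \<in> space (F j n). idx n z = charge n z} \<in> sets (F j n)"
    using idx_meas[of n] charge_meas[of n] by measurable
  then show ?thesis by (simp add: at_record_def)
qed

lemma integrable_diff_charge: "integrable M (\<lambda>z. beta s z * (X j s z - charge s z))"
  unfolding right_diff_distrib using integrable_beta_X integrable_beta_charge by auto

text \<open>Every time after the record \<open>v\<close> belongs to exactly one interval between consecutive records
  \<open>n\<close>, on which the charge is constantly equal to the index at \<open>n\<close>.\<close>

lemma charge_excess_nonpos_finite:
  assumes A: "A \<in> sets (F j v)" "A \<subseteq> at_record v"
  shows "(\<Sum>s\<in>{v..<N}. \<integral>z. indicator A z * (beta s z * (X j s z - charge s z)) \<partial>M) \<le> 0"
proof -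
  define C where "C n = A \<inter> at_record n" for n
  \<comment> \<open>The rule started at \<open>n\<close> that stops at the next record or at the
    horizon \<open>N\<close>, whichever comes first, but operates at \<open>n\<close> in any case.
    The horizon keeps all sums finite.\<close>
  define E where "E n s = (if s \<le> n then space M else {z \<in> space M. s < N \<and> (\<forall>u\<in>{n<..s}. idx u z \<noteq> charge u z)})" for n s
  define I where "I n s = (\<integral>z. indicator (E n s \<inter> C n) z * (beta s z * (X j s z - charge s z)) \<partial>M)" for n s
  have E_stops: "stops_after n (E n)" for n
  proof -
    have "E n s \<in> sets (F j s)" for s
    proof -
      have "{z \<in> space M. s < N \<and> (\<forall>u\<in>{n<..s}. idx u z \<noteq> charge u z)}
        = (if s < N then space M - (\<Union>u\<in>{n<..s}. at_record u) else {})"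
        by (auto simp: at_record_def)
      moreover have "at_record u \<in> sets (F j s)" if "u \<le> s" for u
        using at_record_sets F_mono[OF that] by auto
      ultimately show ?thesis unfolding E_def by (auto intro!: sets.Diff sets.finite_UN)
    qed
    moreover have "E n (Suc s) \<subseteq> E n s" for s
      unfolding E_def by auto
    ultimately show ?thesis by (auto simp: stops_after_def adapted_down_def E_def)
  qed
  have C_sets: "C n \<in> sets (F j n)" if "v \<le> n" for n
    using A at_record_sets F_mono[OF that] by (auto simp: C_def)
  have I_int: "integrable M (\<lambda>z. indicator (E n s \<inter> C n) z * (beta s z * (X j s z - charge s z)))" if "v \<le> n" for n s
    using stops_afterD(2)[OF E_stops] F_subD[OF C_sets[OF that]]
    by (intro integrable_indicator_mult integrable_diff_charge) auto
  \<comment> \<open>At the record \<open>n\<close> index and charge agree, and the charge stays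
    constant during the cycle. So the arm faces a fixed rental equal to its index, against which no
    rule gains.\<close>
  have cycle: "(\<Sum>s\<in>{n..<N}. I n s) \<le> 0" if n: "v \<le> n" "n < N" for n
  proof -
    have "stop_gain M (excess n (charge n)) (\<lambda>s. E n s \<inter> C n) \<le> 0"
    proof (rule excess_nonpos[OF charge_meas integrable_charge_n E_stops C_sets[OF n(1)]])
      show "AE z in M. z \<in> C n \<longrightarrow> \<Gamma> n z \<le> ereal (charge n z)"
        using AE_index_eq by eventually_elim (auto simp: C_def at_record_def)
    qed
    also have "stop_gain M (excess n (charge n)) (\<lambda>s. E n s \<inter> C n) = (\<Sum>s\<in>{n..<N}. I n s)"
    proof -
      have "stop_gain M (excess n (charge n)) (\<lambda>s. E n s \<inter> C n)
        = (\<Sum>s\<in>{n..<N}. \<integral>z. indicator (E n s \<inter> C n) z * excess n (charge n) s z \<partial>M)"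
        unfolding stop_gain_def
      proof (rule suminf_finite)
        fix s assume "s \<notin> {n..<N}"
        then have "s < n \<or> E n s = {}" using n by (auto simp: E_def)
        then show "(\<integral>z. indicator (E n s \<inter> C n) z * excess n (charge n) s z \<partial>M) = 0"
          by (auto simp: excess_def weight_from_def)
      qed simp
      also have "\<dots> = (\<Sum>s\<in>{n..<N}. I n s)"
        unfolding I_def
      proof (intro sum.cong Bochner_Integration.integral_cong refl)
        fix s z assume s: "s \<in> {n..<N}" and "z \<in> space M"
        show "indicator (E n s \<inter> C n) z * excess n (charge n) s z
          = indicator (E n s \<inter> C n) z * (beta s z * (X j s z - charge s z))"
        proof (cases "z \<in> E n s \<inter> C n")
          case True
          then have "charge s z = charge n z"
            using s by (intro charge_eq_of_no_record) (auto simp: E_def split: if_splits)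
          then show ?thesis using s by (simp add: excess_def weight_from_def)
        qed simp
      qed
      finally show ?thesis .
    qed
    finally show ?thesis .
  qed
  have "(\<integral>z. indicator A z * (beta s z * (X j s z - charge s z)) \<partial>M) = (\<Sum>n=v..s. I n s)"
    if s: "v \<le> s" "s < N" for s
  proof -
    have "(\<Sum>n=v..s. I n s) = (\<integral>z. (\<Sum>n=v..s. indicator (E n s \<inter> C n) z * (beta s z * (X j s z - charge s z))) \<partial>M)"
      unfolding I_def using I_int by (intro Bochner_Integration.integral_sum[symmetric]) auto
    also have "\<dots> = (\<integral>z. indicator A z * (beta s z * (X j s z - charge s z)) \<partial>M)"
    proof (intro Bochner_Integration.integral_cong refl)
      fix z assume z: "z \<in> space M"
      have "(\<Sum>n=v..s. indicator (E n s \<inter> C n) z :: real) = indicator A z"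
      proof (cases "z \<in> A")
        case True
        have "(\<Sum>n=v..s. indicator (E n s \<inter> C n) z :: real)
          = (\<Sum>n=v..s. of_bool (z \<in> at_record n \<and> (\<forall>u\<in>{n<..s}. z \<notin> at_record u)))"
          using True z s by (intro sum.cong) (auto simp: indicator_def E_def C_def at_record_def)
        also have "\<dots> = 1" using True A(2) s by (intro sum_last_occurrence) auto
        finally show ?thesis using True by simp
      qed (auto simp: C_def)
      then show "(\<Sum>n=v..s. indicator (E n s \<inter> C n) z * (beta s z * (X j s z - charge s z)))
        = indicator A z * (beta s z * (X j s z - charge s z))"
        by (simp add: sum_distrib_right[symmetric])
    qed
    finally show ?thesis by simp
  qed
  then have "(\<Sum>s\<in>{v..<N}. \<integral>z. indicator A z * (beta s z * (X j s z - charge s z)) \<partial>M) = (\<Sum>s\<in>{v..<N}. \<Sum>n=v..s. I n s)"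
    by (intro sum.cong) auto
  \<comment> \<open>Regrouping from operations to cycles.\<close>
  also have "\<dots> = (\<Sum>n\<in>{v..<N}. \<Sum>s\<in>{n..<N}. I n s)"
    unfolding sum.Sigma[OF finite_atLeastLessThan ballI[OF finite_atLeastAtMost]] sum.Sigma[OF finite_atLeastLessThan ballI[OF finite_atLeastLessThan]]
    by (rule sum.reindex_bij_witness[of _ "\<lambda>(n, s). (s, n)" "\<lambda>(s, n). (n, s)"]) auto
  also have "\<dots> \<le> 0" by (rule sum_nonpos) (use cycle in auto)
  finally show ?thesis .
qed

text \<open>The bound is uniform in the horizon, so it survives letting the horizon tend to
  infinity.\<close>

lemma charge_excess_nonpos:
  assumes A: "A \<in> sets (F j v)" "A \<subseteq> at_record v"
  shows "(\<Sum>s. \<integral>z. indicator A z * (weight_from v s z * (X j s z - charge s z)) \<partial>M) \<le> 0"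
proof -
  interpret p: stop_problem M "F j" "\<lambda>s z. indicator A z * (weight_from v s z * (X j s z - charge s z + 0))"
    by (rule stop_problem_charge[OF F_subD[OF A(1)]])
  let ?a = "\<lambda>s. \<integral>z. indicator A z * (weight_from v s z * (X j s z - charge s z)) \<partial>M"
  have "summable ?a"
    using p.summable_gain[of "\<lambda>_. A"] F_subD[OF A(1)] by (simp add: indicator_idem_mult)
  then have "(\<lambda>N. \<Sum>s<N. ?a s) \<longlonglongrightarrow> suminf ?a" by (rule summable_LIMSEQ)
  moreover have "(\<Sum>s<N. ?a s) \<le> 0" for N
  proof -
    have "(\<Sum>s<N. ?a s) = (\<Sum>s\<in>{v..<N}. ?a s)"
      by (intro sum.mono_neutral_right) (auto simp: weight_from_def)
    also have "\<dots> = (\<Sum>s\<in>{v..<N}. \<integral>z. indicator A z * (beta s z * (X j s z - charge s z)) \<partial>M)"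
      by (intro sum.cong) (auto simp: weight_from_def)
    also have "\<dots> \<le> 0" by (rule charge_excess_nonpos_finite[OF A])
    finally show ?thesis .
  qed
  ultimately show ?thesis by (intro LIMSEQ_le_const2) auto
qed

text \<open>With the charge lowered by \<open>e > 0\<close> it is never worth stopping: wherever the maximiser stopped,
  the index would be at most \<open>charge - e\<close>.\<close>

lemma discounted_charge_excess_nonneg:
  assumes A: "A \<in> sets (F j v)" and e: "e > 0"
  shows "0 \<le> (\<Sum>s. \<integral>z. indicator A z * (weight_from v s z * (X j s z - charge s z + e)) \<partial>M)"
proof -
  define Y where "Y = (\<lambda>s z. indicator A z * (weight_from v s z * (X j s z - charge s z + e)))"
  interpret p: stop_problem M "F j" Y
    unfolding Y_def by (rule stop_problem_charge[OF F_subD[OF A]])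
  obtain E0 where E0: "adapted_down M (F j) E0" and max0: "\<And>E'. adapted_down M (F j) E' \<Longrightarrow> stop_gain M Y E' \<le> stop_gain M Y E0"
    by (rule p.stop_gain_maximizer) blast
  \<comment> \<open>The terms before \<open>v\<close> vanish, so enlarging the sets there does not
    change the gain, and now no point has stopped before \<open>v\<close>.\<close>
  define E where "E s = (if s < v then space M else E0 s)" for s
  have E: "adapted_down M (F j) E"
    using E0 F_subD sets.sets_into_space unfolding adapted_down_def E_def by (auto; blast)
  have "stop_gain M Y E = stop_gain M Y E0"
    unfolding stop_gain_def by (intro suminf_cong) (auto simp: E_def Y_def weight_from_def)
  with max0 have max: "stop_gain M Y E' \<le> stop_gain M Y E" if "adapted_down M (F j) E'" for E'
    using that by simp
  have EF: "E s \<in> sets (F j s)" and EM: "E s \<in> sets M" for s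
    using E F_subD by (auto simp: adapted_down_def)
  define prev where "prev n = (if n = 0 then space M else E (n - 1))" for n
  have null: "AE z in M. z \<in> A \<inter> prev n \<longrightarrow> z \<in> E n" if n: "v \<le> n" for n
  proof -
    \<comment> \<open>The points of \<open>A\<close> at which the maximiser stops exactly at
      \<open>n\<close>; they are to be shown negligible.\<close>
    define B where "B = A \<inter> prev n - E n"
    have "prev n \<in> sets (F j n)"
      using EF[of "n - 1"] F_mono[of "n - 1" n] by (auto simp: prev_def)
    then have B: "B \<in> sets (F j n)"
      using A F_mono[OF n] EF by (auto simp: B_def)
    define l where "l z = charge n z - e" for z
    have lm: "l \<in> borel_measurable (F j n)"
      unfolding l_def[abs_def] using charge_meas[of n] by measurable
    have li: "integrable M (\<lambda>z. l z * beta n z)"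
      unfolding l_def left_diff_distrib using integrable_charge_n integral_beta by auto
    have "AE z in M. z \<in> B \<longrightarrow> \<Gamma> n z \<le> ereal (l z)"
    proof (rule index_le_of_excess_nonpos[OF lm li B])
      fix E1 B' assume E1: "stops_after n E1" and B': "B' \<in> sets (F j n)" "B' \<subseteq> B"
      \<comment> \<open>The maximiser is prolonged by following \<open>E1\<close> on
        \<open>B'\<close> instead of stopping there. The added sets are disjoint from the old ones,
        so modularity gives the added gain exactly, and maximality makes it nonpositive.\<close>
      define K where "K s = (if s < n then {} else E1 s \<inter> B')" for s
      have KM: "K s \<in> sets M" for s
        using stops_afterD(2)[OF E1] F_subD[OF B'(1)] by (auto simp: K_def)
      have disj: "K s \<inter> E s = {}" for s
        using adapted_downD[OF E, of n s] B' by (auto simp: K_def B_def; blast)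
      have "adapted_down M (F j) (\<lambda>s. E s \<union> K s)"
        unfolding adapted_down_def
      proof (intro allI conjI)
        fix s
        show "E s \<union> K s \<in> sets (F j s)"
        proof (cases "s < n")
          case False
          then have "B' \<in> sets (F j s)" using B' F_mono[of n s] by auto
          then show ?thesis using EF stops_afterD(1)[OF E1] by (auto simp: K_def)
        qed (use EF in \<open>auto simp: K_def\<close>)
        have "K (Suc s) \<subseteq> E s \<union> K s"
        proof (cases "Suc s = n")
          case True
          then have "B' \<subseteq> E s" using B'(2) by (auto simp: B_def prev_def)
          then show ?thesis by (auto simp: K_def)
        next
          case False
          then show ?thesis using stops_afterD(3)[OF E1, of s "Suc s"] by (auto simp: K_def)
        qed
        then show "E (Suc s) \<union> K (Suc s) \<subseteq> E s \<union> K s"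
          using adapted_downD[OF E, of s "Suc s"] by auto
      qed
      then have "stop_gain M Y (\<lambda>s. E s \<union> K s) \<le> stop_gain M Y E" by (rule max)
      moreover have "stop_gain M Y (\<lambda>s. E s \<union> K s) + stop_gain M Y (\<lambda>s. E s \<inter> K s) = stop_gain M Y E + stop_gain M Y K"
        by (rule p.stop_gain_modular[OF EM KM])
      moreover have "stop_gain M Y (\<lambda>s. E s \<inter> K s) = 0"
        using disj by (simp add: stop_gain_def Int_commute)
      ultimately have "stop_gain M Y K \<le> 0" by simp
      moreover have "stop_gain M (excess n l) (\<lambda>s. E1 s \<inter> B') \<le> stop_gain M Y K"
      proof -
        interpret x: stop_problem M "F j" "excess n l" by (rule stop_problem_excess[OF lm li])
        have E1B: "E1 s \<inter> B' \<in> sets M" for s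
          using stops_afterD(2)[OF E1] F_subD[OF B'(1)] by auto
        show ?thesis
          unfolding stop_gain_def
        proof (intro suminf_le x.summable_gain p.summable_gain KM E1B)
          fix s
          show "(\<integral>z. indicator (E1 s \<inter> B') z * excess n l s z \<partial>M) \<le> (\<integral>z. indicator (K s) z * Y s z \<partial>M)"
          proof (intro integral_mono x.int_indicator p.int_indicator KM E1B)
            fix z
            show "indicator (E1 s \<inter> B') z * excess n l s z \<le> indicator (K s) z * Y s z"
            proof (cases "n \<le> s \<and> z \<in> E1 s \<inter> B'")
              case True
              then have "z \<in> A" using B' by (auto simp: B_def)
              \<comment> \<open>The charge at \<open>s\<close> is at most that at \<open>n\<close>,
                so the constant rental \<open>l\<close> only understates the continuation
                gain.\<close>
              have "beta s z * (X j s z - l z) \<le> beta s z * (X j s z - charge s z + e)"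
                using charge_antimono[of n s z] True beta_pos[of s z]
                by (intro mult_left_mono) (auto simp: l_def)
              then show ?thesis
                using True \<open>z \<in> A\<close> n by (simp add: K_def Y_def excess_def weight_from_def)
            qed (auto simp: K_def excess_def weight_from_def indicator_def)
          qed
        qed
      qed
      ultimately show "stop_gain M (excess n l) (\<lambda>s. E1 s \<inter> B') \<le> 0" by linarith
    qed
    \<comment> \<open>An index at most \<open>charge n - e\<close> contradicts
      \<open>charge_le_idx\<close>; this is where \<open>e > 0\<close> enters.\<close>
    then show ?thesis
      using AE_index_eq
    proof eventually_elim
      case (elim z)
      then show ?case
        using charge_le_idx[of n z] e by (auto simp: B_def l_def)
    qed
  qed
  have "AE z in M. z \<in> A \<longrightarrow> (\<forall>n\<ge>v. z \<in> E n)"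
  proof -
    have "AE z in M. \<forall>n. v \<le> n \<longrightarrow> z \<in> A \<inter> prev n \<longrightarrow> z \<in> E n"
      using null by (simp add: AE_all_countable)
    then show ?thesis
      using AE_space
    proof eventually_elim
      case (elim z)
      have "z \<in> E n" if "z \<in> A" "v \<le> n" for n
        using that(2)
      proof (induction n rule: dec_induct)
        case base
        have "z \<in> prev v" using elim(2) by (auto simp: prev_def E_def)
        then show ?case using elim(1) that by auto
      next
        case (step n)
        then have "z \<in> prev (Suc n)" by (simp add: prev_def)
        then show ?case using elim(1) that step by auto
      qed
      then show ?case by blast
    qed
  qed
  \<comment> \<open>On \<open>A\<close> the maximiser almost surely never stops, so never stopping
    has the maximal gain, which is at least the gain 0 of the empty rule.\<close>
  then have "(\<Sum>s. \<integral>z. Y s z \<partial>M) = stop_gain M Y E"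
    unfolding stop_gain_def
  proof (intro suminf_cong integral_cong_AE)
    fix s
    assume "AE z in M. z \<in> A \<longrightarrow> (\<forall>n\<ge>v. z \<in> E n)"
    then show "AE z in M. Y s z = indicator (E s) z * Y s z"
      by eventually_elim (auto simp: Y_def weight_from_def indicator_def)
  qed (use p.int_Y p.int_indicator EM in \<open>auto dest!: borel_measurable_integrable\<close>)
  also have "\<dots> \<ge> stop_gain M Y (\<lambda>_. {})"
    by (rule max) (simp add: adapted_down_def)
  finally show ?thesis by (simp add: stop_gain_def Y_def)
qed

text \<open>The lowered charge is raised back by letting the slack tend to 0, which is possible
  because the total expected discount is finite.\<close>

lemma charge_excess_nonneg:
  assumes A: "A \<in> sets (F j v)"
  shows "0 \<le> (\<Sum>s. \<integral>z. indicator A z * (weight_from v s z * (X j s z - charge s z)) \<partial>M)"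
proof (rule field_le_epsilon)
  fix e :: real assume e: "e > 0"
  define c where "c = (\<Sum>s. \<rho> ^ s)"
  have "c \<ge> 1"
    using sum_le_suminf[OF summable_rho, of "{0}"] \<rho>_nonneg by (simp add: c_def)
  \<comment> \<open>Lowering the charge by \<open>e'\<close> adds an expected discounted subsidy of
    at most \<open>e' * c\<close>, which is \<open>e\<close>.\<close>
  define e' where "e' = e / c"
  have e': "e' > 0" using e \<open>c \<ge> 1\<close> by (simp add: e'_def)
  interpret p: stop_problem M "F j" "\<lambda>s z. indicator A z * (weight_from v s z * (X j s z - charge s z + 0))"
    by (rule stop_problem_charge[OF F_subD[OF A(1)]])
  interpret p': stop_problem M "F j" "\<lambda>s z. indicator A z * (weight_from v s z * (X j s z - charge s z + e'))"
    by (rule stop_problem_charge[OF F_subD[OF A(1)]])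
  let ?a = "\<lambda>s. \<integral>z. indicator A z * (weight_from v s z * (X j s z - charge s z)) \<partial>M"
  have sa: "summable ?a"
    using p.summable_gain[of "\<lambda>_. A"] F_subD[OF A(1)] by (simp add: indicator_idem_mult)
  have "0 \<le> (\<Sum>s. \<integral>z. indicator A z * (weight_from v s z * (X j s z - charge s z + e')) \<partial>M)"
    by (rule discounted_charge_excess_nonneg[OF A e'])
  also have "\<dots> \<le> (\<Sum>s. ?a s + e' * \<rho> ^ s)"
  proof (rule suminf_le)
    show "summable (\<lambda>s. \<integral>z. indicator A z * (weight_from v s z * (X j s z - charge s z + e')) \<partial>M)"
      using p'.summable_gain[of "\<lambda>_. A"] F_subD[OF A(1)] by (simp add: indicator_idem_mult)
    show "summable (\<lambda>s. ?a s + e' * \<rho> ^ s)"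
      by (intro summable_add sa summable_mult summable_rho)
    fix s
    have "(\<integral>z. indicator A z * (weight_from v s z * (X j s z - charge s z + e')) \<partial>M)
      \<le> (\<integral>z. indicator A z * (weight_from v s z * (X j s z - charge s z)) + e' * beta s z \<partial>M)"
    proof (rule integral_mono)
      fix z
      have "indicator A z * (weight_from v s z * e') \<le> e' * beta s z"
        using beta_pos[of s z] e' by (auto simp: indicator_def weight_from_def)
      then show "indicator A z * (weight_from v s z * (X j s z - charge s z + e'))
        \<le> indicator A z * (weight_from v s z * (X j s z - charge s z)) + e' * beta s z"
        by (simp add: distrib_left)
    qed (use p.int_Y[of s] p'.int_Y[of s] integral_beta in auto)
    also have "\<dots> = ?a s + e' * \<rho> ^ s"
      using p.int_Y[of s] integral_beta[of s] by simp
    finally show "(\<integral>z. indicator A z * (weight_from v s z * (X j s z - charge s z + e')) \<partial>M) \<le> ?a s + e' * \<rho> ^ s" .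
  qed
  also have "\<dots> = suminf ?a + e"
  proof -
    have "(\<Sum>s. e' * \<rho> ^ s) = e' * c" unfolding c_def by (rule suminf_mult[OF summable_rho])
    also have "\<dots> = e" using \<open>c \<ge> 1\<close> by (simp add: e'_def)
    finally show ?thesis
      using suminf_add[OF sa summable_mult[OF summable_rho, of e']] by simp
  qed
  finally show "0 \<le> suminf ?a + e" .
qed

end

section \<open>Profits weighted by durations and their conditional tails\<close>

context arm
begin

text \<open>The discount integral over operation \<open>s\<close> on the arm's own clock, by
  \<open>disc_int_arm\<close>.\<close>

definition dur :: "nat \<Rightarrow> 'a \<Rightarrow> real" where
  "dur s z = (beta s z - beta (Suc s) z) / q"

lemma dur_eq: "dur s z = (beta s z - beta s z * exp (- q * W j s z)) / q"
  by (simp add: dur_def beta_Suc)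

lemma dur_nonneg: "z \<in> space M \<Longrightarrow> 0 \<le> dur s z"
  using beta_antimono[of z s "Suc s"] q by (simp add: dur_def)

lemma dur_meas: "dur s \<in> borel_measurable (F j (Suc s))"
  unfolding dur_def[abs_def] using meas_mono[OF beta_meas, of s "Suc s"] beta_meas[of "Suc s"] by measurable

text \<open>Given the past, the discount integral of an operation has mean
  \<open>(1 - \<rho>) / q\<close> times \<open>beta s\<close>. This is the bridge between the
  weights of the index and those of the value.\<close>

lemma
  assumes Y: "Y \<in> borel_measurable (F j s)" and int: "integrable M (\<lambda>z. beta s z * Y z)"
  shows integrable_dur: "integrable M (\<lambda>z. Y z * dur s z)"
    and integral_dur: "(\<integral>z. Y z * dur s z \<partial>M) = (1 - \<rho>) / q * (\<integral>z. beta s z * Y z \<partial>M)"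
proof -
  have m: "(\<lambda>z. beta s z * Y z) \<in> borel_measurable (F j s)"
    using Y beta_meas by measurable
  have eq: "Y z * dur s z = (beta s z * Y z - beta s z * Y z * exp (- q * W j s z)) / q" for z
    by (simp add: dur_eq algebra_simps)
  note i = integrable_exp_W[OF m int]
  show "integrable M (\<lambda>z. Y z * dur s z)"
    unfolding eq by (intro integrable_divide Bochner_Integration.integrable_diff int i)
  have "(\<integral>z. Y z * dur s z \<partial>M)
    = ((\<integral>z. beta s z * Y z \<partial>M) - (\<integral>z. beta s z * Y z * exp (- q * W j s z) \<partial>M)) / q"
    unfolding eq by (simp only: integral_divide_zero Bochner_Integration.integral_diff[OF int i])
  then show "(\<integral>z. Y z * dur s z \<partial>M) = (1 - \<rho>) / q * (\<integral>z. beta s z * Y z \<partial>M)"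
    unfolding integral_exp_W[OF m int] by (simp add: algebra_simps diff_divide_distrib)
qed

lemma integral_abs_dur:
  assumes Y: "Y \<in> borel_measurable (F j s)" and int: "integrable M (\<lambda>z. beta s z * Y z)"
  shows "(\<integral>z. \<bar>Y z * dur s z\<bar> \<partial>M) = (1 - \<rho>) / q * (\<integral>z. \<bar>beta s z * Y z\<bar> \<partial>M)"
proof -
  have b: "beta s z * \<bar>Y z\<bar> = \<bar>beta s z * Y z\<bar>" for z
    using beta_pos[of s z] by (simp add: abs_mult)
  have "(\<integral>z. \<bar>Y z * dur s z\<bar> \<partial>M) = (\<integral>z. \<bar>Y z\<bar> * dur s z \<partial>M)"
    by (intro Bochner_Integration.integral_cong) (auto simp: abs_mult dur_nonneg)
  also have "\<dots> = (1 - \<rho>) / q * (\<integral>z. beta s z * \<bar>Y z\<bar> \<partial>M)"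
    using Y int by (intro integral_dur) (auto simp: b)
  finally show ?thesis by (simp add: b)
qed

lemma integrable_reward: "integrable M (\<lambda>z. X j s z * dur s z)"
  and summable_reward: "summable (\<lambda>s. \<integral>z. \<bar>X j s z * dur s z\<bar> \<partial>M)"
  using integrable_dur[OF X_meas integrable_beta_X] summable_mult[OF summable_beta_X]
  by (simp_all only: integral_abs_dur[OF X_meas integrable_beta_X])

lemma integrable_charge: "integrable M (\<lambda>z. charge s z * dur s z)"
  and summable_charge: "summable (\<lambda>s. \<integral>z. \<bar>charge s z * dur s z\<bar> \<partial>M)"
  using integrable_dur[OF charge_meas integrable_beta_charge] summable_mult[OF summable_beta_charge]
  by (simp_all only: integral_abs_dur[OF charge_meas integrable_beta_charge])

definition profit :: "nat \<Rightarrow> 'a \<Rightarrow> real" where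
  "profit s z = (X j s z - charge s z) * dur s z"

lemma integrable_profit: "integrable M (profit s)"
  unfolding profit_def left_diff_distrib
  by (intro Bochner_Integration.integrable_diff integrable_reward integrable_charge)

lemma summable_profit: "summable (\<lambda>s. \<integral>z. \<bar>profit s z\<bar> \<partial>M)"
proof (rule summable_comparison_test'[OF summable_add[OF summable_reward summable_charge], of 0])
  fix s
  have "(\<integral>z. \<bar>profit s z\<bar> \<partial>M) \<le> (\<integral>z. \<bar>X j s z * dur s z\<bar> + \<bar>charge s z * dur s z\<bar> \<partial>M)"
    using integrable_profit integrable_reward integrable_charge
    by (intro integral_mono) (auto simp: profit_def left_diff_distrib)
  then show "norm (\<integral>z. \<bar>profit s z\<bar> \<partial>M) \<le> (\<integral>z. \<bar>X j s z * dur s z\<bar> \<partial>M) + (\<integral>z. \<bar>charge s z * dur s z\<bar> \<partial>M)"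
    using integrable_reward integrable_charge by simp
qed

lemma AE_summable_profit: "AE z in M. summable (\<lambda>s. \<bar>profit s z\<bar>)"
  by (rule AE_summable_norm[OF integrable_profit summable_profit])

lemma profit_meas: "profit s \<in> borel_measurable (F j (Suc s))"
  unfolding profit_def[abs_def]
  using dur_meas meas_mono[OF X_meas, of s "Suc s"] meas_mono[OF charge_meas, of s "Suc s"] by measurable

definition rest :: "nat \<Rightarrow> nat \<Rightarrow> 'a \<Rightarrow> real" where
  "rest v s z = (if v \<le> s then profit s z else 0)"

text \<open>Written as a stopped sum under the rule that never stops, so that
  \<open>int_total\<close> and \<open>integral_total\<close> apply.\<close>

definition tail :: "nat \<Rightarrow> 'a \<Rightarrow> real" where
  "tail v = stopped (rest v) (\<lambda>_. space M)"

lemma stop_problem_rest: "stop_problem M (F j) (rest v)"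
proof
  show "integrable M (rest v s)" for s
    using integrable_profit[of s] by (cases "v \<le> s") (auto simp: rest_def[abs_def])
  show "summable (\<lambda>s. \<integral>z. \<bar>rest v s z\<bar> \<partial>M)"
  proof (rule summable_comparison_test'[OF summable_profit, of 0])
    show "norm (\<integral>z. \<bar>rest v s z\<bar> \<partial>M) \<le> (\<integral>z. \<bar>profit s z\<bar> \<partial>M)" for s
      by (cases "v \<le> s") (simp_all add: rest_def)
  qed
qed (rule F_le_M)

lemma integrable_tail: "integrable M (tail v)"
  unfolding tail_def stopped_def by (rule stop_problem.int_total[OF stop_problem_rest]) simp

lemma integral_tail:
  assumes A: "A \<in> sets (F j v)"
  shows "(\<integral>z. indicator A z * tail v z \<partial>M)
    = (1 - \<rho>) / q * (\<Sum>s. \<integral>z. indicator A z * (weight_from v s z * (X j s z - charge s z)) \<partial>M)"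
proof -
  interpret p: stop_problem M "F j" "\<lambda>s z. indicator A z * (weight_from v s z * (X j s z - charge s z + 0))"
    by (rule stop_problem_charge[OF F_subD[OF A]])
  have sa: "summable (\<lambda>s. \<integral>z. indicator A z * (weight_from v s z * (X j s z - charge s z)) \<partial>M)"
    using p.summable_gain[of "\<lambda>_. A"] F_subD[OF A] by (simp add: indicator_idem_mult)
  have step: "(\<integral>z. indicator A z * rest v s z \<partial>M)
      = (1 - \<rho>) / q * (\<integral>z. indicator A z * (weight_from v s z * (X j s z - charge s z)) \<partial>M)" for s
  proof (cases "v \<le> s")
    case True
    have As: "A \<in> sets (F j s)" using A F_mono[OF True] by auto
    have "(\<integral>z. indicator A z * rest v s z \<partial>M) = (\<integral>z. (indicator A z * (X j s z - charge s z)) * dur s z \<partial>M)"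
      using True by (intro Bochner_Integration.integral_cong) (auto simp: rest_def profit_def)
    also have "\<dots> = (1 - \<rho>) / q * (\<integral>z. beta s z * (indicator A z * (X j s z - charge s z)) \<partial>M)"
    proof (rule integral_dur)
      show "(\<lambda>z. indicator A z * (X j s z - charge s z)) \<in> borel_measurable (F j s)"
        using As X_meas[of s] charge_meas[of s] by measurable
      show "integrable M (\<lambda>z. beta s z * (indicator A z * (X j s z - charge s z)))"
        using integrable_indicator_mult[OF integrable_diff_charge F_subD[OF A]] by (simp add: mult_ac)
    qed
    finally show ?thesis using True by (simp add: weight_from_def mult_ac)
  qed (simp add: rest_def weight_from_def)
  have "(\<integral>z. indicator A z * tail v z \<partial>M) = stop_gain M (rest v) (\<lambda>s. space M \<inter> A)"
    unfolding tail_def stopped_def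
    using F_subD[OF A] by (intro stop_problem.integral_total[OF stop_problem_rest]) auto
  also have "space M \<inter> A = A" using sets.sets_into_space[OF F_subD[OF A]] by auto
  finally show ?thesis
    unfolding stop_gain_def step by (simp only: suminf_mult[OF sa])
qed

text \<open>Both signs are read off by testing on events of \<open>F j v\<close>: nonnegativity on
  all of them, the reverse inequality only on those contained in \<open>at_record v\<close>.\<close>

lemma cond_tail_nonneg: "AE z in M. 0 \<le> cexp v (tail v) z"
  and cond_tail_at_record: "AE z in M. z \<in> at_record v \<longrightarrow> cexp v (tail v) z = 0"
proof -
  interpret S: sigma_finite_subalgebra M "F j v" by (rule sfs)
  have c: "0 \<le> (1 - \<rho>) / q" using \<rho>_less_1 q by simp
  have "AE z in M. z \<in> space M \<longrightarrow> cexp v (\<lambda>z. (-1) * tail v z) z \<le> 0"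
  proof (rule S.real_cond_exp_nonpos_on)
    show "integrable M (\<lambda>z. (-1) * tail v z)" using integrable_tail by auto
    fix A assume A: "A \<in> sets (F j v)"
    have "0 \<le> (\<integral>z. indicator A z * tail v z \<partial>M)"
      unfolding integral_tail[OF A] using c charge_excess_nonneg[OF A] by (rule mult_nonneg_nonneg)
    then show "(\<integral>z. indicator A z * ((-1) * tail v z) \<partial>M) \<le> 0"
      by simp
  qed simp
  moreover have "AE z in M. cexp v (\<lambda>z. (-1) * tail v z) z = (-1) * cexp v (tail v) z"
    by (rule S.real_cond_exp_cmult[OF integrable_tail])
  ultimately show nonneg: "AE z in M. 0 \<le> cexp v (tail v) z"
    using AE_space by eventually_elim auto
  have "AE z in M. z \<in> at_record v \<longrightarrow> cexp v (tail v) z \<le> 0"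
  proof (rule S.real_cond_exp_nonpos_on[OF integrable_tail at_record_sets])
    fix A assume A: "A \<in> sets (F j v)" "A \<subseteq> at_record v"
    show "(\<integral>z. indicator A z * tail v z \<partial>M) \<le> 0"
      unfolding integral_tail[OF A(1)] using c charge_excess_nonpos[OF A] by (rule mult_nonneg_nonpos)
  qed
  with nonneg show "AE z in M. z \<in> at_record v \<longrightarrow> cexp v (tail v) z = 0"
    by eventually_elim auto
qed

lemma AE_tail_step: "AE z in M. \<forall>v. tail v z = profit v z + tail (Suc v) z"
  using AE_summable_profit AE_space
proof eventually_elim
  case (elim z)
  have s: "summable (\<lambda>s. rest v s z)" for v
    using elim(1) by (rule summable_comparison_test'[of _ 0]) (auto simp: rest_def)
  have t: "tail v z = (\<Sum>s. rest v s z)" for v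
    using elim(2) by (simp add: tail_def stopped_def)
  have "(\<Sum>s. rest v s z) = profit v z + (\<Sum>s. rest (Suc v) s z)" for v
  proof -
    have "rest v s z = (if s = v then profit v z else 0) + rest (Suc v) s z" for s
      by (cases s v rule: linorder_cases) (auto simp: rest_def)
    then have "(\<Sum>s. rest v s z) = (\<Sum>s. (if s = v then profit v z else 0) + rest (Suc v) s z)"
      by (rule suminf_cong)
    also have "\<dots> = (\<Sum>s. if s = v then profit v z else 0) + (\<Sum>s. rest (Suc v) s z)"
      by (rule suminf_add[symmetric]) (auto intro: sums_summable[OF sums_single] s)
    also have "(\<Sum>s. if s = v then profit v z else 0) = profit v z"
      by (rule sums_unique[OF sums_single, symmetric])
    finally show ?thesis .
  qed
  then show ?case unfolding t by blast
qed

lemma integral_abs_tail: "(\<integral>z. \<bar>tail v z\<bar> \<partial>M) \<le> (\<Sum>s. \<integral>z. \<bar>profit (s + v) z\<bar> \<partial>M)"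
proof -
  have sv: "summable (\<lambda>s. \<integral>z. \<bar>profit (s + v) z\<bar> \<partial>M)"
    using summable_profit by (rule summable_ignore_initial_segment)
  have ae: "AE z in M. summable (\<lambda>s. \<bar>profit (s + v) z\<bar>)"
    using AE_summable_profit by eventually_elim (rule summable_ignore_initial_segment)
  have "(\<integral>z. \<bar>tail v z\<bar> \<partial>M) \<le> (\<integral>z. (\<Sum>s. \<bar>profit (s + v) z\<bar>) \<partial>M)"
  proof (rule integral_mono_AE)
    show "integrable M (\<lambda>z. \<Sum>s. \<bar>profit (s + v) z\<bar>)"
      using ae sv by (intro integrable_suminf integrable_abs integrable_profit) auto
    show "AE z in M. \<bar>tail v z\<bar> \<le> (\<Sum>s. \<bar>profit (s + v) z\<bar>)"
      using AE_summable_profit ae AE_space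
    proof eventually_elim
      case (elim z)
      have "summable (\<lambda>s. rest v s z)"
        using elim(1) by (rule summable_comparison_test'[of _ 0]) (auto simp: rest_def)
      then have "tail v z = (\<Sum>s. rest v (s + v) z) + (\<Sum>s<v. rest v s z)"
        using elim(3) suminf_split_initial_segment[of "\<lambda>s. rest v s z" v] by (simp add: tail_def stopped_def)
      also have "(\<Sum>s<v. rest v s z) = 0" by (intro sum.neutral) (auto simp: rest_def)
      finally have "tail v z = (\<Sum>s. profit (s + v) z)" by (simp add: rest_def)
      then show ?case using summable_rabs[OF elim(2)] by simp
    qed
  qed (use integrable_tail in auto)
  also have "\<dots> = (\<Sum>s. \<integral>z. \<bar>profit (s + v) z\<bar> \<partial>M)"
    using ae sv by (intro integral_suminf integrable_abs integrable_profit) auto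
  finally show ?thesis .
qed

lemma integral_abs_tail_tendsto: "(\<lambda>v. \<integral>z. \<bar>tail v z\<bar> \<partial>M) \<longlonglongrightarrow> 0"
proof (rule tendsto_sandwich[OF _ _ tendsto_const])
  show "(\<lambda>v. \<Sum>s. \<integral>z. \<bar>profit (s + v) z\<bar> \<partial>M) \<longlonglongrightarrow> 0"
    using suminf_exist_split2[OF summable_profit] by simp
qed (auto simp: integral_abs_tail)

text \<open>The tail sees the whole future of its arm but nothing of the others, which is what
  independence between arms requires.\<close>

lemma tail_meas: "tail v \<in> borel_measurable (sigma (space M) (\<Union>s. sets (F j s)))"
proof -
  let ?S = "sigma (space M) (\<Union>s. sets (F j s))"
  have sub: "(\<Union>s. sets (F j s)) \<subseteq> Pow (space M)"
    using sets.space_closed[of "F j _"] by auto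
  have "subalgebra ?S (F j s)" for s
    using sub by (auto simp: subalgebra_def sets_measure_of space_measure_of)
  then have "profit s \<in> borel_measurable ?S" for s
    using profit_meas measurable_from_subalg by blast
  then have [measurable]: "rest v s \<in> borel_measurable ?S" for s
    unfolding rest_def[abs_def] by measurable
  have [measurable]: "space M \<in> sets ?S" using sets.top[of ?S] sub by (simp add: space_measure_of)
  show ?thesis unfolding tail_def stopped_def[abs_def] by measurable
qed

end

lemma (in prob_space) indep_set_integral_indicator:
  fixes Y :: "'a \<Rightarrow> real"
  assumes ind: "indep_set A C" and A: "sigma_algebra (space M) A" and C: "sigma_algebra (space M) C"
    and Y: "integrable M Y" "\<And>S. S \<in> sets borel \<Longrightarrow> Y -` S \<inter> space M \<in> A" and B: "B \<in> C" "C \<subseteq> sets M"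
  shows "(\<integral>z. indicator B z * Y z \<partial>M) = prob B * (\<integral>z. Y z \<partial>M)"
proof -
  interpret C: sigma_algebra "space M" C by (rule C)
  have BM: "B \<in> sets M" using B by blast
  have "indep_set A {indicator B -` S \<inter> space M |S. S \<in> sets (borel :: real measure)}"
    unfolding indep_set_def
  proof (rule indep_sets_mono_sets[OF ind[unfolded indep_set_def]])
    have "(indicator B :: 'a \<Rightarrow> real) -` S \<inter> space M \<in> C" for S
    proof -
      have "(indicator B :: 'a \<Rightarrow> real) -` S \<inter> space M
        = (if 1 \<in> S then B else {}) \<union> (if 0 \<in> S then space M - B else {})"
        using C.sets_into_space[OF B(1)] by (auto simp: indicator_def of_bool_def split: if_splits)
      then show ?thesis using B(1) by auto
    qed
    then have "{indicator B -` S \<inter> space M |S. S \<in> sets (borel :: real measure)} \<subseteq> C" by blast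
    then show "case_bool A {indicator B -` S \<inter> space M |S. S \<in> sets (borel :: real measure)} i \<subseteq> case_bool A C i" for i
      by (cases i) simp_all
  qed
  then have "indep_var borel Y borel (indicator B)"
    using Y A BM by (intro indep_var_of_indep_set) auto
  from indep_var_lebesgue_integral[OF this Y(1)] BM show ?thesis
    by (simp add: mult.commute emeasure_eq_measure)
qed

section \<open>Several independent arms\<close>

locale bandit = prob_space M for M :: "'a measure" +
  fixes q :: real and J :: nat and F :: "nat \<Rightarrow> nat \<Rightarrow> 'a measure" and X W :: "nat \<Rightarrow> nat \<Rightarrow> 'a \<Rightarrow> real"
    and \<Gamma> :: "nat \<Rightarrow> nat \<Rightarrow> 'a \<Rightarrow> ereal" and G :: "nat \<Rightarrow> real measure"
  assumes J: "J \<ge> 1"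
    and arm: "\<And>j. j < J \<Longrightarrow> arm M q F X W j (\<Gamma> j) (G j)"
    and F_indep: "indep_sets (\<lambda>j. sigma_sets (space M) (\<Union>s. sets (F j s))) {..<J}"
begin

text \<open>All that can be known when arm \<open>j\<close> is in state \<open>v\<close>, no matter
  how often the other arms have been operated: their entire evolution is included. This avoids
  tracking the random states of the others.\<close>

definition hist :: "nat \<Rightarrow> nat \<Rightarrow> 'a measure" where
  "hist j v = sigma (space M) (sets (F j v) \<union> (\<Union>i\<in>{..<J} - {j}. \<Union>s. sets (F i s)))"

lemma F_sets: "j < J \<Longrightarrow> A \<in> sets (F j s) \<Longrightarrow> A \<in> sets M"
  using arm arm.F_subD by blast

lemma F_Pow: "j < J \<Longrightarrow> sets (F j s) \<subseteq> Pow (space M)"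
  using F_sets sets.sets_into_space by blast

lemma hist_gen: "j < J \<Longrightarrow> sets (F j v) \<union> (\<Union>i\<in>{..<J} - {j}. \<Union>s. sets (F i s)) \<subseteq> Pow (space M)"
  using F_Pow by blast

lemma space_hist [simp]: "space (hist j v) = space M"
  by (simp add: hist_def space_measure_of_conv)

lemma sets_hist: "j < J \<Longrightarrow> sets (hist j v) = sigma_sets (space M) (sets (F j v) \<union> (\<Union>i\<in>{..<J} - {j}. \<Union>s. sets (F i s)))"
  unfolding hist_def by (rule sets_measure_of[OF hist_gen])

lemma hist_subalgebra: "j < J \<Longrightarrow> subalgebra M (hist j v)"
  unfolding subalgebra_def space_hist sets_hist
  using F_sets by (auto intro!: sets.sigma_sets_subset)

lemma hist_sfs: "j < J \<Longrightarrow> sigma_finite_subalgebra M (hist j v)"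
  by (rule finite_measure_subalgebra_is_sigma_finite)
     (simp add: finite_measure_subalgebra_def finite_measure_subalgebra_axioms_def hist_subalgebra finite_measure_axioms)

lemma hist_own: "j < J \<Longrightarrow> s \<le> v \<Longrightarrow> A \<in> sets (F j s) \<Longrightarrow> A \<in> sets (hist j v)"
  using arm.F_mono[OF arm, of j s v] by (auto simp: sets_hist intro: sigma_sets.Basic)

lemma hist_other: "j < J \<Longrightarrow> i < J \<Longrightarrow> i \<noteq> j \<Longrightarrow> A \<in> sets (F i s) \<Longrightarrow> A \<in> sets (hist j v)"
  by (auto simp: sets_hist intro: sigma_sets.Basic)

text \<open>Information independent of the whole arm does not improve the prediction of its
  variables. The defining identity is checked on a generator and extended by a Dynkin
  argument.\<close>

lemma cond_exp_hist:
  assumes j: "j < J" and Z: "integrable M Z" and Zm: "Z \<in> borel_measurable (sigma (space M) (\<Union>s. sets (F j s)))"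
  shows "AE z in M. real_cond_exp M (hist j v) Z z = real_cond_exp M (F j v) Z z"
proof -
  interpret A: arm M q F X W j "\<Gamma> j" "G j" by (rule arm[OF j])
  interpret S: sigma_finite_subalgebra M "F j v" by (rule A.sfs)
  interpret H: sigma_finite_subalgebra M "hist j v" by (rule hist_sfs[OF j])
  let ?inf = "\<lambda>i. sigma_sets (space M) (\<Union>s. sets (F i s))"
  define K where "K = sigma_sets (space M) (\<Union>i\<in>{..<J} - {j}. ?inf i)"
  define U where "U = real_cond_exp M (F j v) Z"
  have U: "integrable M U" unfolding U_def by (rule S.real_cond_exp_int[OF Z])
  have inf_Pow: "i < J \<Longrightarrow> (\<Union>s. sets (F i s)) \<subseteq> Pow (space M)" for i using F_Pow by blast
  have inf_M: "i < J \<Longrightarrow> ?inf i \<subseteq> sets M" for i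
    using F_sets by (intro sets.sigma_sets_subset) auto
  have K_M: "K \<subseteq> sets M"
    unfolding K_def using inf_M by (intro sets.sigma_sets_subset) auto
  have K_alg: "sigma_algebra (space M) K"
    unfolding K_def using inf_M sets.space_closed by (intro sigma_algebra_sigma_sets) blast
  have inf_alg: "sigma_algebra (space M) (?inf j)"
    using inf_Pow[OF j] by (rule sigma_algebra_sigma_sets)
  have ind: "indep_set (?inf j) K"
  proof -
    have "indep_sets (\<lambda>b. sigma_sets (space M) (\<Union>i\<in>(if b then {j} else {..<J} - {j}). ?inf i)) (UNIV :: bool set)"
    proof (rule indep_sets_collect_sigma)
      have "(\<Union>b\<in>UNIV. if b then {j} else {..<J} - {j}) = {..<J}"
        using j by (auto split: if_splits)
      then show "indep_sets ?inf (\<Union>b\<in>UNIV. if b then {j} else {..<J} - {j})"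
        using F_indep by simp
      show "Int_stable (?inf i)" if "i \<in> (if b then {j} else {..<J} - {j})" for i b
      proof -
        have "i < J" using that j by (auto split: if_splits)
        then interpret I: sigma_algebra "space M" "?inf i"
          by (intro sigma_algebra_sigma_sets inf_Pow)
        show ?thesis by (auto simp: Int_stable_def)
      qed
      show "disjoint_family_on (\<lambda>b. if b then {j} else {..<J} - {j}) UNIV"
        by (auto simp: disjoint_family_on_def)
    qed
    then show ?thesis
      unfolding indep_set_def
    proof (rule indep_sets_mono_sets)
      show "case_bool (?inf j) K b \<subseteq> sigma_sets (space M) (\<Union>i\<in>(if b then {j} else {..<J} - {j}). ?inf i)" for b
        by (cases b) (auto simp: K_def)
    qed
  qed
  \<comment> \<open>An intersection-stable generator: an event of the arm up to \<open>v\<close> met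
    with an event of the others. Either factor may be the whole space, so both kinds of events are
    included.\<close>
  define Gen where "Gen = {B1 \<inter> B2 |B1 B2. B1 \<in> sets (F j v) \<and> B2 \<in> K}"
  have spK: "space M \<in> K" unfolding K_def by (rule sigma_sets_top)
  have Gen_Pow: "Gen \<subseteq> Pow (space M)"
    using F_Pow[OF j] by (auto simp: Gen_def)
  have Int_Gen: "Int_stable Gen"
  proof (rule Int_stableI)
    interpret K: sigma_algebra "space M" K by (rule K_alg)
    fix a b assume "a \<in> Gen" "b \<in> Gen"
    then obtain B1 B2 C1 C2 where "a = B1 \<inter> B2" "b = C1 \<inter> C2" "B1 \<in> sets (F j v)" "B2 \<in> K" "C1 \<in> sets (F j v)" "C2 \<in> K"
      by (auto simp: Gen_def)
    then have "a \<inter> b = (B1 \<inter> C1) \<inter> (B2 \<inter> C2)" "B1 \<inter> C1 \<in> sets (F j v)" "B2 \<inter> C2 \<in> K" by auto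
    then show "a \<inter> b \<in> Gen" unfolding Gen_def by blast
  qed
  have hist_Gen: "sets (hist j v) \<subseteq> sigma_sets (space M) Gen"
    unfolding sets_hist[OF j]
  proof (rule sigma_sets_mono, rule subsetI)
    fix a assume "a \<in> sets (F j v) \<union> (\<Union>i\<in>{..<J} - {j}. \<Union>s. sets (F i s))"
    then consider "a \<in> sets (F j v)" | i s where "i < J" "i \<noteq> j" "a \<in> sets (F i s)" by blast
    then have "a \<in> Gen"
    proof cases
      case 1
      then have "a = a \<inter> space M" using F_Pow[OF j] by blast
      with 1 spK show ?thesis unfolding Gen_def by blast
    next
      case 2
      then have "a \<in> ?inf i" by (intro sigma_sets.Basic UN_I[of s]) auto
      with 2 have "a \<in> (\<Union>i\<in>{..<J} - {j}. ?inf i)" by blast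
      then have "a \<in> K" unfolding K_def by (rule sigma_sets.Basic)
      moreover have "a = space M \<inter> a" using F_Pow[OF 2(1)] 2(3) by blast
      ultimately show ?thesis unfolding Gen_def using A.space_in_F by blast
    qed
    then show "a \<in> sigma_sets (space M) Gen" by (rule sigma_sets.Basic)
  qed
  have Gen_M: "sigma_sets (space M) Gen \<subseteq> sets M"
    using A.F_subD K_M by (intro sets.sigma_sets_subset) (auto simp: Gen_def)
  have basic: "(\<integral>z. indicator a z * Z z \<partial>M) = (\<integral>z. indicator a z * U z \<partial>M)" if aG: "a \<in> Gen" for a
  proof -
    obtain B1 B2 where a: "a = B1 \<inter> B2" and B: "B1 \<in> sets (F j v)" "B2 \<in> K"
      using aG unfolding Gen_def by blast
    have B1M: "B1 \<in> sets M" using B(1) by (rule A.F_subD)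
    let ?S = "sigma (space M) (\<Union>s. sets (F j s))"
    have sets_S: "sets ?S = ?inf j" by (rule sets_measure_of[OF inf_Pow[OF j]])
    have space_S: "space ?S = space M" by (simp add: space_measure_of_conv)
    have "subalgebra ?S (F j v)"
      unfolding subalgebra_def space_S sets_S by (auto intro: sigma_sets.Basic)
    then have Um: "U \<in> borel_measurable ?S" unfolding U_def
      by (rule measurable_from_subalg) measurable
    have B1S: "B1 \<in> sets ?S" unfolding sets_S using B(1) by (auto intro: sigma_sets.Basic)
    \<comment> \<open>The event of the other arms splits off as a probability, in the same way for
      \<open>Z\<close> and for \<open>U\<close>, as both depend on arm \<open>j\<close>
      only.\<close>
    have fac: "(\<integral>z. indicator a z * Y z \<partial>M) = prob B2 * (\<integral>z. indicator B1 z * Y z \<partial>M)"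
      if Y: "integrable M Y" "Y \<in> borel_measurable ?S" for Y
    proof -
      have Y1: "(\<lambda>z. indicator B1 z * Y z) \<in> borel_measurable ?S"
        using B1S Y(2) by measurable
      have "(\<integral>z. indicator a z * Y z \<partial>M) = (\<integral>z. indicator B2 z * (indicator B1 z * Y z) \<partial>M)"
        unfolding a by (intro Bochner_Integration.integral_cong) (auto simp: indicator_def)
      also have "\<dots> = prob B2 * (\<integral>z. indicator B1 z * Y z \<partial>M)"
        using measurable_sets[OF Y1] B(2) K_M
        by (intro indep_set_integral_indicator[OF ind inf_alg K_alg] integrable_indicator_mult Y(1) B1M)
           (auto simp: sets_S space_S)
      finally show ?thesis .
    qed
    have "(\<integral>z. indicator B1 z * Z z \<partial>M) = (\<integral>z. indicator B1 z * U z \<partial>M)"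
      unfolding U_def using B(1) Z
      by (intro S.real_cond_exp_intg(2)[symmetric] integrable_indicator_mult B1M) auto
    then show ?thesis using fac[OF Z Zm] fac[OF U Um] by simp
  qed
  have main: "(\<integral>z. indicator a z * Z z \<partial>M) = (\<integral>z. indicator a z * U z \<partial>M)"
    if "a \<in> sigma_sets (space M) Gen" for a
    using Int_Gen Gen_Pow that
  proof (induction a rule: sigma_sets_induct_disjoint)
    case (basic a)
    then show ?case by (rule \<open>\<And>a. a \<in> Gen \<Longrightarrow> _ a\<close>)
  next
    case empty
    then show ?case by simp
  next
    case (compl a)
    have aM: "a \<in> sets M" using compl(1) Gen_M by blast
    have "(\<integral>z. indicator (space M - a) z * Y z \<partial>M) = (\<integral>z. Y z \<partial>M) - (\<integral>z. indicator a z * Y z \<partial>M)"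
      if "integrable M Y" for Y :: "'a \<Rightarrow> real"
      unfolding Bochner_Integration.integral_diff[OF that integrable_indicator_mult[OF that aM], symmetric]
      by (intro Bochner_Integration.integral_cong) (auto simp: indicator_def)
    moreover have "(\<integral>z. Z z \<partial>M) = (\<integral>z. U z \<partial>M)"
      unfolding U_def by (rule S.real_cond_exp_int(2)[OF Z, symmetric])
    ultimately show ?case using Z U compl(2) by simp
  next
    case (union a)
    have aM: "a i \<in> sets M" for i using union(2) Gen_M by blast
    have "(\<integral>z. indicator (\<Union>i. a i) z * Y z \<partial>M) = (\<Sum>i. \<integral>z. indicator (a i) z * Y z \<partial>M)"
      if Y: "integrable M Y" for Y :: "'a \<Rightarrow> real"
    proof -
      have "(LINT z:(\<Union>i. a i)|M. Y z) = (\<Sum>i. (LINT z:(a i)|M. Y z))"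
        using union(1) aM integrable_mult_indicator[OF sets.countable_UN[of a UNIV] Y]
        by (intro lebesgue_integral_countable_add) (auto simp: disjoint_family_on_def set_integrable_def)
      then show ?thesis by (simp add: set_lebesgue_integral_def)
    qed
    then show ?case using Z U union(3) by simp
  qed
  have "AE z in M. real_cond_exp M (hist j v) Z z = U z"
  proof (rule H.real_cond_exp_charact)
    show "(LINT z:a|M. Z z) = (LINT z:a|M. U z)" if "a \<in> sets (hist j v)" for a
      using main[of a] hist_Gen that by (auto simp: set_lebesgue_integral_def)
    have "subalgebra (hist j v) (F j v)"
      unfolding subalgebra_def using hist_own[OF j order_refl] by auto
    then show "U \<in> borel_measurable (hist j v)"
      unfolding U_def by (rule measurable_from_subalg) measurable
  qed (use Z U in auto)
  then show ?thesis by (simp add: U_def)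
qed

lemma cond_exp_hist_mult:
  assumes j: "j < J" and Z: "integrable M Z" and Zm: "Z \<in> borel_measurable (sigma (space M) (\<Union>s. sets (F j s)))"
    and N: "N \<in> borel_measurable (hist j v)" "\<And>z. z \<in> space M \<Longrightarrow> \<bar>N z\<bar> \<le> 1"
  shows "integrable M (\<lambda>z. N z * Z z)" "integrable M (\<lambda>z. N z * real_cond_exp M (F j v) Z z)"
    "(\<integral>z. N z * Z z \<partial>M) = (\<integral>z. N z * real_cond_exp M (F j v) Z z \<partial>M)"
proof -
  interpret A: arm M q F X W j "\<Gamma> j" "G j" by (rule arm[OF j])
  interpret S: sigma_finite_subalgebra M "F j v" by (rule A.sfs)
  interpret H: sigma_finite_subalgebra M "hist j v" by (rule hist_sfs[OF j])
  have NM: "N \<in> borel_measurable M" by (rule measurable_from_subalg[OF hist_subalgebra[OF j] N(1)])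
  have i: "integrable M (\<lambda>z. N z * Y z)" if Y: "integrable M Y" for Y :: "'a \<Rightarrow> real"
  proof (rule Bochner_Integration.integrable_bound[OF Y])
    show "(\<lambda>z. N z * Y z) \<in> borel_measurable M" using NM Y by auto
    show "AE z in M. norm (N z * Y z) \<le> norm (Y z)"
      using N(2) by (auto simp: abs_mult intro!: AE_I2 mult_left_le_one_le)
  qed
  show NZ: "integrable M (\<lambda>z. N z * Z z)" by (rule i[OF Z])
  show "integrable M (\<lambda>z. N z * real_cond_exp M (F j v) Z z)" by (intro i S.real_cond_exp_int Z)
  have "(\<integral>z. N z * Z z \<partial>M) = (\<integral>z. N z * real_cond_exp M (hist j v) Z z \<partial>M)"
    using Z by (intro H.real_cond_exp_intg(2)[symmetric] NZ N(1)) auto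
  also have "\<dots> = (\<integral>z. N z * real_cond_exp M (F j v) Z z \<partial>M)"
    using cond_exp_hist[OF j Z Zm, of v] NM
    by (intro integral_cong_AE) (auto elim!: eventually_mono)
  finally show "(\<integral>z. N z * Z z \<partial>M) = (\<integral>z. N z * real_cond_exp M (F j v) Z z \<partial>M)" .
qed

text \<open>Summation by parts turns the discounted profits into the tails, weighted by the decrements of \<open>N\<close>.\<close>

lemma
  assumes j: "j < J" and N: "\<And>s. N s \<in> borel_measurable (hist j s)" "\<And>s z. z \<in> space M \<Longrightarrow> 0 \<le> N s z" "\<And>s z. z \<in> space M \<Longrightarrow> N s z \<le> 1"
    and dec: "\<And>s z. z \<in> space M \<Longrightarrow> N (Suc s) z \<le> N s z"
  shows weighted_profit_nonpos: "(\<Sum>s. \<integral>z. N s z * arm.profit q X W j (\<Gamma> j) s z \<partial>M) \<le> 0"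
    and weighted_profit_zero: "(\<And>s. AE z in M. N (Suc s) z < N s z \<longrightarrow> z \<in> arm.at_record M (\<Gamma> j) (Suc s))
      \<Longrightarrow> (\<Sum>s. \<integral>z. N s z * arm.profit q X W j (\<Gamma> j) s z \<partial>M) = 0"
proof -
  interpret A: arm M q F X W j "\<Gamma> j" "G j" by (rule arm[OF j])
  have NM: "N s \<in> borel_measurable M" for s by (rule measurable_from_subalg[OF hist_subalgebra[OF j] N(1)])
  have N_abs: "z \<in> space M \<Longrightarrow> \<bar>N s z\<bar> \<le> 1" for s z using N(2,3)[of z s] by simp
  have iN: "integrable M (\<lambda>z. N s z * Y z)" if Y: "integrable M Y" for s and Y :: "'a \<Rightarrow> real"
  proof (rule Bochner_Integration.integrable_bound[OF Y])
    show "(\<lambda>z. N s z * Y z) \<in> borel_measurable M" using NM Y by auto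
    show "AE z in M. norm (N s z * Y z) \<le> norm (Y z)"
      using N_abs by (auto simp: abs_mult intro!: AE_I2 mult_left_le_one_le)
  qed
  let ?p = "\<lambda>s. \<integral>z. N s z * A.profit s z \<partial>M"
  have abs_le: "\<bar>\<integral>z. N s z * Y z \<partial>M\<bar> \<le> (\<integral>z. \<bar>Y z\<bar> \<partial>M)" if Y: "integrable M Y" for s and Y :: "'a \<Rightarrow> real"
  proof -
    have "\<bar>\<integral>z. N s z * Y z \<partial>M\<bar> \<le> (\<integral>z. \<bar>N s z * Y z\<bar> \<partial>M)" by (rule integral_abs_bound)
    also have "\<dots> \<le> (\<integral>z. \<bar>Y z\<bar> \<partial>M)"
      using N_abs by (intro integral_mono integrable_abs iN Y) (auto simp: abs_mult intro!: mult_left_le_one_le)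
    finally show ?thesis .
  qed
  have sum: "summable ?p"
    using abs_le[OF A.integrable_profit] by (intro summable_comparison_test'[OF A.summable_profit, of 0]) auto
  define d where "d s = (\<integral>z. (N s z - N (Suc s) z) * A.tail (Suc s) z \<partial>M)" for s
  let ?U = "\<lambda>s. real_cond_exp M (F j s) (A.tail s)"
  have hist_mono: "N s \<in> borel_measurable (hist j (Suc s))" for s
  proof (rule measurable_from_subalg[OF _ N(1)])
    show "subalgebra (hist j (Suc s)) (hist j s)"
      unfolding subalgebra_def sets_hist[OF j] using A.F_Suc[of s]
      by (auto intro!: sigma_sets_mono' )
  qed
  \<comment> \<open>The decrement of \<open>N\<close> is already known at
    \<open>hist j (Suc s)\<close>, so the tail from \<open>Suc s\<close> on may be replaced by its
    conditional expectation.\<close>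
  have d_eq: "d s = (\<integral>z. (N s z - N (Suc s) z) * ?U (Suc s) z \<partial>M)" for s
    unfolding d_def
  proof (rule cond_exp_hist_mult(3)[OF j A.integrable_tail A.tail_meas])
    show "(\<lambda>z. N s z - N (Suc s) z) \<in> borel_measurable (hist j (Suc s))"
      using hist_mono[of s] N(1)[of "Suc s"] by measurable
    show "z \<in> space M \<Longrightarrow> \<bar>N s z - N (Suc s) z\<bar> \<le> 1" for z
      using N(2,3)[of z s] N(2,3)[of z "Suc s"] by linarith
  qed
  have d_nonneg: "0 \<le> d s" for s
    unfolding d_eq
  proof (rule integral_nonneg_AE)
    show "AE z in M. 0 \<le> (N s z - N (Suc s) z) * ?U (Suc s) z"
      using A.cond_tail_nonneg[of "Suc s"] AE_space by eventually_elim (auto simp: dec)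
  qed
  have parts: "(\<Sum>s<n. ?p s) = - (\<Sum>s<n. d s) - (\<integral>z. N n z * A.tail n z \<partial>M)" for n
  proof (induction n)
    case 0
    \<comment> \<open>Operation 0 is always a record, so the boundary term at 0 vanishes.\<close>
    have "(\<integral>z. N 0 z * A.tail 0 z \<partial>M) = (\<integral>z. N 0 z * ?U 0 z \<partial>M)"
      by (rule cond_exp_hist_mult(3)[OF j A.integrable_tail A.tail_meas N(1) N_abs])
    also have "\<dots> = (\<integral>z. 0 \<partial>M)"
    proof (rule integral_cong_AE)
      show "AE z in M. N 0 z * ?U 0 z = 0"
        using A.cond_tail_at_record[of 0] AE_space by eventually_elim (auto simp: A.at_record_def)
    qed (use NM in auto)
    finally show ?case by simp
  next
    case (Suc n)
    have "?p n = (\<integral>z. N n z * A.tail n z - N n z * A.tail (Suc n) z \<partial>M)"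
    proof (rule integral_cong_AE)
      show "AE z in M. N n z * A.profit n z = N n z * A.tail n z - N n z * A.tail (Suc n) z"
        using A.AE_tail_step
      proof eventually_elim
        case (elim z)
        then have "A.tail n z = A.profit n z + A.tail (Suc n) z" by blast
        then show ?case by (simp only:) (simp add: algebra_simps)
      qed
      show "(\<lambda>z. N n z * A.profit n z) \<in> borel_measurable M"
        by (rule borel_measurable_integrable[OF iN[OF A.integrable_profit]])
      show "(\<lambda>z. N n z * A.tail n z - N n z * A.tail (Suc n) z) \<in> borel_measurable M"
        by (intro borel_measurable_diff borel_measurable_integrable[OF iN[OF A.integrable_tail]])
    qed
    also have "\<dots> = (\<integral>z. N n z * A.tail n z \<partial>M) - (\<integral>z. N n z * A.tail (Suc n) z \<partial>M)"
      by (intro Bochner_Integration.integral_diff iN A.integrable_tail)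
    finally have 1: "?p n = (\<integral>z. N n z * A.tail n z \<partial>M) - (\<integral>z. N n z * A.tail (Suc n) z \<partial>M)" .
    have 2: "d n = (\<integral>z. N n z * A.tail (Suc n) z \<partial>M) - (\<integral>z. N (Suc n) z * A.tail (Suc n) z \<partial>M)"
      unfolding d_def left_diff_distrib by (intro Bochner_Integration.integral_diff iN A.integrable_tail)
    show ?case using Suc 1 2 by simp
  qed
  have lim: "(\<lambda>n. \<Sum>s<n. ?p s) \<longlonglongrightarrow> suminf ?p" using sum by (rule summable_LIMSEQ)
  have rem: "(\<lambda>n. \<integral>z. N n z * A.tail n z \<partial>M) \<longlonglongrightarrow> 0"
    by (rule Lim_null_comparison[OF _ A.integral_abs_tail_tendsto]) (use abs_le[OF A.integrable_tail] in auto)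
  have lim2: "(\<lambda>n. (\<Sum>s<n. ?p s) + (\<integral>z. N n z * A.tail n z \<partial>M)) \<longlonglongrightarrow> suminf ?p"
    using tendsto_add[OF lim rem] by simp
  show "suminf ?p \<le> 0"
    using lim2 by (rule LIMSEQ_le_const2) (auto simp: parts sum_nonneg d_nonneg)
  \<comment> \<open>Wherever \<open>N\<close> decreases, the conditional tail is zero; elsewhere the
    decrement is. So every \<open>d s\<close> vanishes.\<close>
  assume rec: "\<And>s. AE z in M. N (Suc s) z < N s z \<longrightarrow> z \<in> A.at_record (Suc s)"
  have "d s = 0" for s
  proof -
    have "d s = (\<integral>z. 0 \<partial>M)"
      unfolding d_eq
    proof (rule integral_cong_AE)
      show "AE z in M. (N s z - N (Suc s) z) * ?U (Suc s) z = 0"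
        using rec[of s] A.cond_tail_at_record[of "Suc s"] AE_space
      proof eventually_elim
        case (elim z)
        then show ?case using dec[of z s] by (cases "N (Suc s) z < N s z") auto
      qed
    qed (use NM in auto)
    then show ?thesis by simp
  qed
  with lim2 have "(\<lambda>n. 0) \<longlonglongrightarrow> suminf ?p" by (simp add: parts)
  then show "suminf ?p = 0" by (rule LIMSEQ_unique[OF _ tendsto_const, symmetric, THEN sym])
qed

end

section \<open>Strategies and the discount that other arms impose on an arm\<close>

lemma
  assumes "is_strategy M F J \<pi>" "z \<in> space M"
  shows sel_arm_less: "sel_arm \<pi> t z < J"
    and strategy_Suc: "\<pi> (Suc t) z = (\<pi> t z)(sel_arm \<pi> t z := Suc (\<pi> t z (sel_arm \<pi> t z)))"
proof -
  obtain j where j: "j < J" "\<pi> (Suc t) z = (\<pi> t z)(j := Suc (\<pi> t z j))"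
    using assms unfolding is_strategy_def by blast
  have "sel_arm \<pi> t z = j"
    unfolding sel_arm_def j(2) by (rule Least_equality) (auto split: if_splits)
  with j show "sel_arm \<pi> t z < J"
    "\<pi> (Suc t) z = (\<pi> t z)(sel_arm \<pi> t z := Suc (\<pi> t z (sel_arm \<pi> t z)))" by simp_all
qed

lemma sel_armI: "\<pi> (Suc t) z = (\<pi> t z)(j := Suc (\<pi> t z j)) \<Longrightarrow> sel_arm \<pi> t z = j"
  unfolding sel_arm_def by (rule Least_equality) (auto split: if_splits)

context bandit
begin

abbreviation "strategy \<equiv> is_strategy M F J"
abbreviation "joint \<equiv> joint_sigma M F J"

definition other_time :: "(nat \<Rightarrow> 'a \<Rightarrow> nat \<Rightarrow> nat) \<Rightarrow> nat \<Rightarrow> nat \<Rightarrow> 'a \<Rightarrow> real" where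
  "other_time \<pi> j t z = (\<Sum>i\<in>{..<J} - {j}. arm_time W i (\<pi> t z i) z)"

definition op :: "(nat \<Rightarrow> 'a \<Rightarrow> nat \<Rightarrow> nat) \<Rightarrow> nat \<Rightarrow> nat \<Rightarrow> nat \<Rightarrow> 'a \<Rightarrow> bool" where
  "op \<pi> j s t z \<longleftrightarrow> sel_arm \<pi> t z = j \<and> \<pi> t z j = s"

definition op_weight :: "(nat \<Rightarrow> 'a \<Rightarrow> nat \<Rightarrow> nat) \<Rightarrow> nat \<Rightarrow> nat \<Rightarrow> nat \<Rightarrow> 'a \<Rightarrow> real" where
  "op_weight \<pi> j s t z = (if op \<pi> j s t z then exp (- q * other_time \<pi> j t z) else 0)"

text \<open>At most one term is nonzero: the value is the discount due to the other arms when
  operation \<open>s\<close> of arm \<open>j\<close> takes place, and 0 if it never does.\<close>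

definition weight :: "(nat \<Rightarrow> 'a \<Rightarrow> nat \<Rightarrow> nat) \<Rightarrow> nat \<Rightarrow> nat \<Rightarrow> 'a \<Rightarrow> real" where
  "weight \<pi> j s z = (\<Sum>t. op_weight \<pi> j s t z)"

text \<open>In each period only one pair of arm and state contributes. The redundant inner sums
  allow passing from a sum over periods to a sum over operations; \<open>s \<le> t\<close> loses
  nothing, as no state exceeds the time.\<close>

definition total :: "(nat \<Rightarrow> 'a \<Rightarrow> nat \<Rightarrow> nat) \<Rightarrow> (nat \<Rightarrow> nat \<Rightarrow> 'a \<Rightarrow> real) \<Rightarrow> 'a \<Rightarrow> real" where
  "total \<pi> h z = (\<Sum>t. \<Sum>j<J. \<Sum>s\<le>t. op_weight \<pi> j s t z * h j s z)"

lemma q_pos: "q > 0"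
  using arm[of 0] J arm.q by fastforce

lemma W_pos: "j < J \<Longrightarrow> z \<in> space M \<Longrightarrow> W j s z > 0"
  using arm.W_pos[OF arm] by blast

lemma arm_time_mono: "j < J \<Longrightarrow> z \<in> space M \<Longrightarrow> s \<le> t \<Longrightarrow> arm_time W j s z \<le> arm_time W j t z"
  unfolding arm_time_def using W_pos by (intro sum_mono2) (auto intro: less_imp_le)

lemma arm_time_nonneg: "j < J \<Longrightarrow> z \<in> space M \<Longrightarrow> 0 \<le> arm_time W j s z"
  using arm_time_mono[of j z 0 s] by (simp add: arm_time_def)

context
  fixes \<pi> assumes strat: "strategy \<pi>"
begin

lemma strategy_mono: "z \<in> space M \<Longrightarrow> t \<le> t' \<Longrightarrow> \<pi> t z i \<le> \<pi> t' z i"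
  by (rule lift_Suc_mono_le[of "\<lambda>t. \<pi> t z i"]) (simp_all add: strategy_Suc[OF strat])

lemma strategy_le: "z \<in> space M \<Longrightarrow> \<pi> t z i \<le> t"
proof (induction t)
  case 0
  then show ?case using strat by (simp add: is_strategy_def)
next
  case (Suc t)
  then show ?case by (auto simp: strategy_Suc[OF strat] intro: le_SucI)
qed

lemma strategy_outside: "z \<in> space M \<Longrightarrow> J \<le> i \<Longrightarrow> \<pi> t z i = 0"
proof (induction t)
  case 0
  then show ?case using strat by (simp add: is_strategy_def)
next
  case (Suc t)
  then show ?case using sel_arm_less[OF strat, of z t] by (auto simp: strategy_Suc[OF strat])
qed

lemma op_before:
  assumes "z \<in> space M" "s < \<pi> t' z j"
  shows "\<exists>t<t'. op \<pi> j s t z"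
  using assms(2)
proof (induction t')
  case 0
  then show ?case using strat assms(1) by (simp add: is_strategy_def)
next
  case (Suc t')
  show ?case
  proof (cases "s < \<pi> t' z j")
    case True
    then show ?thesis using Suc.IH less_SucI by blast
  next
    case False
    with Suc.prems have "op \<pi> j s t' z"
      by (auto simp: strategy_Suc[OF strat assms(1)] op_def split: if_splits)
    then show ?thesis by blast
  qed
qed

lemma op_after: "z \<in> space M \<Longrightarrow> op \<pi> j s t z \<Longrightarrow> t < t' \<Longrightarrow> s < \<pi> t' z j"
  using strategy_mono[of z "Suc t" t' j] by (simp add: strategy_Suc[OF strat] op_def)

lemma op_unique: "z \<in> space M \<Longrightarrow> op \<pi> j s t z \<Longrightarrow> op \<pi> j s t' z \<Longrightarrow> t = t'"
  using op_after[of z j s t t'] op_after[of z j s t' t] unfolding op_def by (metis less_irrefl linorder_neqE_nat)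

lemma op_less: "z \<in> space M \<Longrightarrow> op \<pi> j s t z \<Longrightarrow> j < J \<and> s \<le> t"
  using sel_arm_less[OF strat] strategy_le by (auto simp: op_def)

lemma other_time_mono: "z \<in> space M \<Longrightarrow> t \<le> t' \<Longrightarrow> other_time \<pi> j t z \<le> other_time \<pi> j t' z"
  unfolding other_time_def by (intro sum_mono arm_time_mono strategy_mono) auto

lemma other_time_nonneg: "z \<in> space M \<Longrightarrow> 0 \<le> other_time \<pi> j t z"
  unfolding other_time_def by (intro sum_nonneg arm_time_nonneg) auto

lemma op_weight_sums:
  assumes z: "z \<in> space M"
  shows "op \<pi> j s t z \<Longrightarrow> (\<lambda>t. op_weight \<pi> j s t z) sums exp (- q * other_time \<pi> j t z)"
    and "(\<nexists>t. op \<pi> j s t z) \<Longrightarrow> (\<lambda>t. op_weight \<pi> j s t z) sums 0"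
proof -
  assume t: "op \<pi> j s t z"
  have "op_weight \<pi> j s t' z = (if t' = t then exp (- q * other_time \<pi> j t' z) else 0)" for t'
  proof (cases "t' = t")
    case False
    then have "\<not> op \<pi> j s t' z" using op_unique[OF z t, of t'] by blast
    with False show ?thesis by (simp add: op_weight_def)
  qed (simp add: op_weight_def t)
  then show "(\<lambda>t. op_weight \<pi> j s t z) sums exp (- q * other_time \<pi> j t z)"
    using sums_single[of t "\<lambda>t. exp (- q * other_time \<pi> j t z)"] by simp
qed (simp add: op_weight_def)

lemma weight_op: "z \<in> space M \<Longrightarrow> op \<pi> j s t z \<Longrightarrow> weight \<pi> j s z = exp (- q * other_time \<pi> j t z)"
  unfolding weight_def using op_weight_sums(1) by (rule sums_unique[symmetric])

lemma weight_no_op: "z \<in> space M \<Longrightarrow> (\<nexists>t. op \<pi> j s t z) \<Longrightarrow> weight \<pi> j s z = 0"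
  unfolding weight_def using op_weight_sums(2) by (rule sums_unique[symmetric])

lemma op_weight_summable: "z \<in> space M \<Longrightarrow> summable (\<lambda>t. op_weight \<pi> j s t z)"
  using op_weight_sums[of z j s] sums_summable by (cases "\<exists>t. op \<pi> j s t z") blast+

lemma op_weight_nonneg: "0 \<le> op_weight \<pi> j s t z"
  by (simp add: op_weight_def)

lemma weight_bounds:
  assumes z: "z \<in> space M"
  shows "0 \<le> weight \<pi> j s z" "weight \<pi> j s z \<le> 1"
  using weight_op[OF z, of j s] weight_no_op[OF z, of j s] other_time_nonneg[OF z] q_pos
  by (cases "\<exists>t. op \<pi> j s t z"; auto)+

text \<open>A later operation of the arm happens in a later period, when the other arms have used at
  least as much time; an operation that never happens has weight 0.\<close>

lemma weight_decreasing:
  assumes z: "z \<in> space M"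
  shows "weight \<pi> j (Suc s) z \<le> weight \<pi> j s z"
proof (cases "\<exists>t. op \<pi> j (Suc s) t z")
  case True
  then obtain t where t: "op \<pi> j (Suc s) t z" by blast
  then obtain t' where t': "t' < t" "op \<pi> j s t' z"
    using op_before[OF z, of s t j] by (auto simp: op_def)
  show ?thesis
    using other_time_mono[OF z, of t' t j] t' q_pos by (simp add: weight_op[OF z t] weight_op[OF z t'(2)])
qed (use weight_no_op[OF z] weight_bounds[OF z] in auto)

text \<open>If operation \<open>Suc s\<close> followed immediately, the other arms would not have
  moved and the weight would be unchanged. A drop thus means that the arm is passed over in state
  \<open>Suc s\<close>.\<close>

lemma weight_drop:
  assumes z: "z \<in> space M" and less: "weight \<pi> j (Suc s) z < weight \<pi> j s z"
  obtains t where "\<pi> t z j = Suc s" "sel_arm \<pi> t z \<noteq> j"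
proof -
  have "\<exists>t. op \<pi> j s t z" using less weight_no_op[OF z, of j s] weight_bounds[OF z, of j "Suc s"] by fastforce
  then obtain t where t: "op \<pi> j s t z" by blast
  have 1: "\<pi> (Suc t) z j = Suc s" using t by (simp add: strategy_Suc[OF strat z] op_def)
  have "other_time \<pi> j (Suc t) z = other_time \<pi> j t z"
    unfolding other_time_def using t by (intro sum.cong) (auto simp: strategy_Suc[OF strat z] op_def)
  then have "\<not> op \<pi> j (Suc s) (Suc t) z"
    using less weight_op[OF z, of j "Suc s" "Suc t"] weight_op[OF z t] by auto
  with 1 show ?thesis by (intro that[of "Suc t"]) (auto simp: op_def)
qed

text \<open>The partial sums over periods are reordered by operations. The partial weights lie
  between 0 and 1 and converge, so dominated convergence for series gives the limit.\<close>

lemma total_sums: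
  assumes z: "z \<in> space M" and h: "\<And>j. j < J \<Longrightarrow> summable (\<lambda>s. \<bar>h j s z\<bar>)"
  shows "(\<lambda>t. \<Sum>j<J. \<Sum>s\<le>t. op_weight \<pi> j s t z * h j s z) sums (\<Sum>j<J. \<Sum>s. weight \<pi> j s z * h j s z)"
proof -
  define N where "N n j s = (\<Sum>t<n. op_weight \<pi> j s t z)" for n j s
  have N_bounds: "0 \<le> N n j s" "N n j s \<le> 1" for n j s
  proof -
    have "N n j s \<le> weight \<pi> j s z"
      unfolding N_def weight_def by (intro sum_le_suminf op_weight_summable z) (auto simp: op_weight_nonneg)
    then show "N n j s \<le> 1" using weight_bounds[OF z, of j s] by linarith
  qed (simp add: N_def sum_nonneg op_weight_nonneg)
  have zero: "op_weight \<pi> j s t z = 0" if "t < s" for j s t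
    using op_less[OF z, of j s t] that by (auto simp: op_weight_def)
  have "(\<Sum>t<n. \<Sum>j<J. \<Sum>s\<le>t. op_weight \<pi> j s t z * h j s z) = (\<Sum>j<J. \<Sum>s. N n j s * h j s z)" for n
  proof -
    have "(\<Sum>t<n. \<Sum>j<J. \<Sum>s\<le>t. op_weight \<pi> j s t z * h j s z)
      = (\<Sum>t<n. \<Sum>j<J. \<Sum>s<n. op_weight \<pi> j s t z * h j s z)"
      by (intro sum.cong refl sum.mono_neutral_left) (auto simp: zero)
    also have "\<dots> = (\<Sum>j<J. \<Sum>t<n. \<Sum>s<n. op_weight \<pi> j s t z * h j s z)"
      by (rule sum.swap)
    also have "\<dots> = (\<Sum>j<J. \<Sum>s<n. \<Sum>t<n. op_weight \<pi> j s t z * h j s z)"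
      by (intro sum.cong refl sum.swap)
    also have "\<dots> = (\<Sum>j<J. \<Sum>s<n. N n j s * h j s z)"
      by (simp add: N_def sum_distrib_right)
    also have "\<dots> = (\<Sum>j<J. \<Sum>s. N n j s * h j s z)"
    proof (intro sum.cong refl suminf_finite[symmetric])
      show "N n j s * h j s z = 0" if "s \<notin> {..<n}" for j s
        using that by (auto simp: N_def zero intro!: sum.neutral)
    qed simp
    finally show ?thesis .
  qed
  moreover have "(\<lambda>n. \<Sum>j<J. \<Sum>s. N n j s * h j s z) \<longlonglongrightarrow> (\<Sum>j<J. \<Sum>s. weight \<pi> j s z * h j s z)"
  proof (intro tendsto_sum tendsto_suminf_dominated)
    fix j s n assume "j \<in> {..<J}"
    show "(\<lambda>n. N n j s * h j s z) \<longlonglongrightarrow> weight \<pi> j s z * h j s z"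
      unfolding N_def weight_def by (intro tendsto_mult tendsto_const summable_LIMSEQ op_weight_summable z)
    show "\<bar>N n j s * h j s z\<bar> \<le> \<bar>h j s z\<bar>"
      using N_bounds[of n j s] by (auto simp: abs_mult intro!: mult_left_le_one_le)
  qed (use h in auto)
  ultimately show ?thesis by (simp add: sums_def)
qed

lemma joint_sigma_hist:
  assumes j: "j < J" and A: "A \<in> sets (joint p)"
  shows "A \<in> sets (hist j (p j))"
proof -
  have "sets (joint p) = sigma_sets (space M) (\<Union>i<J. sets (F i (p i)))"
    unfolding joint_sigma_def using F_Pow by (intro sets_measure_of) blast
  also have "\<dots> \<subseteq> sets (hist j (p j))"
  proof -
    have "(\<Union>i<J. sets (F i (p i))) \<subseteq> sets (hist j (p j))"
      using hist_own[OF j order_refl] hist_other[OF j] by (auto, metis)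
    then show ?thesis using sets.sigma_sets_subset[of _ "hist j (p j)"] by simp
  qed
  finally show ?thesis using A by blast
qed

text \<open>The event that \<open>j\<close> is selected at state \<open>p\<close> is only assumed to be known once arm \<open>j\<close> has been operated.
  Its complement within \<open>\<pi> t = p\<close>, however, concerns the other arms only.\<close>

lemma op_weight_meas:
  assumes j: "j < J"
  shows "op_weight \<pi> j s t \<in> borel_measurable (hist j s)"
proof -
  \<comment> \<open>The states possible in period \<open>t\<close> with arm \<open>j\<close> in
    state \<open>s\<close>; there are only finitely many, since no entry exceeds
    \<open>t\<close>.\<close>
  define P where "P = {p. (\<forall>i. (i \<in> {..<J} \<longrightarrow> p i \<in> {..t}) \<and> (i \<notin> {..<J} \<longrightarrow> p i = 0)) \<and> p j = s}"
  have "finite {p. \<forall>i. (i \<in> {..<J} \<longrightarrow> p i \<in> {..t}) \<and> (i \<notin> {..<J} \<longrightarrow> p i = (0::nat))}"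
    by (rule finite_set_of_finite_funs) auto
  then have finP: "finite P" by (rule rev_finite_subset) (auto simp: P_def)
  define D where "D p = {z \<in> space M. \<pi> t z = p \<and> sel_arm \<pi> t z = j}" for p
  have D_sets: "D p \<in> sets (hist j s)" if p: "p \<in> P" for p
  proof -
    have ev: "{z \<in> space M. \<pi> t' z = p'} \<in> sets (hist j s)" if "\<forall>i\<ge>J. p' i = 0" "p' j = s" for p' t'
      using strat joint_sigma_hist[OF j, of _ p'] that unfolding is_strategy_def by blast
    have "D p = {z \<in> space M. \<pi> t z = p} - (\<Union>i\<in>{..<J} - {j}. {z \<in> space M. \<pi> (Suc t) z = p(i := Suc (p i))})"
    proof (intro set_eqI iffI)
      fix z assume "z \<in> D p"
      then have z: "z \<in> space M" "\<pi> t z = p" "sel_arm \<pi> t z = j" by (auto simp: D_def)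
      then have "\<pi> (Suc t) z = p(j := Suc (p j))" using strategy_Suc[OF strat z(1), of t] by simp
      then have "\<pi> (Suc t) z \<noteq> p(i := Suc (p i))" if "i \<noteq> j" for i
        using that by (auto simp: fun_eq_iff)
      with z show "z \<in> {z \<in> space M. \<pi> t z = p} - (\<Union>i\<in>{..<J} - {j}. {z \<in> space M. \<pi> (Suc t) z = p(i := Suc (p i))})"
        by auto
    next
      fix z assume "z \<in> {z \<in> space M. \<pi> t z = p} - (\<Union>i\<in>{..<J} - {j}. {z \<in> space M. \<pi> (Suc t) z = p(i := Suc (p i))})"
      then show "z \<in> D p"
        using strategy_Suc[OF strat, of z t] sel_arm_less[OF strat, of z t] by (auto simp: D_def)
    qed
    moreover have "\<dots> \<in> sets (hist j s)"
      using p by (intro sets.Diff sets.finite_UN ev) (auto simp: P_def)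
    ultimately show ?thesis by simp
  qed
  have W_hist: "W i u \<in> borel_measurable (hist j s)" if "i < J" "i \<noteq> j" for i u
  proof (rule measurable_from_subalg)
    show "subalgebra (hist j s) (F i (Suc u))"
      using hist_other[OF j that] arm.space_F[OF arm[OF that(1)]] by (auto simp: subalgebra_def)
    show "W i u \<in> borel_measurable (F i (Suc u))" by (rule arm.W_meas[OF arm[OF that(1)]])
  qed
  have "(\<lambda>z. \<Sum>p\<in>P. indicator (D p) z * exp (- q * (\<Sum>i\<in>{..<J} - {j}. arm_time W i (p i) z))) \<in> borel_measurable (hist j s)"
    unfolding arm_time_def using D_sets W_hist
    by (intro borel_measurable_sum borel_measurable_times borel_measurable_indicator
          measurable_compose[OF _ borel_measurable_exp] borel_measurable_const) auto
  moreover have "op_weight \<pi> j s t z = (\<Sum>p\<in>P. indicator (D p) z * exp (- q * (\<Sum>i\<in>{..<J} - {j}. arm_time W i (p i) z)))"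
    if z: "z \<in> space M" for z
  proof (cases "op \<pi> j s t z")
    case True
    have "\<pi> t z \<in> P"
      using True strategy_le[OF z] strategy_outside[OF z] by (auto simp: P_def op_def)
    then have "(\<Sum>p\<in>P. indicator (D p) z * exp (- q * (\<Sum>i\<in>{..<J} - {j}. arm_time W i (p i) z)))
      = (\<Sum>p\<in>{\<pi> t z}. indicator (D p) z * exp (- q * (\<Sum>i\<in>{..<J} - {j}. arm_time W i (p i) z)))"
    proof (intro sum.mono_neutral_right finP ballI)
      fix p assume "p \<in> P - {\<pi> t z}"
      then have "z \<notin> D p" by (auto simp: D_def)
      then show "indicator (D p) z * exp (- q * (\<Sum>i\<in>{..<J} - {j}. arm_time W i (p i) z)) = 0" by simp
    qed simp
    with True z show ?thesis by (simp add: op_weight_def D_def op_def other_time_def)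
  next
    case False
    then have "z \<notin> D p" if "p \<in> P" for p using that by (auto simp: D_def P_def op_def)
    then have "(\<Sum>p\<in>P. indicator (D p) z * exp (- q * (\<Sum>i\<in>{..<J} - {j}. arm_time W i (p i) z))) = 0"
      by (intro sum.neutral ballI) simp
    then show ?thesis using False by (simp add: op_weight_def)
  qed
  ultimately show ?thesis
    by (subst measurable_cong[of "hist j s"]) auto
qed

lemma weight_meas: "j < J \<Longrightarrow> weight \<pi> j s \<in> borel_measurable (hist j s)"
  unfolding weight_def[abs_def] by (intro borel_measurable_suminf op_weight_meas)

lemma op_weight_meas_M: "j < J \<Longrightarrow> op_weight \<pi> j s t \<in> borel_measurable M"
  by (rule measurable_from_subalg[OF hist_subalgebra op_weight_meas])

lemma weight_meas_M: "j < J \<Longrightarrow> weight \<pi> j s \<in> borel_measurable M"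
  by (rule measurable_from_subalg[OF hist_subalgebra weight_meas])

lemma
  assumes h: "\<And>j s. j < J \<Longrightarrow> integrable M (h j s)" "\<And>j. j < J \<Longrightarrow> summable (\<lambda>s. \<integral>z. \<bar>h j s z\<bar> \<partial>M)"
  shows integrable_total: "integrable M (total \<pi> h)"
    and integral_total: "(\<integral>z. total \<pi> h z \<partial>M) = (\<Sum>j<J. \<Sum>s. \<integral>z. weight \<pi> j s z * h j s z \<partial>M)"
    and AE_total: "AE z in M. (\<lambda>t. \<Sum>j<J. \<Sum>s\<le>t. op_weight \<pi> j s t z * h j s z) sums total \<pi> h z"
    and integrable_weight_mult: "\<And>j s. j < J \<Longrightarrow> integrable M (\<lambda>z. weight \<pi> j s z * h j s z)"
    and summable_weight_mult: "\<And>j. j < J \<Longrightarrow> summable (\<lambda>s. \<integral>z. weight \<pi> j s z * h j s z \<partial>M)"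
proof -
  have hm: "j < J \<Longrightarrow> h j s \<in> borel_measurable M" for j s using h(1) by auto
  have ae: "AE z in M. \<forall>j<J. summable (\<lambda>s. \<bar>h j s z\<bar>)"
    unfolding all_simps(6)[symmetric] AE_all_countable using AE_summable_norm[OF h] by auto
  have tot: "AE z in M. (\<lambda>t. \<Sum>j<J. \<Sum>s\<le>t. op_weight \<pi> j s t z * h j s z) sums (\<Sum>j<J. \<Sum>s. weight \<pi> j s z * h j s z)"
    using ae AE_space by eventually_elim (rule total_sums, auto)
  then show "AE z in M. (\<lambda>t. \<Sum>j<J. \<Sum>s\<le>t. op_weight \<pi> j s t z * h j s z) sums total \<pi> h z"
    by eventually_elim (unfold total_def, rule summable_sums, rule sums_summable)
  have eq: "AE z in M. total \<pi> h z = (\<Sum>j<J. \<Sum>s. weight \<pi> j s z * h j s z)"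
    using tot by eventually_elim (simp add: total_def sums_unique[symmetric])
  have w_le: "\<bar>weight \<pi> j s z * y\<bar> \<le> \<bar>y\<bar>" if "z \<in> space M" for j s z y
    using weight_bounds[OF that, of j s] by (auto simp: abs_mult intro!: mult_left_le_one_le)
  show wi: "integrable M (\<lambda>z. weight \<pi> j s z * h j s z)" if j: "j < J" for j s
  proof (rule Bochner_Integration.integrable_bound[OF h(1)[OF j]])
    show "(\<lambda>z. weight \<pi> j s z * h j s z) \<in> borel_measurable M"
      using weight_meas_M[OF j] hm[OF j] by measurable
    show "AE z in M. norm (weight \<pi> j s z * h j s z) \<le> norm (h j s z)"
      using w_le by (auto intro!: AE_I2)
  qed
  have wabs: "(\<integral>z. \<bar>weight \<pi> j s z * h j s z\<bar> \<partial>M) \<le> (\<integral>z. \<bar>h j s z\<bar> \<partial>M)" if j: "j < J" for j s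
    by (intro integral_mono integrable_abs wi j h w_le)
  have ws: "summable (\<lambda>s. \<integral>z. \<bar>weight \<pi> j s z * h j s z\<bar> \<partial>M)" if j: "j < J" for j
    by (rule summable_comparison_test'[OF h(2)[OF j], of 0]) (simp add: wabs[OF j])
  show "summable (\<lambda>s. \<integral>z. weight \<pi> j s z * h j s z \<partial>M)" if j: "j < J" for j
    by (rule summable_comparison_test'[OF ws[OF j], of 0]) (simp only: real_norm_def integral_abs_bound)
  have wae: "AE z in M. summable (\<lambda>s. norm (weight \<pi> j s z * h j s z))" if j: "j < J" for j
    using AE_summable_norm[OF wi[OF j] ws[OF j]] by simp
  have si: "integrable M (\<lambda>z. \<Sum>s. weight \<pi> j s z * h j s z)" if j: "j < J" for j
    using ws[OF j] by (intro integrable_suminf wi wae j) auto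
  have tm: "total \<pi> h \<in> borel_measurable M"
    unfolding total_def[abs_def] using op_weight_meas_M hm
    by (intro borel_measurable_suminf borel_measurable_sum borel_measurable_times) auto
  have Si: "integrable M (\<lambda>z. \<Sum>j<J. \<Sum>s. weight \<pi> j s z * h j s z)"
    using si by (intro Bochner_Integration.integrable_sum) auto
  show "integrable M (total \<pi> h)"
    using Si eq tm by (subst integrable_cong_AE[of _ _ "\<lambda>z. \<Sum>j<J. \<Sum>s. weight \<pi> j s z * h j s z"]) auto
  have "(\<integral>z. total \<pi> h z \<partial>M) = (\<integral>z. (\<Sum>j<J. \<Sum>s. weight \<pi> j s z * h j s z) \<partial>M)"
    using eq tm Si by (intro integral_cong_AE) auto
  also have "\<dots> = (\<Sum>j<J. \<integral>z. (\<Sum>s. weight \<pi> j s z * h j s z) \<partial>M)"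
    using si by (intro Bochner_Integration.integral_sum) auto
  also have "\<dots> = (\<Sum>j<J. \<Sum>s. \<integral>z. weight \<pi> j s z * h j s z \<partial>M)"
    using ws by (intro sum.cong refl integral_suminf wi wae) auto
  finally show "(\<integral>z. total \<pi> h z \<partial>M) = (\<Sum>j<J. \<Sum>s. \<integral>z. weight \<pi> j s z * h j s z \<partial>M)" .
qed

lemma cT_eq: "z \<in> space M \<Longrightarrow> cT W \<pi> t z = (\<Sum>i<J. arm_time W i (\<pi> t z i) z)"
proof (induction t)
  case 0
  then show ?case using strat by (simp add: cT_def arm_time_def is_strategy_def)
next
  case (Suc t)
  let ?a = "sel_arm \<pi> t z"
  have a: "?a \<in> {..<J}" using sel_arm_less[OF strat Suc.prems] by simp
  have "(\<Sum>i<J. arm_time W i (\<pi> (Suc t) z i) z)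
    = arm_time W ?a (Suc (\<pi> t z ?a)) z + (\<Sum>i\<in>{..<J} - {?a}. arm_time W i (\<pi> t z i) z)"
    using a by (subst sum.remove[of _ ?a]) (auto simp: strategy_Suc[OF strat Suc.prems] intro!: sum.cong)
  also have "\<dots> = cW W \<pi> t z + (\<Sum>i<J. arm_time W i (\<pi> t z i) z)"
    using a by (subst sum.remove[of "{..<J}" ?a]) (auto simp: cW_def arm_time_def)
  finally show ?case using Suc by (simp add: cT_def)
qed

text \<open>Elapsed time is the arm's own clock plus the clocks of the others, and only the own
  clock moves during the period, so the discount integral factorises.\<close>

lemma discount_step:
  fixes t :: nat
  assumes z: "z \<in> space M"
  defines "a \<equiv> sel_arm \<pi> t z"
  shows "disc_int q (cT W \<pi> t z) (cT W \<pi> (Suc t) z) = exp (- q * other_time \<pi> a t z) * arm.dur q W a (\<pi> t z a) z"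
proof -
  have a: "a < J" unfolding a_def by (rule sel_arm_less[OF strat z])
  interpret A: arm M q F X W a "\<Gamma> a" "G a" by (rule arm[OF a])
  have 1: "cT W \<pi> t z = arm_time W a (\<pi> t z a) z + other_time \<pi> a t z"
    using a by (simp add: cT_eq[OF z] other_time_def sum.remove[of "{..<J}" a])
  have 2: "cT W \<pi> (Suc t) z = arm_time W a (Suc (\<pi> t z a)) z + other_time \<pi> a t z"
  proof -
    have "cT W \<pi> (Suc t) z = cT W \<pi> t z + W a (\<pi> t z a) z"
      by (simp add: cT_def cW_def a_def)
    then show ?thesis by (simp add: 1 arm_time_def)
  qed
  have "cT W \<pi> t z \<le> cT W \<pi> (Suc t) z" using W_pos[OF a z] by (simp add: 1 2 arm_time_def less_imp_le)
  then have "disc_int q (cT W \<pi> t z) (cT W \<pi> (Suc t) z) = (exp (- q * cT W \<pi> t z) - exp (- q * cT W \<pi> (Suc t) z)) / q"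
    using q_pos by (rule disc_int_eq)
  also have "\<dots> = exp (- q * other_time \<pi> a t z) * A.dur (\<pi> t z a) z"
  proof -
    have "exp (- q * (x + y)) = exp (- q * y) * exp (- q * x)" for x y
      by (simp add: algebra_simps flip: exp_add)
    then show ?thesis unfolding 1 2 A.dur_def A.beta_def by (simp only: right_diff_distrib times_divide_eq_right)
  qed
  finally show ?thesis .
qed

lemma total_term:
  fixes t :: nat
  assumes z: "z \<in> space M"
  defines "a \<equiv> sel_arm \<pi> t z"
  shows "(\<Sum>j<J. \<Sum>s\<le>t. op_weight \<pi> j s t z * (h j s z * arm.dur q W j s z))
    = h a (\<pi> t z a) z * disc_int q (cT W \<pi> t z) (cT W \<pi> (Suc t) z)"
proof -
  have a: "a < J" unfolding a_def by (rule sel_arm_less[OF strat z])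
  let ?f = "\<lambda>j s. op_weight \<pi> j s t z * (h j s z * arm.dur q W j s z)"
  have "(\<Sum>j<J. \<Sum>s\<le>t. ?f j s) = (\<Sum>j\<in>{a}. \<Sum>s\<le>t. ?f j s)"
    using a by (intro sum.mono_neutral_right) (auto simp: op_weight_def op_def a_def intro!: sum.neutral)
  also have "\<dots> = (\<Sum>s\<in>{\<pi> t z a}. ?f a s)"
  proof -
    have "(\<Sum>s\<le>t. ?f a s) = (\<Sum>s\<in>{\<pi> t z a}. ?f a s)"
      using strategy_le[OF z, of t a] by (intro sum.mono_neutral_right) (auto simp: op_weight_def op_def)
    then show ?thesis by simp
  qed
  finally show ?thesis
    unfolding discount_step[OF z] by (simp add: op_weight_def op_def a_def)
qed

end

end

section \<open>Greedy schedules\<close>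

text \<open>A single sample path of a strategy, with all randomness frozen.\<close>

locale schedule =
  fixes J :: nat and w :: "nat \<Rightarrow> nat \<Rightarrow> real" and q :: real and a :: "nat \<Rightarrow> nat" and p :: "nat \<Rightarrow> nat \<Rightarrow> nat"
  assumes w_pos: "\<And>j s. j < J \<Longrightarrow> w j s > 0" and q: "q > 0"
    and start: "p 0 = (\<lambda>_. 0)" and sel: "\<And>t. a t < J"
    and step: "\<And>t. p (Suc t) = (p t)(a t := Suc (p t (a t)))"
begin

text \<open>The integral of e^(-q r) for \<open>r\<close> from 0 to \<open>x\<close>;
  \<open>slice\<close> below is its increment over a period.\<close>

definition disc :: "real \<Rightarrow> real" where "disc x = (1 - exp (- q * x)) / q"

definition clock :: "nat \<Rightarrow> real" where "clock t = (\<Sum>i<J. \<Sum>u<p t i. w i u)"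

definition slice :: "nat \<Rightarrow> real" where "slice t = disc (clock (Suc t)) - disc (clock t)"

lemma p_mono: "s \<le> t \<Longrightarrow> p s i \<le> p t i"
  by (rule lift_Suc_mono_le[of "\<lambda>t. p t i"]) (simp_all add: step)

lemma p_sum: "(\<Sum>i<J. p t i) = t"
proof (induction t)
  case (Suc t)
  have "(\<Sum>i<J. p (Suc t) i) = Suc (\<Sum>i<J. p t i)"
    using sel[of t] by (simp add: step sum.remove[of "{..<J}" "a t"])
  with Suc show ?case by simp
qed (simp add: start)

text \<open>The thresholds \<open>P\<close> mark the first \<open>P i\<close> operations of each arm
  \<open>i\<close>; both sides measure the marked work done before period \<open>m\<close>.\<close>

lemma clock_restricted:
  "(\<Sum>t<m. if p t (a t) < P (a t) then w (a t) (p t (a t)) else 0) = (\<Sum>i<J. \<Sum>u<min (p m i) (P i). w i u)"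
proof (induction m)
  case (Suc m)
  have a: "a m \<in> {..<J}" using sel by simp
  have "(\<Sum>i<J. \<Sum>u<min (p (Suc m) i) (P i). w i u)
    = (\<Sum>u<min (Suc (p m (a m))) (P (a m)). w (a m) u) + (\<Sum>i\<in>{..<J} - {a m}. \<Sum>u<min (p m i) (P i). w i u)"
    using a by (subst sum.remove[of _ "a m"]) (auto simp: step intro!: sum.cong)
  also have "(\<Sum>u<min (Suc (p m (a m))) (P (a m)). w (a m) u)
    = (\<Sum>u<min (p m (a m)) (P (a m)). w (a m) u) + (if p m (a m) < P (a m) then w (a m) (p m (a m)) else 0)"
    by (auto simp: min_def not_less_eq_eq dest: le_antisym)
  finally show ?case
    using a by (simp add: Suc sum.remove[of "{..<J}" "a m"])
qed (simp add: start)

lemma clock_eq: "clock m = (\<Sum>t<m. w (a t) (p t (a t)))"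
proof -
  have "p t i < Suc (p m i)" if "t < m" for t i
    using p_mono[of t m i] that by simp
  \<comment> \<open>With the thresholds \<open>Suc (p m i)\<close> every operation before
    \<open>m\<close> is marked.\<close>
  then show ?thesis
    using clock_restricted[of "\<lambda>i. Suc (p m i)" m] by (simp add: clock_def)
qed

lemma clock_Suc: "clock (Suc t) = clock t + w (a t) (p t (a t))"
  by (simp add: clock_eq)

lemma disc_diff: "disc (x + y) - disc x = exp (- q * x) * disc y"
proof -
  have e: "exp (- q * (x + y)) = exp (- q * x) * exp (- q * y)"
    by (simp add: algebra_simps flip: exp_add)
  have "(1 - A * B) / q - (1 - A) / q = A * ((1 - B) / q)" for A B
    using q by (simp add: field_simps)
  then show ?thesis unfolding disc_def e by blast
qed

lemma slice_eq: "slice t = exp (- q * clock t) * disc (w (a t) (p t (a t)))"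
  by (simp only: slice_def clock_Suc disc_diff)

lemma disc_nonneg: "0 \<le> x \<Longrightarrow> 0 \<le> disc x"
  using q by (simp add: disc_def)

lemma disc_mono: "x \<le> y \<Longrightarrow> disc x \<le> disc y"
  using q by (simp add: disc_def divide_right_mono)

lemma slice_nonneg: "0 \<le> slice t"
  using w_pos[OF sel[of t], of "p t (a t)"] by (simp add: slice_eq disc_nonneg less_imp_le)

lemma sum_slice: "(\<Sum>t<m. slice t) = disc (clock m)"
  by (induction m) (simp_all add: slice_def clock_eq disc_def)

text \<open>Leaving out the unmarked operations moves the marked ones to earlier times, where the
  discount is larger. Packed without gaps from time 0 on, their slices telescope to
  \<open>disc\<close> of their total length.\<close>

lemma packing: "(\<Sum>t<m. if p t (a t) < P (a t) then slice t else 0) \<le> disc (\<Sum>i<J. \<Sum>u<P i. w i u)"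
proof -
  define L where "L m = (\<Sum>t<m. if p t (a t) < P (a t) then w (a t) (p t (a t)) else 0)" for m
  have L_le: "L m \<le> clock m" for m
    unfolding L_def clock_eq using w_pos[OF sel] by (intro sum_mono) (auto intro: less_imp_le)
  have "(\<Sum>t<m. if p t (a t) < P (a t) then slice t else 0) \<le> disc (L m)"
  proof (induction m)
    case (Suc m)
    let ?w = "w (a m) (p m (a m))"
    show ?case
    proof (cases "p m (a m) < P (a m)")
      case True
      have "slice m \<le> exp (- q * L m) * disc ?w"
        unfolding slice_eq using L_le[of m] q w_pos[OF sel[of m], of "p m (a m)"]
        by (intro mult_right_mono disc_nonneg) auto
      also have "\<dots> = disc (L m + ?w) - disc (L m)"
        by (rule disc_diff[symmetric])
      finally show ?thesis using Suc True by (simp add: L_def)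
    qed (use Suc in \<open>simp add: L_def\<close>)
  qed (simp add: L_def disc_def)
  also have "\<dots> \<le> disc (\<Sum>i<J. \<Sum>u<P i. w i u)"
    unfolding L_def clock_restricted
    by (intro disc_mono sum_mono sum_mono2) (auto intro: less_imp_le w_pos)
  finally show ?thesis .
qed

lemma clock_ge: "j < J \<Longrightarrow> (\<Sum>u<p t j. w j u) \<le> clock t"
  unfolding clock_def by (rule member_le_sum) (auto intro!: sum_nonneg intro: less_imp_le w_pos)

text \<open>A particular arm may be operated only finitely often, but the states sum to
  \<open>t\<close>, so by pigeonhole some arm has passed its own threshold once \<open>t\<close>
  reaches the sum of the thresholds.\<close>

lemma clock_at_top:
  assumes inf: "\<And>j. j < J \<Longrightarrow> filterlim (\<lambda>s. \<Sum>u<s. w j u) at_top sequentially"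
  shows "filterlim clock at_top sequentially"
  unfolding filterlim_at_top
proof
  fix K
  have "\<exists>S. \<forall>s\<ge>S. K \<le> (\<Sum>u<s. w j u)" if "j < J" for j
    using inf[OF that] by (auto simp: filterlim_at_top eventually_sequentially)
  then obtain S where S: "\<And>j s. j < J \<Longrightarrow> S j \<le> s \<Longrightarrow> K \<le> (\<Sum>u<s. w j u)" by metis
  have "K \<le> clock t" if t: "(\<Sum>j<J. S j) \<le> t" for t
  proof -
    have "\<exists>j<J. S j \<le> p t j"
    proof (rule ccontr)
      assume "\<not> (\<exists>j<J. S j \<le> p t j)"
      then have "(\<Sum>j<J. p t j) < (\<Sum>j<J. S j)"
        using sel[of 0] by (intro sum_strict_mono) (auto simp: not_le)
      with t show False by (simp add: p_sum)
    qed
    then obtain j where "j < J" "S j \<le> p t j" by blast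
    then show ?thesis using S[of j "p t j"] clock_ge[of j t] by linarith
  qed
  then show "eventually (\<lambda>t. K \<le> clock t) sequentially"
    by (auto simp: eventually_sequentially)
qed

end

text \<open>Bathtub principle: the greedy schedule collects the largest rates first, and the discount factor decreases.
  The rates are compared layer by layer: the items processed greedily up to time \<open>k\<close> have total
  length \<open>clock k\<close>, so no schedule can give them more than \<open>disc (clock k)\<close>.\<close>

lemma greedy_schedule_optimal:
  assumes S: "schedule J w q a p" and S': "schedule J w q a' p'"
    and dec: "\<And>j s. j < J \<Longrightarrow> g j (Suc s) \<le> g j s"
    and greedy: "\<And>t j. j < J \<Longrightarrow> g j (p t j) \<le> g (a t) (p t (a t))"
    and inf: "\<And>j. j < J \<Longrightarrow> filterlim (\<lambda>s. \<Sum>u<s. w j u) at_top sequentially"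
    and sums: "(\<lambda>t. g (a t) (p t (a t)) * schedule.slice J w q p t) sums V"
    and sums': "(\<lambda>t. g (a' t) (p' t (a' t)) * schedule.slice J w q p' t) sums V'"
  shows "V' \<le> V"
proof -
  interpret S: schedule J w q a p by fact
  interpret S': schedule J w q a' p' by fact
  define c where "c t = g (a t) (p t (a t))" for t
  have g_mono: "g j t \<le> g j s" if "j < J" "s \<le> t" for j s t
    by (rule lift_Suc_antimono_le[of "g j"]) (use dec that in auto)
  have c_Suc: "c (Suc t) \<le> c t" for t
  proof -
    let ?b = "a (Suc t)"
    have "c (Suc t) \<le> g ?b (p t ?b)"
      unfolding c_def by (intro g_mono S.sel S.p_mono) simp
    also have "\<dots> \<le> c t" unfolding c_def by (rule greedy[OF S.sel])
    finally show ?thesis .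
  qed
  have c_mono: "t \<le> t' \<Longrightarrow> c t' \<le> c t" for t t'
    by (rule lift_Suc_antimono_le[of c]) (use c_Suc in auto)
  \<comment> \<open>Layer \<open>k\<close> has height \<open>c k - c (Suc k)\<close> and carries the
    operations that the greedy schedule completes before period \<open>Suc k\<close>. An operation
    still pending at \<open>n\<close> has rate at most \<open>c n\<close> by greediness and lies in
    no earlier layer.\<close>
  have layer: "g i s \<le> c n + (\<Sum>k<n. if s < p (Suc k) i then c k - c (Suc k) else 0)" if i: "i < J" for i s n
  proof (induction n)
    case 0
    have "g i s \<le> g i (p 0 i)" using i by (intro g_mono) (simp_all add: S.start)
    also have "\<dots> \<le> c 0" unfolding c_def by (rule greedy[OF i])
    finally show ?case by simp
  next
    case (Suc n)
    show ?case
    proof (cases "s < p (Suc n) i")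
      case False
      have "\<not> s < p (Suc k) i" if "k < n" for k
        using S.p_mono[of "Suc k" "Suc n" i] that False by simp
      then have 0: "(\<Sum>k<Suc n. if s < p (Suc k) i then c k - c (Suc k) else 0) = 0"
        using False by (simp add: sum.neutral)
      have "g i s \<le> g i (p (Suc n) i)" using False i by (intro g_mono) auto
      also have "\<dots> \<le> c (Suc n)" unfolding c_def by (rule greedy[OF i])
      finally show ?thesis using 0 by simp
    qed (use Suc in simp)
  qed
  \<comment> \<open>Summation by parts: layer heights times the discounted layer lengths become
    rates times slices of the greedy schedule.\<close>
  have abel: "(\<Sum>k<n. (c k - c (Suc k)) * S.disc (S.clock (Suc k)))
    = (\<Sum>t<n. c t * S.slice t) - c n * S.disc (S.clock n)" for n
  proof (induction n)
    case 0
    then show ?case by (simp add: S.clock_eq S.disc_def)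
  next
    case (Suc n)
    then show ?case by (simp add: S.slice_def algebra_simps)
  qed
  have finite: "(\<Sum>t<m. g (a' t) (p' t (a' t)) * S'.slice t)
    \<le> c n * S.disc (S'.clock m) + (\<Sum>t<n. c t * S.slice t) - c n * S.disc (S.clock n)" for m n
  proof -
    have "(\<Sum>t<m. g (a' t) (p' t (a' t)) * S'.slice t)
      \<le> (\<Sum>t<m. (c n + (\<Sum>k<n. if p' t (a' t) < p (Suc k) (a' t) then c k - c (Suc k) else 0)) * S'.slice t)"
      by (intro sum_mono mult_right_mono layer S'.sel S'.slice_nonneg)
    also have "\<dots> = c n * (\<Sum>t<m. S'.slice t)
      + (\<Sum>t<m. \<Sum>k<n. (c k - c (Suc k)) * (if p' t (a' t) < p (Suc k) (a' t) then S'.slice t else 0))"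
      unfolding distrib_right sum.distrib sum_distrib_left sum_distrib_right
      by (intro arg_cong2[where f = "(+)"] sum.cong refl) auto
    also have "(\<Sum>t<m. \<Sum>k<n. (c k - c (Suc k)) * (if p' t (a' t) < p (Suc k) (a' t) then S'.slice t else 0))
      = (\<Sum>k<n. (c k - c (Suc k)) * (\<Sum>t<m. if p' t (a' t) < p (Suc k) (a' t) then S'.slice t else 0))"
      unfolding sum_distrib_left by (rule sum.swap)
    also have "\<dots> \<le> (\<Sum>k<n. (c k - c (Suc k)) * S.disc (S.clock (Suc k)))"
      unfolding S.clock_def using c_Suc
      by (intro sum_mono mult_left_mono S'.packing) simp
    finally show ?thesis by (simp add: abel S'.sum_slice)
  qed
  have disc_lim: "(\<lambda>m. exp (- q * T m)) \<longlonglongrightarrow> 0" if "filterlim T at_top sequentially" for T :: "nat \<Rightarrow> real"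
  proof -
    have "filterlim (\<lambda>m. - q * T m) at_bot sequentially"
      using filterlim_tendsto_neg_mult_at_bot[OF tendsto_const _ that, of "- q"] S.q by simp
    then show ?thesis by (rule filterlim_compose[OF exp_at_bot])
  qed
  \<comment> \<open>The competitor's horizon tends to infinity first, with \<open>n\<close> fixed,
    so its \<open>disc\<close> tends to \<open>1 / q\<close>. The rates may be unbounded below, but
    the remainder only needs the upper bound \<open>c n \<le> c 0\<close>.\<close>
  have fin2: "V' \<le> (\<Sum>t<n. c t * S.slice t) + \<bar>c 0\<bar> * exp (- q * S.clock n) / q" for n
  proof -
    have "(\<lambda>m. c n * S.disc (S'.clock m) + (\<Sum>t<n. c t * S.slice t) - c n * S.disc (S.clock n))
      \<longlonglongrightarrow> c n * ((1 - 0) / q) + (\<Sum>t<n. c t * S.slice t) - c n * S.disc (S.clock n)"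
      unfolding S.disc_def using S.q
      by (intro tendsto_intros disc_lim S'.clock_at_top[OF inf]) auto
    then have "V' \<le> c n * ((1 - 0) / q) + (\<Sum>t<n. c t * S.slice t) - c n * S.disc (S.clock n)"
      using sums' finite unfolding sums_def by (intro LIMSEQ_le) auto
    also have "\<dots> = (\<Sum>t<n. c t * S.slice t) + c n * (exp (- q * S.clock n) / q)"
      by (simp add: S.disc_def diff_divide_distrib algebra_simps)
    also have "c n * (exp (- q * S.clock n) / q) \<le> \<bar>c 0\<bar> * (exp (- q * S.clock n) / q)"
      using c_mono[of 0 n] S.q by (intro mult_right_mono) auto
    finally show ?thesis by simp
  qed
  have "(\<lambda>n. \<Sum>t<n. c t * S.slice t) \<longlonglongrightarrow> V"
    using sums unfolding sums_def c_def .
  then have "(\<lambda>n. (\<Sum>t<n. c t * S.slice t) + \<bar>c 0\<bar> * exp (- q * S.clock n) / q) \<longlonglongrightarrow> V + \<bar>c 0\<bar> * 0 / q"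
    using S.q by (intro tendsto_intros disc_lim S.clock_at_top[OF inf]) auto
  then show ?thesis using fin2 by (intro LIMSEQ_le_const) auto
qed

section \<open>A Gittins strategy against a competitor\<close>

context arm
begin

lemma charge_attained: "\<exists>u\<le>n. charge n z = idx u z"
proof (induction n)
  case (Suc n)
  then show ?case by (auto simp: min_def intro: le_SucI)
qed simp

lemma charge_eq_idx: "(\<And>u. u < n \<Longrightarrow> idx n z \<le> idx u z) \<Longrightarrow> charge n z = idx n z"
  using charge_attained[of n z] charge_le_idx[of n z] by (metis antisym le_neq_implies_less)

text \<open>Summable discount factors tend to 0, and the operation time is minus their logarithm
  divided by \<open>q\<close>.\<close>

lemma AE_arm_time_at_top: "AE z in M. filterlim (\<lambda>s. arm_time W j s z) at_top sequentially"
  using AE_summable_beta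
proof eventually_elim
  case (elim z)
  have "(\<lambda>s. beta s z) \<longlonglongrightarrow> 0" using elim by (rule summable_LIMSEQ_zero)
  then have "filterlim (\<lambda>s. beta s z) (at_right 0) sequentially"
    by (rule tendsto_imp_filterlim_at_right) (simp add: beta_pos)
  then have "filterlim (\<lambda>s. ln (beta s z)) at_bot sequentially"
    by (rule filterlim_compose[OF ln_at_0])
  then have "filterlim (\<lambda>s. - ln (beta s z)) at_top sequentially"
    by (simp add: filterlim_uminus_at_top)
  then have "filterlim (\<lambda>s. (1 / q) * - ln (beta s z)) at_top sequentially"
    using q by (intro filterlim_tendsto_pos_mult_at_top[OF tendsto_const]) auto
  then show ?case using q by (simp add: beta_def)
qed

end

context bandit
begin

abbreviation "reward_rate j s z \<equiv> X j s z * arm.dur q W j s z"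
abbreviation "charge_rate j s z \<equiv> arm.charge (\<Gamma> j) s z * arm.dur q W j s z"

lemma AE_index_real: "AE z in M. \<forall>j<J. \<forall>s. \<Gamma> j s z = ereal (arm.idx (\<Gamma> j) s z)"
proof -
  have "AE z in M. \<forall>s. \<Gamma> j s z = ereal (arm.idx (\<Gamma> j) s z)" if "j < J" for j
    by (rule arm.AE_index_eq[OF arm[OF that]])
  then have "AE z in M. \<forall>j\<in>{..<J}. \<forall>s. \<Gamma> j s z = ereal (arm.idx (\<Gamma> j) s z)"
    by (intro AE_finite_allI) auto
  then show ?thesis by eventually_elim auto
qed

lemma schedule_of_strategy:
  assumes \<pi>: "strategy \<pi>" and z: "z \<in> space M"
  shows "schedule J (\<lambda>j s. W j s z) q (\<lambda>t. sel_arm \<pi> t z) (\<lambda>t. \<pi> t z)"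
  using W_pos[OF _ z] q_pos \<pi> z sel_arm_less[OF \<pi> z] strategy_Suc[OF \<pi> z]
  unfolding schedule_def is_strategy_def by auto

lemma disc_int_slice:
  assumes \<pi>: "strategy \<pi>" and z: "z \<in> space M"
  shows "disc_int q (cT W \<pi> t z) (cT W \<pi> (Suc t) z) = schedule.slice J (\<lambda>j s. W j s z) q (\<lambda>t. \<pi> t z) t"
proof -
  interpret S: schedule J "\<lambda>j s. W j s z" q "\<lambda>t. sel_arm \<pi> t z" "\<lambda>t. \<pi> t z"
    by (rule schedule_of_strategy[OF \<pi> z])
  have c: "cT W \<pi> t z = S.clock t" for t
    by (simp add: cT_eq[OF \<pi> z] S.clock_def arm_time_def)
  have "S.clock t \<le> S.clock (Suc t)"
    using S.w_pos[OF S.sel] by (simp add: S.clock_Suc less_imp_le)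
  then show ?thesis
    unfolding c by (simp add: disc_int_eq[OF _ q_pos] S.slice_def S.disc_def diff_divide_distrib)
qed

context
  fixes \<pi>
  assumes strat: "strategy \<pi>"
    and gittins: "\<And>t z j. z \<in> space M \<Longrightarrow> j < J \<Longrightarrow> \<Gamma> j (\<pi> t z j) z \<le> \<Gamma> (sel_arm \<pi> t z) (\<pi> t z (sel_arm \<pi> t z)) z"
begin

context
  fixes z
  assumes z: "z \<in> space M" and fin: "\<And>j s. j < J \<Longrightarrow> \<Gamma> j s z = ereal (arm.idx (\<Gamma> j) s z)"
begin

lemma gittins_idx: "j < J \<Longrightarrow> op \<pi> i s t z \<Longrightarrow> arm.idx (\<Gamma> j) (\<pi> t z j) z \<le> arm.idx (\<Gamma> i) s z"
  using gittins[OF z, of j t] sel_arm_less[OF strat z, of t] fin by (auto simp: op_def)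

text \<open>Greediness for the indices must be transferred to the charges. The charge of the
  selected arm is its index at some state \<open>u\<close>; when it was operated there, arm
  \<open>j\<close> had no larger index, and the charge of \<open>j\<close> is by now no larger than
  that index.\<close>

lemma gittins_greedy_charge:
  assumes j: "j < J"
  shows "arm.charge (\<Gamma> j) (\<pi> t z j) z \<le> arm.charge (\<Gamma> (sel_arm \<pi> t z)) (\<pi> t z (sel_arm \<pi> t z)) z"
proof -
  define i where "i = sel_arm \<pi> t z"
  have i: "i < J" unfolding i_def by (rule sel_arm_less[OF strat z])
  interpret A: arm M q F X W j "\<Gamma> j" "G j" by (rule arm[OF j])
  interpret B: arm M q F X W i "\<Gamma> i" "G i" by (rule arm[OF i])
  obtain u where u: "u \<le> \<pi> t z i" "B.charge (\<pi> t z i) z = B.idx u z" using B.charge_attained by blast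
  \<comment> \<open>This is the present period if \<open>u\<close> is the present state, and an
    earlier one otherwise.\<close>
  obtain t' where t': "t' \<le> t" "op \<pi> i u t' z"
  proof (cases "u = \<pi> t z i")
    case True
    then show ?thesis by (intro that[of t]) (auto simp: op_def i_def)
  next
    case False
    then obtain t' where "t' < t" "op \<pi> i u t' z" using u op_before[OF strat z, of u t i] by auto
    then show ?thesis by (intro that[of t']) auto
  qed
  have "A.charge (\<pi> t z j) z \<le> A.charge (\<pi> t' z j) z"
    by (intro A.charge_antimono strategy_mono[OF strat z] t')
  also have "\<dots> \<le> A.idx (\<pi> t' z j) z" by (rule A.charge_le_idx)
  also have "\<dots> \<le> B.idx u z" by (rule gittins_idx[OF j t'(2)])
  finally show ?thesis unfolding i_def[symmetric] u(2) .
qed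

text \<open>If arm \<open>j\<close> had been operated at an index below its present one, then the arm \<open>i\<close> selected now would have
  been below that value at the time, and would never have been selected since.\<close>

lemma gittins_switch_at_record:
  assumes j: "j < J" and neq: "sel_arm \<pi> t z \<noteq> j"
  shows "z \<in> arm.at_record M (\<Gamma> j) (\<pi> t z j)"
proof -
  define i where "i = sel_arm \<pi> t z"
  have i: "i < J" unfolding i_def by (rule sel_arm_less[OF strat z])
  interpret A: arm M q F X W j "\<Gamma> j" "G j" by (rule arm[OF j])
  interpret B: arm M q F X W i "\<Gamma> i" "G i" by (rule arm[OF i])
  define v where "v = \<pi> t z j"
  have "A.idx v z \<le> A.idx u z" if u: "u < v" for u
  proof (rule ccontr)
    assume not_le: "\<not> A.idx v z \<le> A.idx u z"
    \<comment> \<open>Choosing the last operation with a lower index ensures that all later indices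
      of arm \<open>j\<close>, up to the present state, are at least the present one.\<close>
    define L where "L = {u. u < v \<and> A.idx u z < A.idx v z}"
    have "u \<in> L" using u not_le by (simp add: L_def)
    moreover have finL: "finite L" by (simp add: L_def)
    ultimately have "Max L \<in> L" by (intro Max_in) auto
    define u0 where "u0 = Max L"
    have u0: "u0 < v" "A.idx u0 z < A.idx v z" using \<open>Max L \<in> L\<close> by (auto simp: L_def u0_def)
    have later: "A.idx v z \<le> A.idx u z" if "u0 < u" "u \<le> v" for u
    proof (rule ccontr)
      assume "\<not> A.idx v z \<le> A.idx u z"
      with that have "u \<in> L" by (cases "u = v") (auto simp: L_def)
      then have "u \<le> u0" unfolding u0_def using finL by simp
      with that show False by simp
    qed
    obtain t2 where t2: "t2 < t" "op \<pi> j u0 t2 z"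
      using op_before[OF strat z, of u0 t j] u0 by (auto simp: v_def)
    \<comment> \<open>The first period after \<open>t2\<close> in which arm \<open>i\<close> is
      selected; the present period shows that there is one.\<close>
    define t3 where "t3 = (LEAST t'. t2 < t' \<and> sel_arm \<pi> t' z = i)"
    have ex: "t2 < t \<and> sel_arm \<pi> t z = i" using t2 by (simp add: i_def)
    have t3: "t2 < t3" "sel_arm \<pi> t3 z = i" "t3 \<le> t"
      unfolding t3_def using LeastI[where P = "\<lambda>t'. t2 < t' \<and> sel_arm \<pi> t' z = i", OF ex]
        Least_le[where P = "\<lambda>t'. t2 < t' \<and> sel_arm \<pi> t' z = i", OF ex] by auto
    \<comment> \<open>Arm \<open>j\<close> is selected at \<open>t2\<close> and arm \<open>i\<close>
      not again before \<open>t3\<close>, so \<open>i\<close> has at \<open>t3\<close> the index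
      that lost against \<open>idx u0\<close> at \<open>t2\<close>.\<close>
    have "\<pi> t3 z i = \<pi> t2 z i"
    proof (rule ccontr)
      assume "\<pi> t3 z i \<noteq> \<pi> t2 z i"
      then have "\<pi> t2 z i < \<pi> t3 z i" using strategy_mono[OF strat z, of t2 t3 i] t3 by simp
      then obtain t4 where t4: "t4 < t3" "op \<pi> i (\<pi> t2 z i) t4 z" using op_before[OF strat z] by blast
      have "t4 \<noteq> t2" using t4(2) t2(2) neq by (auto simp: op_def i_def)
      moreover have "\<not> t4 < t2" using op_after[OF strat z t4(2), of t2] by auto
      ultimately have "t2 < t4 \<and> sel_arm \<pi> t4 z = i" using t4(2) by (auto simp: op_def)
      then have "t3 \<le> t4" unfolding t3_def by (rule Least_le)
      with t4 show False by simp
    qed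
    then have "op \<pi> i (\<pi> t2 z i) t3 z" using t3 by (simp add: op_def)
    then have "A.idx (\<pi> t3 z j) z \<le> B.idx (\<pi> t2 z i) z" by (rule gittins_idx[OF j])
    also have "\<dots> \<le> A.idx u0 z" by (rule gittins_idx[OF i t2(2)])
    also have "\<dots> < A.idx v z" by (rule u0)
    also have "\<dots> \<le> A.idx (\<pi> t3 z j) z"
      using op_after[OF strat z t2(2) t3(1)] strategy_mono[OF strat z t3(3), of j] by (intro later) (auto simp: v_def)
    finally show False by simp
  qed
  then have "A.charge v z = A.idx v z" by (rule A.charge_eq_idx)
  then show ?thesis using z by (simp add: A.at_record_def v_def)
qed

end

lemma gittins_maximizes_charge:
  assumes \<pi>': "strategy \<pi>'"
  shows "(\<integral>z. total \<pi>' charge_rate z \<partial>M) \<le> (\<integral>z. total \<pi> charge_rate z \<partial>M)"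
proof (rule integral_mono_AE)
  have h: "\<And>j s. j < J \<Longrightarrow> integrable M (charge_rate j s)" "\<And>j. j < J \<Longrightarrow> summable (\<lambda>s. \<integral>z. \<bar>charge_rate j s z\<bar> \<partial>M)"
    using arm.integrable_charge[OF arm] arm.summable_charge[OF arm] by auto
  show "integrable M (total \<pi>' charge_rate)" "integrable M (total \<pi> charge_rate)"
    by (intro integrable_total \<pi>' strat h; assumption)+
  have "AE z in M. \<forall>j\<in>{..<J}. filterlim (\<lambda>s. arm_time W j s z) at_top sequentially"
    using arm.AE_arm_time_at_top[OF arm] by (intro AE_finite_allI) auto
  moreover have "AE z in M. (\<lambda>t. \<Sum>j<J. \<Sum>s\<le>t. op_weight \<pi>' j s t z * charge_rate j s z) sums total \<pi>' charge_rate z"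
    by (rule AE_total[OF \<pi>']) (fact h)+
  moreover have "AE z in M. (\<lambda>t. \<Sum>j<J. \<Sum>s\<le>t. op_weight \<pi> j s t z * charge_rate j s z) sums total \<pi> charge_rate z"
    by (rule AE_total[OF strat]) (fact h)+
  ultimately show "AE z in M. total \<pi>' charge_rate z \<le> total \<pi> charge_rate z"
    using AE_index_real AE_space
  proof eventually_elim
    case (elim z)
    note z = \<open>z \<in> space M\<close>
    have fin: "\<Gamma> j s z = ereal (arm.idx (\<Gamma> j) s z)" if "j < J" for j s using elim(4) that by blast
    show ?case
    proof (rule greedy_schedule_optimal[OF schedule_of_strategy[OF strat z] schedule_of_strategy[OF \<pi>' z],
          where g = "\<lambda>j s. arm.charge (\<Gamma> j) s z"])
      show "arm.charge (\<Gamma> j) (Suc s) z \<le> arm.charge (\<Gamma> j) s z" if "j < J" for j s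
        by (rule arm.charge_antimono[OF arm[OF that]]) simp
      show "arm.charge (\<Gamma> j) (\<pi> t z j) z \<le> arm.charge (\<Gamma> (sel_arm \<pi> t z)) (\<pi> t z (sel_arm \<pi> t z)) z" if "j < J" for t j
        using fin that by (rule gittins_greedy_charge[OF z])
      show "filterlim (\<lambda>s. \<Sum>u<s. W j u z) at_top sequentially" if "j < J" for j
        using elim(1) that by (auto simp: arm_time_def)
    qed (use elim(2,3) in \<open>simp_all add: total_term[OF strat z, of _ "\<lambda>j s. arm.charge (\<Gamma> j) s"]
        total_term[OF \<pi>' z, of _ "\<lambda>j s. arm.charge (\<Gamma> j) s"] disc_int_slice[OF strat z] disc_int_slice[OF \<pi>' z]\<close>)
  qed
qed

end

lemma integral_reward_split:
  assumes \<pi>: "strategy \<pi>"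
  shows "(\<integral>z. total \<pi> reward_rate z \<partial>M)
    = (\<integral>z. total \<pi> charge_rate z \<partial>M) + (\<Sum>j<J. \<Sum>s. \<integral>z. weight \<pi> j s z * arm.profit q X W j (\<Gamma> j) s z \<partial>M)"
proof -
  have h: "\<And>j s. j < J \<Longrightarrow> integrable M (charge_rate j s)" "\<And>j. j < J \<Longrightarrow> summable (\<lambda>s. \<integral>z. \<bar>charge_rate j s z\<bar> \<partial>M)"
    using arm.integrable_charge[OF arm] arm.summable_charge[OF arm] by auto
  have r: "\<And>j s. j < J \<Longrightarrow> integrable M (reward_rate j s)" "\<And>j. j < J \<Longrightarrow> summable (\<lambda>s. \<integral>z. \<bar>reward_rate j s z\<bar> \<partial>M)"
    using arm.integrable_reward[OF arm] arm.summable_reward[OF arm] by auto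
  have "(\<Sum>s. \<integral>z. weight \<pi> j s z * reward_rate j s z \<partial>M)
    = (\<Sum>s. \<integral>z. weight \<pi> j s z * charge_rate j s z \<partial>M) + (\<Sum>s. \<integral>z. weight \<pi> j s z * arm.profit q X W j (\<Gamma> j) s z \<partial>M)"
    if j: "j < J" for j
  proof -
    interpret A: arm M q F X W j "\<Gamma> j" "G j" by (rule arm[OF j])
    have ic: "integrable M (\<lambda>z. weight \<pi> j s z * charge_rate j s z)"
      and ir: "integrable M (\<lambda>z. weight \<pi> j s z * reward_rate j s z)" for s
      using integrable_weight_mult[OF \<pi>, of charge_rate j s, OF h j] integrable_weight_mult[OF \<pi>, of reward_rate j s, OF r j]
      by auto
    have eq: "weight \<pi> j s z * A.profit s z = weight \<pi> j s z * reward_rate j s z - weight \<pi> j s z * charge_rate j s z" for s z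
      by (simp add: A.profit_def algebra_simps)
    have "(\<Sum>s. \<integral>z. weight \<pi> j s z * A.profit s z \<partial>M)
      = (\<Sum>s. (\<integral>z. weight \<pi> j s z * reward_rate j s z \<partial>M) - (\<integral>z. weight \<pi> j s z * charge_rate j s z \<partial>M))"
      unfolding eq Bochner_Integration.integral_diff[OF ir ic] ..
    also have "\<dots> = (\<Sum>s. \<integral>z. weight \<pi> j s z * reward_rate j s z \<partial>M) - (\<Sum>s. \<integral>z. weight \<pi> j s z * charge_rate j s z \<partial>M)"
      using summable_weight_mult[OF \<pi>, of charge_rate j, OF h j] summable_weight_mult[OF \<pi>, of reward_rate j, OF r j]
      by (intro suminf_diff[symmetric]) auto
    finally show ?thesis by simp
  qed
  moreover have "(\<integral>z. total \<pi> reward_rate z \<partial>M) = (\<Sum>j<J. \<Sum>s. \<integral>z. weight \<pi> j s z * reward_rate j s z \<partial>M)"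
    by (rule integral_total[OF \<pi>]) (fact r)+
  moreover have "(\<integral>z. total \<pi> charge_rate z \<partial>M) = (\<Sum>j<J. \<Sum>s. \<integral>z. weight \<pi> j s z * charge_rate j s z \<partial>M)"
    by (rule integral_total[OF \<pi>]) (fact h)+
  ultimately show ?thesis by (simp add: sum.distrib[symmetric])
qed

theorem gittins_optimal:
  assumes \<pi>: "strategy \<pi>"
    and gittins: "\<And>t z j. z \<in> space M \<Longrightarrow> j < J \<Longrightarrow> \<Gamma> j (\<pi> t z j) z \<le> \<Gamma> (sel_arm \<pi> t z) (\<pi> t z (sel_arm \<pi> t z)) z"
    and \<pi>': "strategy \<pi>'"
  shows "(\<integral>z. total \<pi>' reward_rate z \<partial>M) \<le> (\<integral>z. total \<pi> reward_rate z \<partial>M)"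
proof -
  have "(\<Sum>s. \<integral>z. weight \<pi>' j s z * arm.profit q X W j (\<Gamma> j) s z \<partial>M) \<le> 0" if j: "j < J" for j
    by (rule weighted_profit_nonpos[OF j weight_meas[OF \<pi>' j] weight_bounds[OF \<pi>'] weight_decreasing[OF \<pi>']])
  then have "(\<Sum>j<J. \<Sum>s. \<integral>z. weight \<pi>' j s z * arm.profit q X W j (\<Gamma> j) s z \<partial>M) \<le> 0"
    by (intro sum_nonpos) simp
  then have "(\<integral>z. total \<pi>' reward_rate z \<partial>M) \<le> (\<integral>z. total \<pi>' charge_rate z \<partial>M)"
    unfolding integral_reward_split[OF \<pi>'] by simp
  also have "\<dots> \<le> (\<integral>z. total \<pi> charge_rate z \<partial>M)"
    using gittins by (rule gittins_maximizes_charge[OF \<pi> _ \<pi>'])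
  also have "\<dots> = (\<integral>z. total \<pi> reward_rate z \<partial>M)"
  proof -
    have "(\<Sum>s. \<integral>z. weight \<pi> j s z * arm.profit q X W j (\<Gamma> j) s z \<partial>M) = 0" if j: "j < J" for j
    proof (rule weighted_profit_zero[OF j weight_meas[OF \<pi> j] weight_bounds[OF \<pi>] weight_decreasing[OF \<pi>]])
      fix s
      show "AE z in M. weight \<pi> j (Suc s) z < weight \<pi> j s z \<longrightarrow> z \<in> arm.at_record M (\<Gamma> j) (Suc s)"
        using AE_index_real AE_space
      proof eventually_elim
        case (elim z)
        show ?case
        proof
          assume "weight \<pi> j (Suc s) z < weight \<pi> j s z"
          then obtain t where t: "\<pi> t z j = Suc s" "sel_arm \<pi> t z \<noteq> j"
            using weight_drop[OF \<pi> elim(2)] by blast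
          have "z \<in> arm.at_record M (\<Gamma> j) (\<pi> t z j)"
            by (rule gittins_switch_at_record[OF \<pi> _ elim(2) _ j t(2)]) (use gittins elim(1) in auto)
          then show "z \<in> arm.at_record M (\<Gamma> j) (Suc s)" by (simp add: t)
        qed
      qed
    qed
    then show ?thesis unfolding integral_reward_split[OF \<pi>] by simp
  qed
  finally show ?thesis .
qed

end

section \<open>Conditional values and existence of a Gittins strategy\<close>

context bandit
begin

lemma joint_sets: "sets (joint p) = sigma_sets (space M) (\<Union>i<J. sets (F i (p i)))"
  unfolding joint_sigma_def using F_Pow by (intro sets_measure_of) blast

lemma space_joint [simp]: "space (joint p) = space M"
  by (simp add: joint_sigma_def space_measure_of_conv)

lemma joint_subalgebra: "subalgebra M (joint p)"
  unfolding subalgebra_def space_joint joint_sets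
  using F_sets by (auto intro!: sets.sigma_sets_subset)

lemma joint_mono:
  assumes "\<And>i. i < J \<Longrightarrow> p i \<le> p' i"
  shows "sets (joint p) \<subseteq> sets (joint p')"
proof -
  have "sets (F i (p i)) \<subseteq> sets (F i (p' i))" if "i < J" for i
    by (rule arm.F_mono[OF arm[OF that] assms[OF that]])
  then show ?thesis unfolding joint_sets by (intro sigma_sets_mono') blast
qed

lemma joint_sfs: "sigma_finite_subalgebra M (joint p)"
  by (rule finite_measure_subalgebra_is_sigma_finite)
     (simp add: finite_measure_subalgebra_def finite_measure_subalgebra_axioms_def joint_subalgebra finite_measure_axioms)

lemma suminf_eq_total:
  assumes \<pi>: "strategy \<pi>" and z: "z \<in> space M"
  shows "(\<Sum>t. cX X \<pi> t z * disc_int q (cT W \<pi> t z) (cT W \<pi> (Suc t) z)) = total \<pi> reward_rate z"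
  unfolding total_def total_term[OF \<pi> z] cX_def ..

lemma integrable_total_reward: "strategy \<pi> \<Longrightarrow> integrable M (total \<pi> reward_rate)"
  by (rule integrable_total) (use arm.integrable_reward[OF arm] arm.summable_reward[OF arm] in auto)

text \<open>An event known at the start belongs to every \<open>joint s\<close>, so deciding on it
  once and for all between two strategies is admissible.\<close>

lemma strategy_if:
  assumes \<pi>: "strategy \<pi>" and \<pi>': "strategy \<pi>'"
    and A: "A \<in> sets (joint (\<lambda>_. 0))"
  shows "strategy (\<lambda>t z. if z \<in> A then \<pi>' t z else \<pi> t z)"
proof -
  have "{z \<in> space M. (if z \<in> A then \<pi>' t z else \<pi> t z) = s} \<in> sets (joint s)"
    if s: "\<forall>j\<ge>J. s j = 0" for t s
  proof -
    have "{z \<in> space M. (if z \<in> A then \<pi>' t z else \<pi> t z) = s}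
      = ({z \<in> space M. \<pi>' t z = s} \<inter> A) \<union> ({z \<in> space M. \<pi> t z = s} - A)"
      by auto
    moreover have "A \<in> sets (joint s)"
      using A joint_mono[of "\<lambda>_. 0" s] by auto
    moreover have "{z \<in> space M. \<pi>' t z = s} \<in> sets (joint s)"
      "{z \<in> space M. \<pi> t z = s} \<in> sets (joint s)"
      using \<pi> \<pi>' s unfolding is_strategy_def by blast+
    ultimately show ?thesis by auto
  qed
  then show ?thesis
    using \<pi> \<pi>' unfolding is_strategy_def by auto
qed

lemma total_cong:
  assumes "\<And>t. \<pi> t z = \<pi>' t z"
  shows "total \<pi> h z = total \<pi>' h z"
proof -
  have "op_weight \<pi> j s t z = op_weight \<pi>' j s t z" for j s t
    unfolding op_weight_def op_def sel_arm_def other_time_def by (simp only: assms)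
  then show ?thesis unfolding total_def by simp
qed

text \<open>Comparing expectations with the strategy that deviates only on an initial event
  \<open>A\<close> bounds the integral of the difference over \<open>A\<close>. As \<open>A\<close>
  is arbitrary, the conditional inequality follows.\<close>

theorem gittins_value_optimal:
  assumes \<pi>: "strategy \<pi>"
    and gittins: "\<And>t z j. z \<in> space M \<Longrightarrow> j < J \<Longrightarrow> \<Gamma> j (\<pi> t z j) z \<le> \<Gamma> (sel_arm \<pi> t z) (\<pi> t z (sel_arm \<pi> t z)) z"
    and \<pi>': "strategy \<pi>'"
  shows "AE z in M. value_fun M q F J X W \<pi>' z \<le> value_fun M q F J X W \<pi> z"
proof -
  let ?F0 = "joint (\<lambda>_. 0)"
  interpret S: sigma_finite_subalgebra M ?F0 by (rule joint_sfs)
  let ?R = "total \<pi> reward_rate" and ?R' = "total \<pi>' reward_rate"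
  have cond_value: "AE z in M. value_fun M q F J X W \<pi>0 z = real_cond_exp M ?F0 (total \<pi>0 reward_rate) z"
    if "strategy \<pi>0" for \<pi>0
    unfolding value_fun_def
  proof (rule S.real_cond_exp_cong)
    show m: "total \<pi>0 reward_rate \<in> borel_measurable M"
      by (rule borel_measurable_integrable[OF integrable_total_reward[OF that]])
    then show "(\<lambda>z. \<Sum>t. cX X \<pi>0 t z * disc_int q (cT W \<pi>0 t z) (cT W \<pi>0 (Suc t) z)) \<in> borel_measurable M"
      by (subst measurable_cong[OF suminf_eq_total[OF that]])
  qed (simp add: suminf_eq_total[OF that])
  note R = integrable_total_reward[OF \<pi>] and R' = integrable_total_reward[OF \<pi>']
  have D: "integrable M (\<lambda>z. ?R' z - ?R z)" using R R' by auto
  have "AE z in M. z \<in> space M \<longrightarrow> real_cond_exp M ?F0 (\<lambda>z. ?R' z - ?R z) z \<le> 0"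
  proof (rule S.real_cond_exp_nonpos_on[OF D])
    show "space M \<in> sets ?F0" using sets.top[of ?F0] by simp
    fix A assume A: "A \<in> sets ?F0"
    define \<sigma> where "\<sigma> = (\<lambda>t z. if z \<in> A then \<pi>' t z else \<pi> t z)"
    have \<sigma>: "strategy \<sigma>" unfolding \<sigma>_def by (rule strategy_if[OF \<pi> \<pi>' A])
    have split: "total \<sigma> reward_rate z - ?R z = indicator A z * (?R' z - ?R z)" for z
      using total_cong[of \<sigma> z \<pi>' reward_rate] total_cong[of \<sigma> z \<pi> reward_rate]
      by (cases "z \<in> A") (auto simp: \<sigma>_def)
    have "(\<integral>z. indicator A z * (?R' z - ?R z) \<partial>M) = (\<integral>z. total \<sigma> reward_rate z \<partial>M) - (\<integral>z. ?R z \<partial>M)"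
      unfolding split[symmetric] by (rule Bochner_Integration.integral_diff[OF integrable_total_reward[OF \<sigma>] R])
    also have "\<dots> \<le> 0"
      using gittins_optimal[OF \<pi> gittins \<sigma>] by simp
    finally show "(\<integral>z. indicator A z * (?R' z - ?R z) \<partial>M) \<le> 0" .
  qed
  then show ?thesis
    using S.real_cond_exp_diff[OF R' R] cond_value[OF \<pi>] cond_value[OF \<pi>'] AE_space
    by eventually_elim auto
qed

definition best :: "(nat \<Rightarrow> nat) \<Rightarrow> 'a \<Rightarrow> nat \<Rightarrow> bool" where
  "best p z j \<longleftrightarrow> j < J \<and> (\<forall>i<J. \<Gamma> i (p i) z \<le> \<Gamma> j (p j) z)"

text \<open>Ties go to the smallest arm number, which makes the selection a measurable function of
  the current indices.\<close>

definition choice :: "(nat \<Rightarrow> nat) \<Rightarrow> 'a \<Rightarrow> nat" where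
  "choice p z = (LEAST j. best p z j)"

primrec gittins_strategy :: "nat \<Rightarrow> 'a \<Rightarrow> nat \<Rightarrow> nat" where
  "gittins_strategy 0 z = (\<lambda>_. 0)"
| "gittins_strategy (Suc t) z =
    (gittins_strategy t z)(choice (gittins_strategy t z) z := Suc (gittins_strategy t z (choice (gittins_strategy t z) z)))"

lemma best_choice: "best p z (choice p z)"
proof -
  let ?V = "(\<lambda>j. \<Gamma> j (p j) z) ` {..<J}"
  have "Max ?V \<in> ?V" using J by (intro Max_in) (auto simp: lessThan_empty_iff)
  then obtain j where j: "j < J" "Max ?V = \<Gamma> j (p j) z" by auto
  have "\<Gamma> i (p i) z \<le> \<Gamma> j (p j) z" if "i < J" for i
    unfolding j(2)[symmetric] using that by (intro Max_ge) auto
  then have "best p z j" using j by (simp add: best_def)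
  then show ?thesis unfolding choice_def by (rule LeastI)
qed

lemma choice_eq_iff: "choice p z = j \<longleftrightarrow> best p z j \<and> (\<forall>i<j. \<not> best p z i)"
  using best_choice[of p z] Least_le[of "best p z"] not_less_Least[of _ "best p z"]
  unfolding choice_def by (metis antisym not_less)

lemma choice_sets: "{z \<in> space M. choice p z = j} \<in> sets (joint p)"
proof -
  let ?N = "joint p"
  have "\<Gamma> i (p i) \<in> borel_measurable ?N" if i: "i < J" for i
  proof (rule measurable_from_subalg)
    interpret A: arm M q F X W i "\<Gamma> i" "G i" by (rule arm[OF i])
    show "subalgebra ?N (F i (p i))"
      using i unfolding subalgebra_def space_joint joint_sets by (auto intro: sigma_sets.Basic)
    show "\<Gamma> i (p i) \<in> borel_measurable (F i (p i))"
      using A.Gittins unfolding is_gittins_index_def by blast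
  qed
  then have le: "{z \<in> space M. \<Gamma> i (p i) z \<le> \<Gamma> k (p k) z} \<in> sets ?N" if "i < J" "k < J" for i k
    using borel_measurable_le[of "\<Gamma> i (p i)" ?N "\<Gamma> k (p k)"] that by simp
  have best: "{z \<in> space M. best p z k} \<in> sets ?N" for k
  proof (cases "k < J")
    case True
    have "{z \<in> space M. best p z k} = (\<Inter>i\<in>{..<J}. {z \<in> space M. \<Gamma> i (p i) z \<le> \<Gamma> k (p k) z})"
      using True J by (auto simp: best_def)
    also have "\<dots> \<in> sets ?N" using True le J by (intro sets.finite_INT) (auto simp: lessThan_empty_iff)
    finally show ?thesis .
  qed (simp add: best_def)
  have "{z \<in> space M. choice p z = j} = {z \<in> space M. best p z j} - (\<Union>i\<in>{..<j}. {z \<in> space M. best p z i})"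
    by (auto simp: choice_eq_iff)
  also have "\<dots> \<in> sets ?N" by (intro sets.Diff sets.finite_UN best) auto
  finally show ?thesis .
qed

lemma gittins_strategy_sets:
  "{z \<in> space M. gittins_strategy t z = s} \<in> sets (joint s)"
proof (induction t arbitrary: s)
  case 0
  have "{z \<in> space M. gittins_strategy 0 z = s} = (if s = (\<lambda>_. 0) then space M else {})" by auto
  moreover have "space M \<in> sets (joint p)" for p using sets.top[of "joint p"] by simp
  ultimately show ?case by simp
next
  case (Suc t)
  \<comment> \<open>The state before arm \<open>j\<close> was operated. Truncated subtraction is
    harmless, because only arms with \<open>0 < s j\<close> are considered.\<close>
  let ?p = "\<lambda>j. s(j := s j - 1)"
  let ?E = "\<lambda>j. {z \<in> space M. gittins_strategy t z = ?p j} \<inter> {z \<in> space M. choice (?p j) z = j}"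
  have "{z \<in> space M. gittins_strategy (Suc t) z = s} = (\<Union>j\<in>{j \<in> {..<J}. 0 < s j}. ?E j)"
  proof (intro set_eqI iffI)
    fix z assume z: "z \<in> {z \<in> space M. gittins_strategy (Suc t) z = s}"
    define j where "j = choice (gittins_strategy t z) z"
    have s: "s = (gittins_strategy t z)(j := Suc (gittins_strategy t z j))" using z by (simp add: j_def)
    then have "gittins_strategy t z = ?p j" by simp
    moreover have "0 < s j" using s by simp
    moreover have "j < J" using best_choice[of "gittins_strategy t z" z] by (simp add: best_def j_def)
    ultimately show "z \<in> (\<Union>j\<in>{j \<in> {..<J}. 0 < s j}. ?E j)" using z j_def by auto
  next
    fix z assume "z \<in> (\<Union>j\<in>{j \<in> {..<J}. 0 < s j}. ?E j)"
    then obtain j where "0 < s j" "z \<in> space M" "gittins_strategy t z = ?p j" "choice (?p j) z = j" by blast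
    moreover from this have "gittins_strategy (Suc t) z = (?p j)(j := Suc (?p j j))"
      by (simp only: gittins_strategy.simps)
    ultimately show "z \<in> {z \<in> space M. gittins_strategy (Suc t) z = s}" by simp
  qed
  also have "\<dots> \<in> sets (joint s)"
  proof (intro sets.finite_UN)
    fix j
    have "sets (joint (?p j)) \<subseteq> sets (joint s)" by (rule joint_mono) simp
    then show "?E j \<in> sets (joint s)" using Suc.IH[of "?p j"] choice_sets[of "?p j" j] by blast
  qed simp
  finally show ?case .
qed

lemma sel_arm_gittins_strategy: "sel_arm gittins_strategy t z = choice (gittins_strategy t z) z"
  by (rule sel_armI) simp

lemma is_strategy_gittins: "strategy gittins_strategy"
proof -
  have choice_less: "choice p z < J" for p z using best_choice[of p z] by (simp add: best_def)
  have "(\<Sum>j<J. gittins_strategy t z j) = t" for t z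
  proof (induction t)
    case (Suc t)
    let ?a = "choice (gittins_strategy t z) z"
    have "?a \<in> {..<J}" using choice_less by simp
    then have "(\<Sum>j<J. gittins_strategy (Suc t) z j) = Suc (\<Sum>j<J. gittins_strategy t z j)"
      by (simp add: sum.remove[of "{..<J}" ?a])
    with Suc show ?case by simp
  qed simp
  moreover have "\<exists>j<J. gittins_strategy (Suc t) z = (gittins_strategy t z)(j := Suc (gittins_strategy t z j))" for t z
    using choice_less[of "gittins_strategy t z" z] by (intro exI[of _ "choice (gittins_strategy t z) z"]) simp
  ultimately show ?thesis
    unfolding is_strategy_def using gittins_strategy_sets by (simp del: gittins_strategy.simps(2))
qed

lemma gittins_strategy_index:
  "j < J \<Longrightarrow> \<Gamma> j (gittins_strategy t z j) z
    \<le> \<Gamma> (sel_arm gittins_strategy t z) (gittins_strategy t z (sel_arm gittins_strategy t z)) z"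
  using best_choice[of "gittins_strategy t z" z] by (simp add: sel_arm_gittins_strategy best_def)

end

theorem mainTheorem1:
  fixes M :: "'a measure" and q :: real and J :: nat
    and F :: "nat \<Rightarrow> nat \<Rightarrow> 'a measure"
    and X W :: "nat \<Rightarrow> nat \<Rightarrow> 'a \<Rightarrow> real"
    and G :: "nat \<Rightarrow> real measure"
    and \<Gamma> :: "nat \<Rightarrow> nat \<Rightarrow> 'a \<Rightarrow> ereal"
  assumes M: "prob_space M"
    and M_complete: "\<And>N A. N \<in> null_sets M \<Longrightarrow> A \<subseteq> N \<Longrightarrow> A \<in> sets M"
    and J: "J \<ge> 1"
    and q: "q > 0"
    and F_sub: "\<And>j s. j < J \<Longrightarrow> subalgebra M (F j s)"
    and F_mono: "\<And>j s. j < J \<Longrightarrow> sets (F j s) \<subseteq> sets (F j (Suc s))"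
    and F_compl: "\<And>j s. j < J \<Longrightarrow> null_sets M \<subseteq> sets (F j s)"
    and X_meas: "\<And>j s. j < J \<Longrightarrow> X j s \<in> borel_measurable (F j s)"
    and W_meas: "\<And>j s. j < J \<Longrightarrow> W j s \<in> borel_measurable (F j (Suc s))"
    and W_pos: "\<And>j s \<omega>. j < J \<Longrightarrow> \<omega> \<in> space M \<Longrightarrow> W j s \<omega> > 0"
    and W_law: "\<And>j s. j < J \<Longrightarrow> distr M borel (W j s) = G j"
    and W_iid: "\<And>j. j < J \<Longrightarrow> prob_space.indep_vars M (\<lambda>_. borel) (W j) UNIV"
    and W_indep: "\<And>j s. j < J \<Longrightarrow> prob_space.indep_set M (sets (F j s))
                     {W j s -` A \<inter> space M | A. A \<in> sets borel}"
    and F_indep: "prob_space.indep_sets M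
                     (\<lambda>j. sigma_sets (space M) (\<Union>s. sets (F j s))) {..<J}"
    and integr: "\<And>j. j < J \<Longrightarrow>
        (\<integral>\<^sup>+ \<omega>. (\<Sum>s. ennreal (\<bar>X j s \<omega>\<bar> *
            disc_int q (arm_time W j s \<omega>) (arm_time W j (Suc s) \<omega>))) \<partial>M) < \<infinity>"
    and Gittins: "\<And>j. j < J \<Longrightarrow> is_gittins_index M q F X W j (\<Gamma> j)"
  shows "(\<exists>\<pi>. is_strategy M F J \<pi> \<and>
            (\<forall>t. \<forall>\<omega>\<in>space M. \<forall>j<J. \<Gamma> j (\<pi> t \<omega> j) \<omega> \<le>
                 \<Gamma> (sel_arm \<pi> t \<omega>) (\<pi> t \<omega> (sel_arm \<pi> t \<omega>)) \<omega>))
       \<and> (\<forall>\<pi>. is_strategy M F J \<pi> \<longrightarrow>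
            (\<forall>t. \<forall>\<omega>\<in>space M. \<forall>j<J. \<Gamma> j (\<pi> t \<omega> j) \<omega> \<le>
                 \<Gamma> (sel_arm \<pi> t \<omega>) (\<pi> t \<omega> (sel_arm \<pi> t \<omega>)) \<omega>) \<longrightarrow>
            (\<forall>\<pi>'. is_strategy M F J \<pi>' \<longrightarrow>
               (AE \<omega> in M. value_fun M q F J X W \<pi>' \<omega> \<le> value_fun M q F J X W \<pi> \<omega>)))"
proof -
  interpret prob_space M by (rule M)
  have arm: "arm M q F X W j (\<Gamma> j) (G j)" if j: "j < J" for j
    using q F_sub[OF j] F_mono[OF j] X_meas[OF j] W_meas[OF j] W_pos[OF j] W_law[OF j] W_indep[OF j] integr[OF j] Gittins[OF j]
    by unfold_locales
  interpret bandit M q J F X W \<Gamma> G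
    by (intro bandit.intro bandit_axioms.intro prob_space_axioms J arm F_indep)
  show ?thesis
  proof (intro conjI allI impI)
    show "\<exists>\<pi>. is_strategy M F J \<pi> \<and> (\<forall>t. \<forall>\<omega>\<in>space M. \<forall>j<J. \<Gamma> j (\<pi> t \<omega> j) \<omega> \<le>
                 \<Gamma> (sel_arm \<pi> t \<omega>) (\<pi> t \<omega> (sel_arm \<pi> t \<omega>)) \<omega>)"
      using is_strategy_gittins gittins_strategy_index by blast
  qed (rule gittins_value_optimal; blast)
qed

end
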